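(* Let $G_D$ be a Lie group with Lie algebra $\mathfrak g=\mathfrak h\oplus_D\mathbb Re_7$, where $\mathfrak h$ is a codimension-one abelian ideal, and let $\varphi$ be a left-invariant $G_2$-structure on $G_D$. If $(\varphi,\nabla f,\lambda)$ is a closed non-torsion-free gradient Laplacian soliton on $G_D$ with $f$ non-constant, then $(G_D,g_\varphi)$ must be a Riemannian product $N\times\mathbb R^k$ and $f$ is constant on $N$.
   Context: A $G_2$-structure on a $7$-manifold is a $3$-form $\varphi$ such that at each point there is a basis $(e_i)$ of the tangent space with $\varphi=e^{127}+e^{347}+e^{567}+e^{135}-e^{146}-e^{236}-e^{245}$. It induces a metric $g_\varphi$ and orientation by $g_\varphi(X,Y)\,\mathrm{vol}_\varphi=\frac16\,\iota_X\varphi\wedge\iota_Y\varphi\wedge\varphi$, hence a Hodge star $*$. It is closed if $d\varphi=0$, torsion-free if $d\varphi=0$ and $d*\varphi=0$. The Hodge Laplacian on $3$-forms is $\Delta_\varphi=*d*d-d*d*$. $(\varphi,\nabla f,\lambda)$ is a closed gradient Laplacian soliton if $\varphi$ is closed, $\lambda\in\mathbb R$, $f$ is smooth, $\nabla f$ is complete and $\Delta_\varphi\varphi=\lambda\varphi+\mathcal L_{\nabla f}\varphi$; then $\mathrm{Hess} f=-g_\varphi(Q_\varphi\cdot,\cdot)-\frac13\lambda g_\varphi$, where $Q_\varphi=\mathrm{Ric}_\varphi-\frac1{12}\mathrm{tr}(\tau_\varphi^2)I+\frac12\tau_\varphi^2$ and $\tau_\varphi=-*d*\varphi$ is identified with a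 skew endomorphism by $\tau_\varphi(X,Y)=g_\varphi(\tau_\varphi X,Y)$. For a $6$-dimensional Lie algebra $\mathfrak h$ and a derivation $D$ of $\mathfrak h$, $\mathfrak g=\mathfrak h\oplus_D\mathbb Re_7$ is the Lie algebra with $[e_7,X]=D(X)$ for $X\in\mathfrak h$ and the bracket of $\mathfrak h$ on $\mathfrak h$; $G_D$ is the simply connected Lie group with this Lie algebra. The metric $g_\varphi$ satisfies $e_7\perp\mathfrak h$, $\|e_7\|=1$, and there is an orthonormal basis $e_1,\dots,e_6$ of $\mathfrak h$ for which $\varphi=\omega\wedge e^7+\rho^+$ with $\omega=e^{12}+e^{34}+e^{56}$, $\rho^+=e^{135}-e^{146}-e^{236}-e^{245}$. *)

theory Defs
  imports "HOL-Analysis.Analysis"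
begin

section \<open>Calculus on a Euclidean space\<close>

primrec Ck :: "nat \<Rightarrow> ('a::euclidean_space \<Rightarrow> 'b::real_normed_vector) \<Rightarrow> bool" where
  "Ck 0 F \<longleftrightarrow> continuous_on UNIV F"
| "Ck (Suc k) F \<longleftrightarrow> (\<forall>x. F differentiable (at x)) \<and>
     (\<forall>v. Ck k (\<lambda>x. frechet_derivative F (at x) v))"

definition smooth :: "('a::euclidean_space \<Rightarrow> 'b::real_normed_vector) \<Rightarrow> bool" where
  "smooth F \<longleftrightarrow> (\<forall>k. Ck k F)"

definition diffeomorphism :: "('a::euclidean_space \<Rightarrow> 'b::euclidean_space) \<Rightarrow> bool" where
  "diffeomorphism F \<longleftrightarrow> bij F \<and> smooth F \<and> smooth (inv F)"

definition complete_field :: "('a::euclidean_space \<Rightarrow> 'a) \<Rightarrow> bool" where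
  "complete_field X \<longleftrightarrow>
     (\<forall>p. \<exists>c. c 0 = p \<and> (\<forall>t::real. (c has_vector_derivative X (c t)) (at t)))"

definition lie_bracket :: "('a::euclidean_space \<Rightarrow> 'a) \<Rightarrow> ('a \<Rightarrow> 'a) \<Rightarrow> 'a \<Rightarrow> 'a" where
  "lie_bracket X Y p = frechet_derivative Y (at p) (X p) - frechet_derivative X (at p) (Y p)"


section \<open>Exterior algebra\<close>

text \<open>An exterior form of degree \<open>k\<close> is a function of the list of its \<open>k\<close> arguments;
  it is set to \<open>0\<close> on lists of any other length, so that equality of forms is equality of functions.\<close>

type_synonym 'a form = "'a list \<Rightarrow> real"

definition is_form :: "nat \<Rightarrow> ('a::euclidean_space) form \<Rightarrow> bool" where
  "is_form k \<alpha> \<longleftrightarrow>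
     (\<forall>vs. length vs \<noteq> k \<longrightarrow> \<alpha> vs = 0) \<and>
     (\<forall>vs i. length vs = k \<longrightarrow> i < k \<longrightarrow> linear (\<lambda>v. \<alpha> (vs[i := v]))) \<and>
     (\<forall>vs. length vs = k \<longrightarrow> \<not> distinct vs \<longrightarrow> \<alpha> vs = 0)"

text \<open>\<open>wedge k \<alpha> \<beta>\<close> for \<open>\<alpha>\<close> of degree \<open>k\<close>: a sum over shuffles, the set \<open>I\<close> being the positions of
  the arguments handed to \<open>\<alpha>\<close>; the sign is that of the number of inversions. With this
  normalisation \<open>e\<^sup>1 \<and> \<dots> \<and> e\<^sup>k\<close> is \<open>1\<close> on \<open>(e\<^sub>1, \<dots>, e\<^sub>k)\<close>.\<close>

definition wedge :: "nat \<Rightarrow> ('a::euclidean_space) form \<Rightarrow> 'a form \<Rightarrow> 'a form" where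
  "wedge k \<alpha> \<beta> vs =
     (\<Sum>I \<in> {I. I \<subseteq> {..<length vs} \<and> card I = k}.
        (-1) ^ card {(i, j). i \<in> I \<and> j \<notin> I \<and> j < i} * \<alpha> (nths vs I) * \<beta> (nths vs (- I)))"

definition iota :: "('a::euclidean_space) \<Rightarrow> 'a form \<Rightarrow> 'a form" where
  "iota X \<alpha> vs = \<alpha> (X # vs)"

definition inner_product_on :: "('a::euclidean_space) set \<Rightarrow> ('a \<Rightarrow> 'a \<Rightarrow> real) \<Rightarrow> bool" where
  "inner_product_on S g \<longleftrightarrow>
     (\<forall>u\<in>S. \<forall>v\<in>S. g u v = g v u) \<and>
     (\<forall>u\<in>S. \<forall>v\<in>S. \<forall>w\<in>S. \<forall>a b. g (a *\<^sub>R u + b *\<^sub>R v) w = a * g u w + b * g v w) \<and>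
     (\<forall>u\<in>S. u \<noteq> 0 \<longrightarrow> 0 < g u u)"

definition orthonormal_basis :: "(('a::euclidean_space) \<Rightarrow> 'a \<Rightarrow> real) \<Rightarrow> 'a set \<Rightarrow> bool" where
  "orthonormal_basis g B \<longleftrightarrow> finite B \<and> card B = DIM('a) \<and>
     (\<forall>u\<in>B. \<forall>v\<in>B. g u v = (if u = v then 1 else 0))"

definition volume_form :: "(('a::euclidean_space) \<Rightarrow> 'a \<Rightarrow> real) \<Rightarrow> 'a form \<Rightarrow> bool" where
  "volume_form g vol \<longleftrightarrow> is_form DIM('a) vol \<and>
     (\<forall>es. distinct es \<and> orthonormal_basis g (set es) \<longrightarrow> \<bar>vol es\<bar> = 1)"

text \<open>The Hodge star on \<open>k\<close>-forms with the convention \<open>\<alpha> \<and> *\<beta> = \<langle>\<alpha>, \<beta>\<rangle> vol\<close>: in an orthonormal basis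
  \<open>*\<alpha> = (1/k!) \<Sum> \<alpha>(e\<^sub>i, e\<^sub>j, \<dots>) vol(e\<^sub>i, e\<^sub>j, \<dots>, \<cdot>)\<close>, the sum being over all \<open>k\<close>-tuples of basis
  vectors. It does not depend on the orthonormal basis.\<close>

definition hodge_star :: "(('a::euclidean_space) \<Rightarrow> 'a \<Rightarrow> real) \<Rightarrow> 'a form \<Rightarrow> nat \<Rightarrow> 'a form \<Rightarrow> 'a form" where
  "hodge_star g vol k \<alpha> vs =
     (\<Sum>us \<in> {us. set us \<subseteq> (SOME B. orthonormal_basis g B) \<and> length us = k}.
        \<alpha> us * vol (us @ vs)) / fact k"

definition is_basis :: "(nat \<Rightarrow> 'a::euclidean_space) \<Rightarrow> bool" where
  "is_basis e \<longleftrightarrow> inj_on e {1..DIM('a)} \<and> independent (e ` {1..DIM('a)}) \<and>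
     span (e ` {1..DIM('a)}) = UNIV"

text \<open>For a basis \<open>e 1, \<dots>, e n\<close>: \<open>coform e [i]\<close> is the dual basis covector \<open>e\<^sup>i\<close>, and
  \<open>coform e [i, j, k]\<close> is \<open>e\<^sup>i \<and> e\<^sup>j \<and> e\<^sup>k\<close>.\<close>

fun coform :: "(nat \<Rightarrow> 'a::euclidean_space) \<Rightarrow> nat list \<Rightarrow> 'a form" where
  "coform e [] = (\<lambda>vs. if vs = [] then 1 else 0)"
| "coform e [i] =
     (\<lambda>vs. if length vs = 1 then representation (e ` {1..DIM('a)}) (hd vs) (e i) else 0)"
| "coform e (i # is) = wedge 1 (coform e [i]) (coform e is)"


section \<open>Differential forms\<close>

text \<open>Differential forms on a Euclidean space, in its global chart. The exterior derivative and the
  Lie derivative are the invariant formulas evaluated on constant vector fields \<open>v\<^sub>i\<close>, for which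
  \<open>[v\<^sub>i, v\<^sub>j] = 0\<close> and \<open>[X, v\<^sub>i] = - DX(v\<^sub>i)\<close>.\<close>

definition ext_deriv :: "(('a::euclidean_space) \<Rightarrow> 'a form) \<Rightarrow> 'a \<Rightarrow> 'a form" where
  "ext_deriv \<alpha> p vs =
     (\<Sum>i<length vs. (-1) ^ i *
        frechet_derivative (\<lambda>q. \<alpha> q (take i vs @ drop (Suc i) vs)) (at p) (vs ! i))"

definition lie_derivative :: "(('a::euclidean_space) \<Rightarrow> 'a) \<Rightarrow> ('a \<Rightarrow> 'a form) \<Rightarrow> 'a \<Rightarrow> 'a form" where
  "lie_derivative X \<alpha> p vs =
     frechet_derivative (\<lambda>q. \<alpha> q vs) (at p) (X p)
     + (\<Sum>i<length vs. \<alpha> p (vs[i := frechet_derivative X (at p) (vs ! i)]))"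

definition gradient :: "(('a::euclidean_space) \<Rightarrow> 'a \<Rightarrow> 'a \<Rightarrow> real) \<Rightarrow> ('a \<Rightarrow> real) \<Rightarrow> 'a \<Rightarrow> 'a" where
  "gradient g f p = (THE w. \<forall>v. g p w v = frechet_derivative f (at p) v)"


section \<open>\<open>G\<^sub>2\<close>-structures\<close>

definition omega_std :: "(nat \<Rightarrow> 'a::euclidean_space) \<Rightarrow> 'a form" where
  "omega_std e vs = coform e [1,2] vs + coform e [3,4] vs + coform e [5,6] vs"

definition rho_plus_std :: "(nat \<Rightarrow> 'a::euclidean_space) \<Rightarrow> 'a form" where
  "rho_plus_std e vs =
     coform e [1,3,5] vs - coform e [1,4,6] vs - coform e [2,3,6] vs - coform e [2,4,5] vs"

definition phi_std :: "(nat \<Rightarrow> 'a::euclidean_space) \<Rightarrow> 'a form" where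
  "phi_std e vs =
     coform e [1,2,7] vs + coform e [3,4,7] vs + coform e [5,6,7] vs
     + coform e [1,3,5] vs - coform e [1,4,6] vs - coform e [2,3,6] vs - coform e [2,4,5] vs"

definition G2_structure :: "(('a::euclidean_space) \<Rightarrow> 'a form) \<Rightarrow> bool" where
  "G2_structure \<phi> \<longleftrightarrow> DIM('a) = 7 \<and> (\<forall>vs. smooth (\<lambda>p. \<phi> p vs)) \<and>
     (\<forall>p. \<exists>e. is_basis e \<and> \<phi> p = phi_std e)"

definition G2_induces ::
  "('a::euclidean_space) form \<Rightarrow> ('a \<Rightarrow> 'a \<Rightarrow> real) \<Rightarrow> 'a form \<Rightarrow> bool" where
  "G2_induces \<phi> g vol \<longleftrightarrow> inner_product_on UNIV g \<and> volume_form g vol \<and>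
     (\<forall>X Y vs. length vs = DIM('a) \<longrightarrow>
        g X Y * vol vs = 1/6 * wedge 2 (iota X \<phi>) (wedge 2 (iota Y \<phi>) \<phi>) vs)"

definition g2_metric :: "('a::euclidean_space) form \<Rightarrow> 'a \<Rightarrow> 'a \<Rightarrow> real" where
  "g2_metric \<phi> = (THE g. \<exists>vol. G2_induces \<phi> g vol)"

definition g2_vol :: "('a::euclidean_space) form \<Rightarrow> 'a form" where
  "g2_vol \<phi> = (THE vol. G2_induces \<phi> (g2_metric \<phi>) vol)"

definition star :: "(('a::euclidean_space) \<Rightarrow> 'a form) \<Rightarrow> nat \<Rightarrow> ('a \<Rightarrow> 'a form) \<Rightarrow> 'a \<Rightarrow> 'a form" where
  "star \<phi> k \<alpha> p = hodge_star (g2_metric (\<phi> p)) (g2_vol (\<phi> p)) k (\<alpha> p)"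

definition closed_G2 :: "(('a::euclidean_space) \<Rightarrow> 'a form) \<Rightarrow> bool" where
  "closed_G2 \<phi> \<longleftrightarrow> (\<forall>p vs. ext_deriv \<phi> p vs = 0)"

definition torsion_free :: "(('a::euclidean_space) \<Rightarrow> 'a form) \<Rightarrow> bool" where
  "torsion_free \<phi> \<longleftrightarrow> closed_G2 \<phi> \<and> (\<forall>p vs. ext_deriv (star \<phi> 3 \<phi>) p vs = 0)"

definition hodge_laplacian ::
  "(('a::euclidean_space) \<Rightarrow> 'a form) \<Rightarrow> ('a \<Rightarrow> 'a form) \<Rightarrow> 'a \<Rightarrow> 'a form" where
  "hodge_laplacian \<phi> \<alpha> p vs =
     star \<phi> 4 (ext_deriv (star \<phi> 4 (ext_deriv \<alpha>))) p vs
     - ext_deriv (star \<phi> 5 (ext_deriv (star \<phi> 3 \<alpha>))) p vs"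

definition closed_gradient_laplacian_soliton ::
  "(('a::euclidean_space) \<Rightarrow> 'a form) \<Rightarrow> ('a \<Rightarrow> real) \<Rightarrow> real \<Rightarrow> bool" where
  "closed_gradient_laplacian_soliton \<phi> f lam \<longleftrightarrow>
     G2_structure \<phi> \<and> closed_G2 \<phi> \<and> smooth f \<and>
     complete_field (gradient (\<lambda>p. g2_metric (\<phi> p)) f) \<and>
     (\<forall>p vs. hodge_laplacian \<phi> \<phi> p vs =
        lam * \<phi> p vs + lie_derivative (gradient (\<lambda>p. g2_metric (\<phi> p)) f) \<phi> p vs)"


section \<open>The Lie group \<open>G\<^sub>D\<close>\<close>

text \<open>With \<open>\<hh> = \<real>\<^sup>6\<close> abelian, a derivation of \<open>\<hh>\<close> is just a linear map \<open>D\<close>. The Lie algebra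
  \<open>\<hh> \<oplus>\<^sub>D \<real>e\<^sub>7\<close> is the space \<open>\<real>\<^sup>6 \<times> \<real>\<close>, with \<open>e\<^sub>7 = (0, 1)\<close> and \<open>bracket_D D\<close> below. Its simply connected
  Lie group is the semidirect product of \<open>\<real>\<^sup>6\<close> by the one-parameter group \<open>exp(sD)\<close>, with
  multiplication \<open>mult_D D\<close>; the lemmas of this section show that this is a group and that
  its left-invariant vector fields have the bracket \<open>bracket_D D\<close>.\<close>

type_synonym GD = "(real ^ 6) \<times> real"

definition bracket_D :: "(real ^ 6 \<Rightarrow> real ^ 6) \<Rightarrow> GD \<Rightarrow> GD \<Rightarrow> GD" where
  "bracket_D D \<xi> \<eta> = (snd \<xi> *\<^sub>R D (fst \<eta>) - snd \<eta> *\<^sub>R D (fst \<xi>), 0)"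

definition exp_D :: "(real ^ 6 \<Rightarrow> real ^ 6) \<Rightarrow> real \<Rightarrow> real ^ 6 \<Rightarrow> real ^ 6" where
  "exp_D D s x = (\<Sum>n. (s ^ n / fact n) *\<^sub>R (D ^^ n) x)"

definition mult_D :: "(real ^ 6 \<Rightarrow> real ^ 6) \<Rightarrow> GD \<Rightarrow> GD \<Rightarrow> GD" where
  "mult_D D a b = (fst a + exp_D D (snd a) (fst b), snd a + snd b)"

definition left_invariant_field :: "(real ^ 6 \<Rightarrow> real ^ 6) \<Rightarrow> GD \<Rightarrow> GD \<Rightarrow> GD" where
  "left_invariant_field D \<xi> p = frechet_derivative (mult_D D p) (at 0) \<xi>"

definition left_invariant_form :: "(real ^ 6 \<Rightarrow> real ^ 6) \<Rightarrow> (GD \<Rightarrow> GD form) \<Rightarrow> bool" where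
  "left_invariant_form D \<phi> \<longleftrightarrow>
     (\<forall>a p vs. \<phi> (mult_D D a p) (map (frechet_derivative (mult_D D a) (at p)) vs) = \<phi> p vs)"

text \<open>The standing normalisation, on the Lie algebra (the tangent space at the identity \<open>0\<close>):
  \<open>e\<^sub>7 \<bottom> \<hh>\<close>, \<open>\<parallel>e\<^sub>7\<parallel> = 1\<close>, and \<open>\<hh>\<close> has an orthonormal basis with \<open>\<phi> = \<omega> \<and> e\<^sup>7 + \<rho>\<^sup>+\<close>.\<close>

definition normalised :: "GD form \<Rightarrow> bool" where
  "normalised \<phi>0 \<longleftrightarrow>
     (\<forall>x. g2_metric \<phi>0 (0, 1) (x, 0) = 0) \<and> g2_metric \<phi>0 (0, 1) (0, 1) = 1 \<and>
     (\<exists>e. is_basis e \<and> e 7 = (0, 1) \<and> (\<forall>i\<in>{1..6}. snd (e i) = 0) \<and>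
        (\<forall>i\<in>{1..6}. \<forall>j\<in>{1..6}. g2_metric \<phi>0 (e i) (e j) = (if i = j then 1 else 0)) \<and>
        \<phi>0 = (\<lambda>vs. wedge 2 (omega_std e) (coform e [7]) vs + rho_plus_std e vs))"

lemma exp_D_summable:
  fixes D :: "real ^ 6 \<Rightarrow> real ^ 6"
  assumes "linear D"
  shows "summable (\<lambda>n. (s ^ n / fact n) *\<^sub>R (D ^^ n) x)"
proof -
  obtain K where K: "\<And>x. norm (D x) \<le> K * norm x" and K0: "0 < K"
    using linear_bounded_pos[OF assms] by blast
  have pow: "norm ((D ^^ n) x) \<le> K ^ n * norm x" for n
  proof (induction n)
    case (Suc n)
    have "norm ((D ^^ Suc n) x) \<le> K * norm ((D ^^ n) x)" using K by simp
    also have "\<dots> \<le> K * (K ^ n * norm x)" using Suc K0 by (intro mult_left_mono) auto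
    finally show ?case by (simp add: mult_ac)
  qed simp
  have "summable (\<lambda>n. norm x * ((\<bar>s\<bar> * K) ^ n /\<^sub>R fact n))"
    by (intro summable_mult summable_exp_generic)
  then show ?thesis
  proof (rule summable_comparison_test[rotated], intro exI allI impI)
    fix n
    have "norm ((s ^ n / fact n) *\<^sub>R (D ^^ n) x) = \<bar>s\<bar> ^ n / fact n * norm ((D ^^ n) x)"
      by (simp add: power_abs)
    also have "\<dots> \<le> \<bar>s\<bar> ^ n / fact n * (K ^ n * norm x)" by (intro mult_left_mono pow) simp
    finally show "norm ((s ^ n / fact n) *\<^sub>R (D ^^ n) x) \<le> norm x * ((\<bar>s\<bar> * K) ^ n /\<^sub>R fact n)"
      by (simp add: power_mult_distrib field_simps)
  qed
qed

lemma funpow_linear: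
  assumes "linear (D :: 'a::real_vector \<Rightarrow> 'a)" shows "linear (D ^^ n)"
proof (induction n)
  case (Suc n)
  then show ?case using linear_compose[OF _ assms] by (metis funpow.simps(2))
qed (simp add: linear_iff)

lemma exp_D_linear:
  assumes "linear D" shows "linear (exp_D D s)"
proof (rule linearI)
  note [simp] = linear_add[OF funpow_linear[OF assms]] linear_cmul[OF funpow_linear[OF assms]]
  note S = exp_D_summable[OF assms]
  show "exp_D D s (x + y) = exp_D D s x + exp_D D s y" for x y
    unfolding exp_D_def by (simp add: suminf_add[OF S S] scaleR_right_distrib)
  show "exp_D D s (c *\<^sub>R x) = c *\<^sub>R exp_D D s x" for c x
    unfolding exp_D_def by (subst suminf_scaleR_right[OF S]) (simp add: mult.commute)
qed

lemma exp_D_0 [simp]: "exp_D D 0 x = x"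
proof -
  have "(\<lambda>n. ((0::real) ^ n / fact n) *\<^sub>R (D ^^ n) x) = (\<lambda>n. if n = 0 then x else 0)"
    by (auto simp: fun_eq_iff)
  then show ?thesis unfolding exp_D_def using sums_single[of 0 "\<lambda>_. x"] by (simp add: sums_iff)
qed

lemma exp_D_commute:
  assumes "linear D" shows "exp_D D s (D x) = D (exp_D D s x)"
proof -
  have bl: "bounded_linear D" using assms linear_conv_bounded_linear by blast
  show ?thesis unfolding exp_D_def
    by (subst bounded_linear.suminf[OF bl exp_D_summable[OF assms]])
       (simp add: linear_cmul[OF assms] funpow_swap1)
qed

lemma exp_D_has_vector_derivative:
  assumes "linear D"
  shows "((\<lambda>s. exp_D D s x) has_vector_derivative D (exp_D D s x)) (at s)"
proof -
  have "((\<lambda>s. exp_D D s x \<bullet> b) has_vector_derivative exp_D D s (D x) \<bullet> b) (at s)" for b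
  proof -
    define c where "c n = ((D ^^ n) x \<bullet> b) / fact n" for n
    have bl: "bounded_linear (\<lambda>v::real^6. v \<bullet> b)" by (rule bounded_linear_inner_left)
    have ser: "exp_D D t y \<bullet> b = (\<Sum>n. ((D ^^ n) y \<bullet> b) / fact n * t ^ n)"
      and smb: "summable (\<lambda>n. ((D ^^ n) y \<bullet> b) / fact n * t ^ n)" for t y
      using bounded_linear.suminf[OF bl exp_D_summable[OF assms, of t y]]
        bounded_linear.summable[OF bl exp_D_summable[OF assms, of t y]]
      unfolding exp_D_def by (simp_all add: mult.commute)
    have d: "diffs c n = ((D ^^ n) (D x) \<bullet> b) / fact n" for n
      by (simp add: diffs_def c_def funpow_swap1 field_simps del: of_nat_Suc)
    have "((\<lambda>t. \<Sum>n. c n * t ^ n) has_field_derivative (\<Sum>n. diffs c n * s ^ n)) (at s)"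
      by (rule termdiffs_strong_converges_everywhere) (use smb c_def in simp)
    then show ?thesis
      unfolding ser d c_def by (simp add: has_real_derivative_iff_has_vector_derivative)
  qed
  then have "((\<lambda>s. exp_D D s x) has_vector_derivative exp_D D s (D x)) (at s)"
    unfolding has_vector_derivative_def
    by (subst has_derivative_componentwise_within) simp
  then show ?thesis by (simp add: exp_D_commute[OF assms])
qed

lemma linear_ode_zero:
  fixes z :: "real \<Rightarrow> real ^ 6"
  assumes "linear D" and z: "\<And>t. (z has_vector_derivative D (z t)) (at t)" and "z 0 = 0"
  shows "z s = 0"
proof -
  have pos: "y s = 0"
    if A: "linear A" and y: "\<And>t. (y has_vector_derivative A (y t)) (at t)"
      and y0: "y 0 = 0" and s: "0 \<le> s"
    for A and y :: "real \<Rightarrow> real ^ 6" and s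
  proof -
    obtain K where K: "\<And>x. norm (A x) \<le> K * norm x"
      using linear_bounded_pos[OF A] by blast
    define h where "h t = exp (- (2 * K * t)) * (y t \<bullet> y t)" for t
    have dh: "(h has_real_derivative
        exp (- (2 * K * t)) * (2 * (y t \<bullet> A (y t)) - 2 * K * (y t \<bullet> y t))) (at t)" for t
    proof -
      have "((\<lambda>t. y t \<bullet> y t) has_vector_derivative (y t \<bullet> A (y t) + A (y t) \<bullet> y t)) (at t)"
        using bounded_bilinear.has_vector_derivative[OF bounded_bilinear_inner y y] .
      then have "((\<lambda>t. y t \<bullet> y t) has_real_derivative (2 * (y t \<bullet> A (y t)))) (at t)"
        by (simp add: has_real_derivative_iff_has_vector_derivative inner_commute)
      then show ?thesis unfolding h_def
        by (auto intro!: derivative_eq_intros simp: algebra_simps)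
    qed
    have "h s \<le> h 0"
    proof (rule DERIV_nonpos_imp_nonincreasing[OF s])
      fix t
      have "y t \<bullet> A (y t) \<le> norm (y t) * norm (A (y t))" by (rule norm_cauchy_schwarz)
      also have "\<dots> \<le> norm (y t) * (K * norm (y t))" by (intro mult_left_mono K) simp
      finally have "2 * (y t \<bullet> A (y t)) - 2 * K * (y t \<bullet> y t) \<le> 0"
        by (simp add: dot_square_norm power2_eq_square mult_ac)
      then show "\<exists>d. (h has_real_derivative d) (at t) \<and> d \<le> 0"
        using dh[of t] by (meson exp_ge_zero mult_nonneg_nonpos)
    qed
    then have "y s \<bullet> y s \<le> 0"
      using y0 by (simp add: h_def mult_le_0_iff not_le[symmetric])
    then show ?thesis by (meson inner_gt_zero_iff not_le)
  qed
  show ?thesis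
  proof (cases "0 \<le> s")
    case True
    then show ?thesis using pos[OF assms] by simp
  next
    case False
    have "((\<lambda>t. z (- t)) has_vector_derivative - D (z (- t))) (at t)" for t
    proof -
      have "(uminus has_vector_derivative - 1) (at t)"
        using has_vector_derivative_minus[OF has_vector_derivative_id] by force
      from vector_diff_chain_at[OF this z] show ?thesis by (simp add: o_def)
    qed
    then show ?thesis
      using pos[of "\<lambda>x. - D x" "\<lambda>t. z (- t)" "- s"] False assms linear_compose_neg by auto
  qed
qed

lemma exp_D_add:
  assumes "linear D" shows "exp_D D (s + t) x = exp_D D s (exp_D D t x)"
proof -
  let ?z = "\<lambda>s. exp_D D (s + t) x - exp_D D s (exp_D D t x)"
  have "((\<lambda>s. exp_D D (s + t) x) has_vector_derivative D (exp_D D (r + t) x)) (at r)" for r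
  proof -
    have "((\<lambda>s. s + t) has_vector_derivative 1) (at r)"
      using has_vector_derivative_add[OF has_vector_derivative_id has_vector_derivative_const] by force
    from vector_diff_chain_at[OF this exp_D_has_vector_derivative[OF assms]]
    show ?thesis by (simp add: o_def)
  qed
  then have "(?z has_vector_derivative D (?z r)) (at r)" for r
    using exp_D_has_vector_derivative[OF assms] unfolding linear_diff[OF assms]
    by (intro has_vector_derivative_diff)
  then have "?z s = 0" by (rule linear_ode_zero[OF assms]) simp
  then show ?thesis by simp
qed

lemma mult_D_group:
  assumes "linear D"
  shows "mult_D D (mult_D D a b) c = mult_D D a (mult_D D b c)"
    and "mult_D D 0 a = a" and "mult_D D a 0 = a"
    and "mult_D D a (- exp_D D (- snd a) (fst a), - snd a) = 0"
    and "mult_D D (- exp_D D (- snd a) (fst a), - snd a) a = 0"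
proof -
  note l = exp_D_linear[OF assms] and add = exp_D_add[OF assms]
  show "mult_D D (mult_D D a b) c = mult_D D a (mult_D D b c)"
    by (simp add: mult_D_def add linear_add[OF l] add.assoc)
  show "mult_D D 0 a = a" "mult_D D a 0 = a"
    "mult_D D (- exp_D D (- snd a) (fst a), - snd a) a = 0"
    by (simp_all add: mult_D_def prod_eq_iff linear_0[OF l])
  show "mult_D D a (- exp_D D (- snd a) (fst a), - snd a) = 0"
    by (simp add: mult_D_def prod_eq_iff linear_neg[OF l] add[symmetric])
qed

lemma mult_D_frechet_derivative:
  assumes "linear D"
  shows "frechet_derivative (mult_D D a) (at p) v = (exp_D D (snd a) (fst v), snd v)"
proof -
  have bl: "bounded_linear (exp_D D (snd a))"
    using exp_D_linear[OF assms] linear_conv_bounded_linear by blast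
  have "(mult_D D a has_derivative (\<lambda>v. (exp_D D (snd a) (fst v), snd v))) (at p)"
    unfolding mult_D_def[abs_def]
    by (auto intro!: derivative_eq_intros bounded_linear.has_derivative[OF bl])
  from frechet_derivative_at[OF this, symmetric] show ?thesis by simp
qed

lemma left_invariant_field_bracket:
  assumes "linear D"
  shows "lie_bracket (left_invariant_field D \<xi>) (left_invariant_field D \<eta>)
       = left_invariant_field D (bracket_D D \<xi> \<eta>)"
proof
  fix p
  note l = exp_D_linear[OF assms]
  have fd: "frechet_derivative (left_invariant_field D \<zeta>) (at p) v
      = (snd v *\<^sub>R D (exp_D D (snd p) (fst \<zeta>)), 0)" for \<zeta> v
  proof -
    have "((\<lambda>q. exp_D D (snd q) (fst \<zeta>)) has_derivative
            (\<lambda>v. snd v *\<^sub>R D (exp_D D (snd p) (fst \<zeta>)))) (at p)"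
      by (rule has_derivative_compose[OF bounded_linear.has_derivative[OF bounded_linear_snd
          has_derivative_ident] exp_D_has_vector_derivative[OF assms, unfolded has_vector_derivative_def]])
    then have "(left_invariant_field D \<zeta> has_derivative
            (\<lambda>v. (snd v *\<^sub>R D (exp_D D (snd p) (fst \<zeta>)), 0))) (at p)"
      unfolding left_invariant_field_def[abs_def] mult_D_frechet_derivative[OF assms]
      by (auto intro!: derivative_eq_intros)
    from frechet_derivative_at[OF this, symmetric] show ?thesis by simp
  qed
  show "lie_bracket (left_invariant_field D \<xi>) (left_invariant_field D \<eta>) p
       = left_invariant_field D (bracket_D D \<xi> \<eta>) p"
    unfolding lie_bracket_def fd
    by (simp add: left_invariant_field_def mult_D_frechet_derivative[OF assms] bracket_D_def
        linear_diff[OF l] linear_cmul[OF l] exp_D_commute[OF assms])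
qed


section \<open>Riemannian products with \<open>\<real>\<^sup>k\<close>\<close>

text \<open>The product of \<open>N = \<real>\<^sup>7\<^sup>-\<^sup>k\<close> with an arbitrary Riemannian metric and the Euclidean \<open>\<real>\<^sup>k\<close> is realised on
  \<open>\<real>\<^sup>7\<close>: a set \<open>K\<close> of \<open>k\<close> indices carries the coordinates of \<open>\<real>\<^sup>k\<close>, the remaining ones those of \<open>N\<close>.\<close>

definition N_part :: "7 set \<Rightarrow> real ^ 7 \<Rightarrow> real ^ 7" where
  "N_part K y = (\<chi> i. if i \<in> K then 0 else y $ i)"

text \<open>\<open>F\<close> is an isometry of \<open>(N, h) \<times> \<real>\<^sup>k\<close> onto the Riemannian manifold with metric \<open>g\<close>.\<close>

definition riemannian_product_isometry ::
  "nat \<Rightarrow> 7 set \<Rightarrow> (real ^ 7 \<Rightarrow> real ^ 7 \<Rightarrow> real ^ 7 \<Rightarrow> real) \<Rightarrow>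
   (('a::euclidean_space) \<Rightarrow> 'a \<Rightarrow> 'a \<Rightarrow> real) \<Rightarrow> (real ^ 7 \<Rightarrow> 'a) \<Rightarrow> bool" where
  "riemannian_product_isometry k K h g F \<longleftrightarrow>
     card K = k \<and>
     (\<forall>y \<in> range (N_part K). inner_product_on (range (N_part K)) (h y)) \<and>
     (\<forall>u \<in> range (N_part K). \<forall>v \<in> range (N_part K). smooth (\<lambda>y. h (N_part K y) u v)) \<and>
     diffeomorphism F \<and>
     (\<forall>y u v. g (F y) (frechet_derivative F (at y) u) (frechet_derivative F (at y) v) =
        h (N_part K y) (N_part K u) (N_part K v) + (\<Sum>i\<in>K. u $ i * v $ i))"

definition constant_on_N :: "7 set \<Rightarrow> (real ^ 7 \<Rightarrow> 'a) \<Rightarrow> ('a \<Rightarrow> real) \<Rightarrow> bool" where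
  "constant_on_N K F f \<longleftrightarrow> (\<forall>y y'. (\<forall>i\<in>K. y $ i = y' $ i) \<longrightarrow> f (F y) = f (F y'))"

end

theory Submission
  imports Defs
begin

text \<open>The hypotheses exclude each other: a closed gradient Laplacian soliton on \<open>G\<^sub>D\<close> with \<open>\<hh>\<close> abelian is
  torsion-free (\<open>is_torsion_free\<close>), so that the product decomposition holds vacuously in the
  non-torsion-free case.

  Closedness of \<open>\<phi> = \<omega> \<and> e\<^sup>7 + \<rho>\<close> says that \<open>D\<close> annihilates \<open>\<rho>\<close>, the real part of a complex volume form;
  hence \<open>D\<close> commutes with the complex structure \<open>J\<close> of \<open>\<hh>\<close> and is a complex \<open>3 \<times> 3\<close> matrix \<open>M\<close> of trace \<open>0\<close>
  (\<open>d_complex_linear\<close>). Put \<open>H = M + M\<^sup>*\<close>, twice the symmetric part of \<open>D\<close>. The form \<open>*d*\<phi>\<close> is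
  \<open>\<langle>JH\<cdot>, \<cdot>\<rangle>\<close> (\<open>torsion_values\<close>), and \<open>H = 0\<close> makes \<open>\<phi>\<close> torsion-free (\<open>torsion_free_if_H_zero\<close>).

  In the left-invariant frame everything except \<open>f\<close> has constant coefficients, so the soliton equation
  becomes, point by point, an algebraic relation between \<open>D\<close>, the components \<open>F\<^sub>i\<close> of \<open>\<nabla>f\<close> and the second
  derivatives \<open>G\<^sub>i\<^sub>j\<close> of \<open>f\<close> (\<open>soliton_frame\<close>). As \<open>\<hh>\<close> is abelian, \<open>\<Delta>\<phi>\<close> has no component along \<open>\<hh>\<close>; there the equation
  forces the block \<open>W\<close> of \<open>G\<close> along \<open>\<hh>\<close> to be complex linear with complex trace \<open>-\<lambda>\<close>, and the mixed
  derivatives \<open>G\<^sub>i\<^sub>7\<close> to vanish (\<open>G_complex_linear\<close>). In the components containing \<open>e\<^sup>7\<close>, the part of type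
  \<open>(2,0) + (0,2)\<close> says that \<open>H\<close> annihilates the \<open>\<hh>\<close>-component of \<open>\<nabla>f\<close>, whence \<open>H W = 0\<close> after differentiation
  (\<open>HW_zero\<close>), and the part of type \<open>(1,1)\<close> is \<open>2 W = H M + M\<^sup>* H + F\<^sub>7 H - (\<lambda> + G\<^sub>7\<^sub>7) I\<close> (\<open>W_matrix\<close>).

  Multiplying the last equation by \<open>H\<close> and taking traces gives \<open>tr H\<^sup>3 + F\<^sub>7 tr H\<^sup>2 = 0\<close>. If \<open>H \<noteq> 0\<close>, then
  \<open>F\<^sub>7 = \<partial>f/\<partial>s\<close> is therefore constant, so \<open>G\<^sub>7\<^sub>7 = 0\<close>, and the trace of the equation itself gives
  \<open>\<lambda> = tr H\<^sup>2\<close>. Multiplying by \<open>H\<^sup>2\<close> then gives \<open>tr H\<^sup>4 = F\<^sub>7\<^sup>2 tr H\<^sup>2 + (tr H\<^sup>2)\<^sup>2\<close>, whereas every trace-free \<open>3 \<times> 3\<close>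
  matrix satisfies \<open>2 tr H\<^sup>4 = (tr H\<^sup>2)\<^sup>2\<close>: a contradiction, as \<open>tr H\<^sup>2 > 0\<close>.\<close>

section \<open>Alternating forms\<close>

lemma is_form_length: "is_form k \<alpha> \<Longrightarrow> length vs \<noteq> k \<Longrightarrow> \<alpha> vs = 0"
  by (simp add: is_form_def)

lemma is_form_linear: "is_form k \<alpha> \<Longrightarrow> length vs = k \<Longrightarrow> i < k \<Longrightarrow> linear (\<lambda>v. \<alpha> (vs[i := v]))"
  by (simp add: is_form_def)

lemma is_form_linear_append:
  assumes "is_form k \<alpha>" "Suc (length us + length ws) = k"
  shows "linear (\<lambda>v. \<alpha> (us @ v # ws))"
  using is_form_linear[OF assms(1), of "us @ 0 # ws" "length us"] assms(2) by simp

lemma is_form_linear_Cons: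
  assumes "is_form (Suc k) \<alpha>" "length ws = k"
  shows "linear (\<lambda>v. \<alpha> (v # ws))"
  using is_form_linear_append[OF assms(1), of "[]" ws] assms(2) by simp

lemma is_form_repeat:
  assumes "is_form k \<alpha>"
  shows "\<alpha> (us @ v # ws @ v # xs) = 0"
proof (cases "length (us @ v # ws @ v # xs) = k")
  case True
  have "\<not> distinct (us @ v # ws @ v # xs)" by simp
  with assms True show ?thesis unfolding is_form_def by blast
qed (use assms is_form_length in blast)

lemma is_form_swap:
  assumes "is_form k \<alpha>"
  shows "\<alpha> (us @ b # a # ws) = - \<alpha> (us @ a # b # ws)"
proof (cases "Suc (Suc (length us + length ws)) = k")
  case True
  have l1: "linear (\<lambda>v. \<alpha> (us @ v # c # ws))" for c
    using is_form_linear_append[OF assms, of us "c # ws"] True by simp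
  have l2: "linear (\<lambda>v. \<alpha> (us @ c # v # ws))" for c
    using is_form_linear_append[OF assms, of "us @ [c]" ws] True by simp
  have z: "\<alpha> (us @ c # c # ws) = 0" for c using is_form_repeat[OF assms, of us c "[]" ws] by simp
  have "\<alpha> (us @ (a + b) # (a + b) # ws) = \<alpha> (us @ a # b # ws) + \<alpha> (us @ b # a # ws)"
    using linear_add[OF l1, of a b "a + b"] linear_add[OF l2, of a a b] linear_add[OF l2, of b a b] z by simp
  with z[of "a + b"] show ?thesis by simp
next
  case False
  then show ?thesis using is_form_length[OF assms] by simp
qed

lemma is_form_iota:
  assumes "is_form (Suc k) \<alpha>"
  shows "is_form k (iota v \<alpha>)"
  unfolding is_form_def iota_def
proof (intro conjI allI impI)
  fix vs :: "'a list" and i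
  assume "length vs = k" "i < k"
  then show "linear (\<lambda>w. \<alpha> (v # vs[i := w]))"
    using is_form_linear[OF assms, of "v # vs" "Suc i"] by simp
qed (use assms in \<open>auto simp: is_form_def\<close>)

lemma linear_combination:
  assumes "linear f" "linear g" shows "linear (\<lambda>v. a * f v + b * g v :: real)"
  using linear_compose_add[OF linear_compose_scale_right[OF assms(1), of a]
      linear_compose_scale_right[OF assms(2), of b]] by simp

lemma is_form_comb:
  assumes "is_form k \<alpha>" "is_form k \<beta>"
  shows "is_form k (\<lambda>vs. a * \<alpha> vs + b * \<beta> vs)"
  unfolding is_form_def
  using assms by (auto simp: is_form_def intro!: linear_combination)

text \<open>Alternation only has to be tested on adjacent arguments; this is what makes induction on the
  position of the repeated argument possible.\<close>

lemma is_formI: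
  assumes len: "\<And>vs. length vs \<noteq> k \<Longrightarrow> \<alpha> vs = 0"
    and lin: "\<And>us ws. Suc (length us + length ws) = k \<Longrightarrow> linear (\<lambda>v. \<alpha> (us @ v # ws))"
    and alt: "\<And>us v ws. \<alpha> (us @ v # v # ws) = 0"
  shows "is_form k \<alpha>"
  unfolding is_form_def
proof (intro conjI allI impI)
  fix vs :: "'a list" and i
  assume *: "length vs = k" "i < k"
  then show "linear (\<lambda>v. \<alpha> (vs[i := v]))"
    using lin[of "take i vs" "drop (Suc i) vs"] by (simp add: upd_conv_take_nth_drop)
next
  fix vs :: "'a list"
  assume vs: "length vs = k" "\<not> distinct vs"
  have swap: "\<alpha> (us @ a # b # ws) = - \<alpha> (us @ b # a # ws)" for us a b ws
  proof (cases "Suc (Suc (length us + length ws)) = k")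
    case True
    have l1: "linear (\<lambda>v. \<alpha> (us @ v # c # ws))" for c using lin[of us "c # ws"] True by simp
    have l2: "linear (\<lambda>v. \<alpha> (us @ c # v # ws))" for c using lin[of "us @ [c]" ws] True by simp
    have "\<alpha> (us @ (a + b) # (a + b) # ws) = \<alpha> (us @ a # b # ws) + \<alpha> (us @ b # a # ws)"
      using linear_add[OF l1, of a b "a + b"] linear_add[OF l2, of a a b] linear_add[OF l2, of b a b] alt by simp
    with alt[of us "a + b"] show ?thesis by simp
  next
    case False
    then show ?thesis using len by simp
  qed
  have "\<alpha> (us @ v # ws @ v # xs) = 0" for us v ws xs
  proof (induction ws arbitrary: us)
    case Nil
    then show ?case using alt by simp
  next
    case (Cons w ws)
    show ?case using Cons[of "us @ [w]"] swap[of us v w "ws @ v # xs"] by simp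
  qed
  moreover obtain us v ws xs where "vs = us @ [v] @ ws @ [v] @ xs"
    using not_distinct_decomp[OF vs(2)] by blast
  ultimately show "\<alpha> vs = 0" by simp
qed (use len in simp)

text \<open>A form is determined by its values on the lists of basis vectors.\<close>

lemma is_form_zero_on_span:
  assumes "is_form k \<alpha>"
    and "\<And>us. set us \<subseteq> B \<Longrightarrow> length us = k \<Longrightarrow> \<alpha> us = 0"
    and "set vs \<subseteq> span B"
  shows "\<alpha> vs = 0"
  using assms
proof (induction k arbitrary: \<alpha> vs)
  case 0
  then show ?case using is_form_length[OF 0(1), of vs] by (cases vs) auto
next
  case (Suc k)
  show ?case
  proof (cases vs)
    case Nil
    then show ?thesis using is_form_length[OF Suc(2)] by simp
  next
    case (Cons v ws)
    show ?thesis
    proof (cases "length ws = k")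
      case True
      have lin: "linear (\<lambda>v. \<alpha> (v # ws))" using is_form_linear_Cons[OF Suc(2) True] .
      have "\<alpha> (b # ws) = 0" if "b \<in> B" for b
        using Suc(1)[OF is_form_iota[OF Suc(2), of b], of ws] Suc(3,4) that Cons unfolding iota_def by simp
      then have "\<alpha> (v # ws) = 0"
        using linear_eq_0_on_span[OF lin, of B v] Suc(4) Cons by simp
      then show ?thesis using Cons by simp
    qed (use Cons is_form_length[OF Suc(2)] in simp)
  qed
qed

subsection \<open>The wedge product\<close>

lemma finite_card_subsets: "finite {I. I \<subseteq> {..<n::nat} \<and> card I = k}"
  by (rule finite_subset[of _ "Pow {..<n}"]) auto

lemma wedge_0: "wedge 0 \<alpha> \<beta> vs = \<alpha> [] * \<beta> vs"
proof -
  have "{I. I \<subseteq> {..<length vs} \<and> card I = 0} = {{}}"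
    by (auto dest: finite_subset[OF _ finite_lessThan])
  then show ?thesis by (simp add: wedge_def nths_all)
qed

lemma wedge_Nil: "wedge (Suc k) \<alpha> \<beta> [] = 0"
proof -
  have "{I. I \<subseteq> {..<length ([]::'a list)} \<and> card I = Suc k} = {}" by auto
  then show ?thesis unfolding wedge_def by (simp only: sum.empty)
qed

text \<open>The antiderivation property of contraction, \<open>\<iota>\<^sub>v(\<alpha> \<and> \<beta>) = \<iota>\<^sub>v\<alpha> \<and> \<beta> + (-1)\<^sup>k \<alpha> \<and> \<iota>\<^sub>v\<beta>\<close>: the shuffles are
  split according to which factor receives the first argument. Read as a recursion over the
  argument list it replaces the sum over shuffles in all that follows.\<close>

lemma wedge_Cons:
  "wedge (Suc k) \<alpha> \<beta> (v # vs) =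
     wedge k (iota v \<alpha>) \<beta> vs + (-1) ^ Suc k * wedge (Suc k) \<alpha> (iota v \<beta>) vs"
proof -
  define n where "n = length vs"
  define t where "t I = (-1::real) ^ card {(i, j). i \<in> I \<and> j \<notin> I \<and> j < i} *
      \<alpha> (nths (v # vs) I) * \<beta> (nths (v # vs) (- I))" for I :: "nat set"
  define A where "A = (\<lambda>I. insert 0 (Suc ` I)) ` {I. I \<subseteq> {..<n} \<and> card I = k}"
  define B where "B = image Suc ` {I. I \<subseteq> {..<n} \<and> card I = Suc k}"
  have fin: "finite I" if "I \<subseteq> {..<n}" for I using that finite_subset by blast
  have "{I. I \<subseteq> {..<length (v # vs)} \<and> card I = Suc k} = A \<union> B"
  proof (intro equalityI subsetI)
    fix I assume "I \<in> {I. I \<subseteq> {..<length (v # vs)} \<and> card I = Suc k}"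
    then have I: "I \<subseteq> {..<Suc n}" "card I = Suc k" by (auto simp: n_def)
    define I' where "I' = {j. Suc j \<in> I}"
    have I': "I' \<subseteq> {..<n}" using I by (auto simp: I'_def)
    have eq: "I = (if 0 \<in> I then insert 0 (Suc ` I') else Suc ` I')"
      unfolding I'_def by (auto simp: image_iff) (metis not0_implies_Suc)+
    show "I \<in> A \<union> B"
    proof (cases "0 \<in> I")
      case True
      then have e: "I = insert 0 (Suc ` I')" using eq by simp
      have "card I' = k" using I(2) fin[OF I'] by (subst (asm) e) (simp add: card_image)
      then show ?thesis using e I' unfolding A_def by blast
    next
      case False
      then have e: "I = Suc ` I'" using eq by simp
      have "card I' = Suc k" using I(2) by (subst (asm) e) (simp add: card_image)
      then show ?thesis using e I' unfolding B_def by blast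
    qed
  next
    fix I assume "I \<in> A \<union> B"
    moreover have "card (insert 0 (Suc ` I')) = Suc (card I')" if "I' \<subseteq> {..<n}" for I'
      using fin[OF that] by (simp add: card_image)
    moreover have "insert 0 (Suc ` I') \<subseteq> {..<Suc n}" "Suc ` I' \<subseteq> {..<Suc n}" "card (Suc ` I') = card I'"
      if "I' \<subseteq> {..<n}" for I' using that by (auto simp: card_image)
    moreover have "length (v # vs) = Suc n" by (simp add: n_def)
    ultimately show "I \<in> {I. I \<subseteq> {..<length (v # vs)} \<and> card I = Suc k}"
      unfolding A_def B_def by (smt (verit, best) Un_iff image_iff mem_Collect_eq)
  qed
  moreover have "finite A" "finite B" unfolding A_def B_def by (auto intro: finite_card_subsets)
  moreover have "A \<inter> B = {}" unfolding A_def B_def by auto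
  ultimately have "wedge (Suc k) \<alpha> \<beta> (v # vs) = sum t A + sum t B"
    unfolding wedge_def t_def[symmetric] by (simp add: sum.union_disjoint)
  moreover have "sum t A = wedge k (iota v \<alpha>) \<beta> vs"
  proof -
    have inj: "inj_on (\<lambda>I. insert 0 (Suc ` I)) {I. I \<subseteq> {..<n} \<and> card I = k}"
    proof (rule inj_onI)
      fix I I' :: "nat set" assume "insert 0 (Suc ` I) = insert 0 (Suc ` I')"
      then have "Suc ` I = Suc ` I'" by (auto simp: set_eq_iff)
      then show "I = I'" by (simp add: inj_image_eq_iff)
    qed
    have "t (insert 0 (Suc ` I)) = (-1) ^ card {(i, j). i \<in> I \<and> j \<notin> I \<and> j < i} *
        iota v \<alpha> (nths vs I) * \<beta> (nths vs (- I))" for I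
    proof -
      have "{(i, j). i \<in> insert 0 (Suc ` I) \<and> j \<notin> insert 0 (Suc ` I) \<and> j < i} =
          map_prod Suc Suc ` {(i, j). i \<in> I \<and> j \<notin> I \<and> j < i}" (is "?L = ?R")
      proof (rule set_eqI)
        fix x :: "nat \<times> nat"
        obtain i j where x: "x = (i, j)" by (cases x)
        show "x \<in> ?L \<longleftrightarrow> x \<in> ?R" unfolding x by (cases i; cases j) (auto simp: image_iff)
      qed
      then have "card {(i, j). i \<in> insert 0 (Suc ` I) \<and> j \<notin> insert 0 (Suc ` I) \<and> j < i} =
          card {(i, j). i \<in> I \<and> j \<notin> I \<and> j < i}"
        by (simp add: card_image inj_on_def)
      moreover have "nths (v # vs) (insert 0 (Suc ` I)) = v # nths vs I"
        "nths (v # vs) (- insert 0 (Suc ` I)) = nths vs (- I)"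
        by (auto simp: nths_Cons Compl_eq intro!: arg_cong2[where f = nths])
      ultimately show ?thesis by (simp only: t_def iota_def)
    qed
    then show ?thesis unfolding A_def wedge_def n_def[symmetric]
      by (subst sum.reindex[OF inj]) simp
  qed
  moreover have "sum t B = (-1) ^ Suc k * wedge (Suc k) \<alpha> (iota v \<beta>) vs"
  proof -
    have inj: "inj_on (image Suc) {I. I \<subseteq> {..<n} \<and> card I = Suc k}"
      by (rule inj_onI) (simp add: inj_image_eq_iff)
    have "t (Suc ` I) = (-1) ^ Suc k * ((-1) ^ card {(i, j). i \<in> I \<and> j \<notin> I \<and> j < i} *
        \<alpha> (nths vs I) * iota v \<beta> (nths vs (- I)))" if I: "I \<subseteq> {..<n}" "card I = Suc k" for I
    proof -
      have "{(i, j). i \<in> Suc ` I \<and> j \<notin> Suc ` I \<and> j < i} =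
          map_prod Suc Suc ` {(i, j). i \<in> I \<and> j \<notin> I \<and> j < i} \<union> (\<lambda>i. (Suc i, 0)) ` I"
        (is "?L = ?R")
      proof (rule set_eqI)
        fix x :: "nat \<times> nat"
        obtain i j where x: "x = (i, j)" by (cases x)
        show "x \<in> ?L \<longleftrightarrow> x \<in> ?R" unfolding x by (cases i; cases j) (auto simp: image_iff)
      qed
      moreover have "finite {(i, j). i \<in> I \<and> j \<notin> I \<and> j < i}"
        by (rule finite_subset[of _ "{..<n} \<times> {..<n}"]) (use I in auto)
      ultimately have "card {(i, j). i \<in> Suc ` I \<and> j \<notin> Suc ` I \<and> j < i} =
          card {(i, j). i \<in> I \<and> j \<notin> I \<and> j < i} + Suc k"
        using I fin[OF I(1)]
        by (simp, subst card_Un_disjoint) (auto simp: card_image inj_on_def)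
      moreover have "nths (v # vs) (Suc ` I) = nths vs I"
        "nths (v # vs) (- (Suc ` I)) = v # nths vs (- I)"
        by (auto simp: nths_Cons Compl_eq intro!: arg_cong2[where f = nths])
      ultimately show ?thesis by (simp add: t_def iota_def power_add)
    qed
    then show ?thesis unfolding B_def wedge_def n_def[symmetric]
      by (subst sum.reindex[OF inj]) (simp add: sum_distrib_left)
  qed
  ultimately show ?thesis by simp
qed

lemma wedge_zero_right: "wedge k \<alpha> (\<lambda>_. 0) vs = 0"
  by (simp add: wedge_def)

lemma iota_is_form_0: "is_form 0 \<beta> \<Longrightarrow> iota v \<beta> = (\<lambda>_. 0)"
  by (rule ext) (simp add: iota_def is_form_def)

lemma linear_iota:
  assumes "is_form k \<alpha>"
  shows "linear (\<lambda>v. iota v \<alpha> ws)"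
proof (cases "Suc (length ws) = k")
  case True
  then show ?thesis using is_form_linear_append[OF assms, of "[]" ws] by (simp add: iota_def)
next
  case False
  then have "(\<lambda>v. iota v \<alpha> ws) = (\<lambda>_. 0)" using is_form_length[OF assms] by (auto simp: iota_def)
  then show ?thesis by (simp add: linear_iff)
qed

lemma linear_wedge_left:
  assumes "\<And>us. linear (\<lambda>v. A v us)"
  shows "linear (\<lambda>v. wedge k (A v) \<beta> vs)"
  unfolding wedge_def
  by (rule linearI) (simp_all add: linear_add[OF assms] linear_cmul[OF assms] sum.distrib sum_distrib_left
      algebra_simps)

lemma linear_wedge_right:
  assumes "\<And>us. linear (\<lambda>v. A v us)"
  shows "linear (\<lambda>v. wedge k \<alpha> (A v) vs)"
  unfolding wedge_def
  by (rule linearI) (simp_all add: linear_add[OF assms] linear_cmul[OF assms] sum.distrib sum_distrib_left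
      algebra_simps)

lemma linear_wedge_Cons:
  assumes "is_form k \<alpha>" "is_form l \<beta>"
  shows "linear (\<lambda>v. wedge k \<alpha> \<beta> (v # ws))"
proof (cases k)
  case 0
  then show ?thesis
    using linear_combination[OF linear_iota[OF assms(2)] linear_iota[OF assms(2)], where a = "\<alpha> []" and b = 0]
    by (simp add: wedge_0 iota_def)
next
  case (Suc m)
  show ?thesis
    using linear_combination[OF linear_wedge_left[OF linear_iota[OF assms(1)], where k = m and \<beta> = \<beta> and vs = ws]
        linear_wedge_right[OF linear_iota[OF assms(2)], where k = k and \<alpha> = \<alpha> and vs = ws], where a = 1 and b = "(-1) ^ Suc m"]
    unfolding Suc wedge_Cons by simp
qed

text \<open>All three clauses follow by moving contractions inside the product. For the alternation clause the
  antiderivation property gives \<open>\<iota>\<^sub>v\<iota>\<^sub>v(\<alpha> \<and> \<beta>) = 0\<close>, the two mixed terms cancelling.\<close>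

lemma is_form_wedge:
  assumes "is_form k \<alpha>" "is_form l \<beta>"
  shows "is_form (k + l) (wedge k \<alpha> \<beta>)"
proof (rule is_formI)
  fix vs :: "'a list" assume "length vs \<noteq> k + l"
  with assms show "wedge k \<alpha> \<beta> vs = 0"
  proof (induction vs arbitrary: k l \<alpha> \<beta>)
    case Nil
    then show ?case by (cases k) (simp_all add: wedge_0 wedge_Nil is_form_length)
  next
    case (Cons v vs)
    show ?case
    proof (cases k)
      case 0
      then show ?thesis using Cons is_form_length[of l \<beta> "v # vs"] by (simp add: wedge_0)
    next
      case (Suc m)
      have 1: "wedge m (iota v \<alpha>) \<beta> vs = 0"
        using Cons.IH[of m "iota v \<alpha>" l \<beta>] Cons.prems Suc is_form_iota[of m \<alpha> v] by simp
      have 2: "wedge k \<alpha> (iota v \<beta>) vs = 0"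
      proof (cases l)
        case 0
        then show ?thesis using iota_is_form_0[of \<beta> v] Cons.prems by (simp add: wedge_zero_right)
      next
        case (Suc l')
        then show ?thesis using Cons.IH[of k \<alpha> l' "iota v \<beta>"] Cons.prems is_form_iota[of l' \<beta> v] by simp
      qed
      show ?thesis using 1 2 unfolding Suc wedge_Cons by simp
    qed
  qed
next
  fix us ws :: "'a list"
  show "linear (\<lambda>v. wedge k \<alpha> \<beta> (us @ v # ws))"
    using assms
  proof (induction us arbitrary: k l \<alpha> \<beta>)
    case Nil
    then show ?case using linear_wedge_Cons by simp
  next
    case (Cons u us)
    show ?case
    proof (cases k)
      case 0
      show ?thesis
      proof (cases "length (u # us) + Suc (length ws) = l")
        case True
        then have "linear (\<lambda>v. \<beta> ((u # us) @ v # ws))"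
          using is_form_linear_append[OF Cons.prems(2), of "u # us" ws] by simp
        then show ?thesis using 0 linear_combination[where a = "\<alpha> []" and b = 0] by (fastforce simp: wedge_0)
      next
        case False
        then show ?thesis using is_form_length[OF Cons.prems(2)] 0 by (simp add: wedge_0 linear_iff)
      qed
    next
      case (Suc m)
      have 1: "linear (\<lambda>v. wedge m (iota u \<alpha>) \<beta> (us @ v # ws))"
        using Cons.IH[of m "iota u \<alpha>" l \<beta>] Cons.prems Suc is_form_iota[of m \<alpha> u] by simp
      have 2: "linear (\<lambda>v. wedge k \<alpha> (iota u \<beta>) (us @ v # ws))"
      proof (cases l)
        case 0
        then show ?thesis using iota_is_form_0[of \<beta> u] Cons.prems
          by (simp add: wedge_zero_right linear_iff)
      next
        case (Suc l')
        then show ?thesis using Cons.IH[of k \<alpha> l' "iota u \<beta>"] Cons.prems is_form_iota[of l' \<beta> u] by simp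
      qed
      show ?thesis using linear_combination[OF 1 2, where a = 1 and b = "(-1) ^ Suc m"] unfolding Suc by (simp add: wedge_Cons)
    qed
  qed
next
  fix us ws :: "'a list" and v
  show "wedge k \<alpha> \<beta> (us @ v # v # ws) = 0"
    using assms
  proof (induction us arbitrary: k l \<alpha> \<beta>)
    case Nil
    have a: "iota v (iota v \<gamma>) = (\<lambda>_. 0)" if "is_form i \<gamma>" for i and \<gamma> :: "'a form"
      using is_form_repeat[OF that, of "[]" v "[]"] by (auto simp: iota_def)
    have b: "\<beta> (v # v # ws) = 0" using is_form_repeat[OF Nil(2), of "[]" v "[]"] by simp
    show ?case
    proof (cases k)
      case 0
      then show ?thesis using b by (simp add: wedge_0)
    next
      case (Suc m)
      show ?thesis
      proof (cases m)
        case 0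
        then show ?thesis unfolding Suc using a[OF Nil(2)]
          by (simp add: wedge_Cons wedge_0 wedge_zero_right iota_def)
      next
        case (Suc i)
        have "wedge i (\<lambda>_. 0) \<beta> ws = 0" by (simp add: wedge_def)
        then show ?thesis unfolding \<open>k = Suc m\<close> Suc using a[OF Nil(1)] a[OF Nil(2)]
          by (simp add: wedge_Cons wedge_zero_right)
      qed
    qed
  next
    case (Cons u us)
    show ?case
    proof (cases k)
      case 0
      then show ?thesis using is_form_repeat[OF Cons.prems(2), of "u # us" v "[]"] by (simp add: wedge_0)
    next
      case (Suc m)
      have 1: "wedge m (iota u \<alpha>) \<beta> (us @ v # v # ws) = 0"
        using Cons.IH[of m "iota u \<alpha>" l \<beta>] Cons.prems Suc is_form_iota[of m \<alpha> u] by simp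
      have 2: "wedge k \<alpha> (iota u \<beta>) (us @ v # v # ws) = 0"
      proof (cases l)
        case 0
        then show ?thesis using iota_is_form_0[of \<beta> u] Cons.prems by (simp add: wedge_zero_right)
      next
        case (Suc l')
        then show ?thesis using Cons.IH[of k \<alpha> l' "iota u \<beta>"] Cons.prems is_form_iota[of l' \<beta> u] by simp
      qed
      show ?thesis using 1 2 unfolding Suc by (simp add: wedge_Cons)
    qed
  qed
qed

subsection \<open>Full contraction over an orthonormal basis\<close>

lemma inner_product_on_linear:
  assumes "inner_product_on UNIV g"
  shows "linear (\<lambda>u. g u w)" "linear (\<lambda>w. g u w)"
proof -
  have c: "g (a *\<^sub>R u + b *\<^sub>R v) w = a * g u w + b * g v w" for a b u v w
    using assms unfolding inner_product_on_def by blast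
  have s: "g u v = g v u" for u v using assms unfolding inner_product_on_def by blast
  show l: "linear (\<lambda>u. g u w)" for w
    by (rule linearI) (use c[of 1 _ 1] c[of _ _ 0] in simp_all)
  have "(\<lambda>w. g u w) = (\<lambda>w. g w u)" using s by blast
  with l show "linear (\<lambda>w. g u w)" by simp
qed

lemma orthonormal_basis_expansion:
  fixes B :: "'a::euclidean_space set"
  assumes g: "inner_product_on UNIV g" and B: "orthonormal_basis g B"
  shows "v = (\<Sum>b\<in>B. g v b *\<^sub>R b)"
proof -
  note lin = inner_product_on_linear(1)[OF g]
  have fin: "finite B" and card: "card B = DIM('a)"
    and on: "\<And>u v. u \<in> B \<Longrightarrow> v \<in> B \<Longrightarrow> g u v = (if u = v then 1 else 0)"
    using B by (auto simp: orthonormal_basis_def)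
  have coeff: "g (\<Sum>b\<in>B. c b *\<^sub>R b) b' = c b'" if "b' \<in> B" for c b'
  proof -
    have "g (\<Sum>b\<in>B. c b *\<^sub>R b) b' = (\<Sum>b\<in>B. c b * g b b')"
      by (simp add: linear_sum[OF lin] linear_cmul[OF lin])
    also have "\<dots> = (\<Sum>b\<in>B. if b = b' then c b else 0)"
      by (rule sum.cong) (use on that in auto)
    finally show ?thesis using that fin by simp
  qed
  have "independent B"
  proof (subst independent_explicit_finite_subsets, intro allI impI ballI)
    fix A u b assume A: "A \<subseteq> B" "finite A" "(\<Sum>v\<in>A. u v *\<^sub>R v) = 0" "b \<in> A"
    have "(\<Sum>v\<in>B. (if v \<in> A then u v else 0) *\<^sub>R v) = (\<Sum>v\<in>A. u v *\<^sub>R v)"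
      using A fin by (intro sum.mono_neutral_cong_right) auto
    then show "u b = 0"
      using coeff[of b "\<lambda>v. if v \<in> A then u v else 0"] A linear_0[OF lin] by (auto split: if_splits)
  qed
  then have "v \<in> span B" using card_ge_dim_independent[of B UNIV] card by auto
  then obtain u where v: "v = (\<Sum>b\<in>B. u b *\<^sub>R b)" using fin by (auto simp: span_finite)
  have "(\<Sum>b\<in>B. u b *\<^sub>R b) = (\<Sum>b\<in>B. g v b *\<^sub>R b)"
    by (rule sum.cong) (use coeff v in auto)
  then show ?thesis using v by simp
qed

text \<open>Expanding one basis in the other, this is Parseval's identity.\<close>

lemma orthonormal_basis_trace:
  fixes F :: "'a::euclidean_space \<Rightarrow> 'a \<Rightarrow> real"
  assumes g: "inner_product_on UNIV g"
    and B: "orthonormal_basis g B" and B': "orthonormal_basis g B'"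
    and F1: "\<And>w. linear (\<lambda>u. F u w)" and F2: "\<And>u. linear (F u)"
  shows "(\<Sum>b\<in>B. F b b) = (\<Sum>b\<in>B'. F b b)"
proof -
  note lin = inner_product_on_linear(1)[OF g]
  have on: "\<And>u v. u \<in> B' \<Longrightarrow> v \<in> B' \<Longrightarrow> g u v = (if u = v then 1 else 0)" and fin: "finite B'"
    using B' by (auto simp: orthonormal_basis_def)
  have sym: "g u v = g v u" for u v using g by (simp add: inner_product_on_def)
  have parseval: "(\<Sum>b\<in>B. g b c * g b c') = g c c'" for c c'
    by (subst (2) orthonormal_basis_expansion[OF g B, of c])
      (simp add: linear_sum[OF lin] linear_cmul[OF lin] sym[of c])
  have "F b b = (\<Sum>c\<in>B'. \<Sum>c'\<in>B'. g b c * g b c' * F c c')" for b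
  proof -
    have "F b b = F (\<Sum>c\<in>B'. g b c *\<^sub>R c) (\<Sum>c'\<in>B'. g b c' *\<^sub>R c')"
      using orthonormal_basis_expansion[OF g B', of b] by simp
    also have "\<dots> = (\<Sum>c\<in>B'. g b c * (\<Sum>c'\<in>B'. g b c' * F c c'))"
      by (simp only: linear_sum[OF F1] linear_cmul[OF F1], simp only: linear_sum[OF F2] linear_cmul[OF F2])
        (simp only: real_scaleR_def)
    finally show ?thesis by (simp add: sum_distrib_left mult.assoc)
  qed
  then have "(\<Sum>b\<in>B. F b b) = (\<Sum>c\<in>B'. \<Sum>c'\<in>B'. g c c' * F c c')"
    by (simp add: sum.swap[of _ _ B] sum_distrib_right[symmetric] parseval)
  also have "\<dots> = (\<Sum>c\<in>B'. \<Sum>c'\<in>B'. if c' = c then F c c' else 0)"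
    by (intro sum.cong) (auto simp: on)
  finally show ?thesis using fin by simp
qed

text \<open>The Hodge star contracts a form with the volume form over an orthonormal basis that its definition
  leaves unspecified. Seen as an iterated trace, the contraction is independent of this basis.\<close>

definition contraction :: "'a set \<Rightarrow> nat \<Rightarrow> ('a::euclidean_space) form \<Rightarrow> 'a form \<Rightarrow> real" where
  "contraction B k \<alpha> \<gamma> = (\<Sum>us \<in> {us. set us \<subseteq> B \<and> length us = k}. \<alpha> us * \<gamma> us)"

lemma contraction_0: "contraction B 0 \<alpha> \<gamma> = \<alpha> [] * \<gamma> []"
proof -
  have "{us. set us \<subseteq> B \<and> length us = 0} = {[]}" by auto
  then show ?thesis by (simp add: contraction_def)
qed

lemma contraction_Suc:
  "contraction B (Suc k) \<alpha> \<gamma> = (\<Sum>b\<in>B. contraction B k (iota b \<alpha>) (iota b \<gamma>))"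
proof -
  have "inj_on (\<lambda>(xs, n). n # xs) X" for X :: "('a list \<times> 'a) set" by (auto simp: inj_on_def)
  then have "contraction B (Suc k) \<alpha> \<gamma> =
      (\<Sum>(us, b)\<in>{us. set us \<subseteq> B \<and> length us = k} \<times> B. \<alpha> (b # us) * \<gamma> (b # us))"
    unfolding contraction_def lists_length_Suc_eq by (subst sum.reindex) (auto simp: case_prod_beta)
  also have "\<dots> = (\<Sum>b\<in>B. \<Sum>us\<in>{us. set us \<subseteq> B \<and> length us = k}. \<alpha> (b # us) * \<gamma> (b # us))"
    by (subst sum.cartesian_product[symmetric]) (rule sum.swap)
  finally show ?thesis by (simp add: contraction_def iota_def)
qed

lemma linear_contraction_left:
  assumes "\<And>us. linear (\<lambda>v. A v us)"
  shows "linear (\<lambda>v. contraction B k (A v) \<gamma>)"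
  unfolding contraction_def
  by (rule linearI) (simp_all add: linear_add[OF assms] linear_cmul[OF assms] sum.distrib sum_distrib_left
      algebra_simps)

lemma linear_contraction_right:
  assumes "\<And>us. linear (\<lambda>v. A v us)"
  shows "linear (\<lambda>v. contraction B k \<gamma> (A v))"
  unfolding contraction_def
  by (rule linearI) (simp_all add: linear_add[OF assms] linear_cmul[OF assms] sum.distrib sum_distrib_left
      algebra_simps)

lemma contraction_basis_independent:
  assumes g: "inner_product_on UNIV g"
    and B: "orthonormal_basis g B" and B': "orthonormal_basis g B'"
    and "is_form k \<alpha>" "is_form k \<gamma>"
  shows "contraction B k \<alpha> \<gamma> = contraction B' k \<alpha> \<gamma>"
  using assms(4,5)
proof (induction k arbitrary: \<alpha> \<gamma>)
  case 0
  then show ?case by (simp add: contraction_0)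
next
  case (Suc k)
  have "contraction B (Suc k) \<alpha> \<gamma> = (\<Sum>b\<in>B. contraction B' k (iota b \<alpha>) (iota b \<gamma>))"
    unfolding contraction_Suc using Suc by (intro sum.cong refl Suc.IH is_form_iota)
  also have "\<dots> = contraction B' (Suc k) \<alpha> \<gamma>"
    unfolding contraction_Suc
    by (rule orthonormal_basis_trace[OF g B B'])
      (intro linear_contraction_left linear_contraction_right linear_iota[OF Suc.prems(1)]
        linear_iota[OF Suc.prems(2)])+
  finally show ?case .
qed

lemma is_form_append:
  assumes "is_form (k + length vs) \<gamma>"
  shows "is_form k (\<lambda>us. \<gamma> (us @ vs))"
proof (rule is_formI)
  fix us :: "'a list" assume "length us \<noteq> k"
  then show "\<gamma> (us @ vs) = 0" using is_form_length[OF assms] by simp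
next
  fix us ws :: "'a list" assume "Suc (length us + length ws) = k"
  then show "linear (\<lambda>v. \<gamma> ((us @ v # ws) @ vs))"
    using is_form_linear_append[OF assms, of us "ws @ vs"] by simp
next
  show "\<gamma> ((us @ v # v # ws) @ vs) = 0" for us v ws
    using is_form_repeat[OF assms, of us v "[]" "ws @ vs"] by simp
qed

text \<open>Adjacent transpositions generate all permutations.\<close>

lemma adjacent_swap_invariant:
  assumes sw: "\<And>us a b ws. f (us @ a # b # ws) = f (us @ b # a # ws)"
    and "mset xs = mset ys"
  shows "f xs = f ys"
proof -
  have front: "f (us @ ys @ x # ws) = f (us @ x # ys @ ws)" for us ys x ws
  proof (induction ys arbitrary: us)
    case (Cons y ys)
    show ?case using Cons[of "us @ [y]"] sw[of us y x "ys @ ws"] by simp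
  qed simp
  have "f (us @ xs) = f (us @ ys)" if "mset xs = mset ys" for us
    using that
  proof (induction xs arbitrary: us ys)
    case (Cons x xs)
    then have "x \<in> set ys" by (metis list.set_intros(1) set_mset_mset)
    then obtain y1 y2 where ys: "ys = y1 @ x # y2" by (meson split_list)
    then have "mset xs = mset (y1 @ y2)" using Cons.prems by simp
    then have "f ((us @ [x]) @ xs) = f ((us @ [x]) @ y1 @ y2)" by (rule Cons.IH)
    then show ?case using front[of us y1 x y2] ys by simp
  qed simp
  from this[of "[]"] assms(2) show ?thesis by simp
qed

text \<open>Sorting the arguments changes a form only by a sign, so increasing lists of basis vectors suffice.\<close>

lemma is_form_zero_increasing:
  assumes \<alpha>: "is_form k \<alpha>"
    and zero: "\<And>js. sorted_wrt (<) js \<Longrightarrow> set js \<subseteq> I \<Longrightarrow> length js = k \<Longrightarrow> \<alpha> (map e (js :: nat list)) = 0"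
    and vs: "set vs \<subseteq> span (e ` I)"
  shows "\<alpha> vs = 0"
proof (rule is_form_zero_on_span[OF \<alpha> _ vs])
  fix us assume us: "set us \<subseteq> e ` I" "length us = k"
  then have "us \<in> lists (e ` I)" by auto
  then have "us \<in> map e ` lists I" unfolding lists_image .
  then obtain js where js: "us = map e js" "set js \<subseteq> I" by auto
  show "\<alpha> us = 0"
  proof (cases "distinct js")
    case True
    have "\<bar>\<alpha> (map e (xs @ a # b # ys))\<bar> = \<bar>\<alpha> (map e (xs @ b # a # ys))\<bar>" for xs a b ys
      using is_form_swap[OF \<alpha>, of "map e xs" "e a" "e b" "map e ys"] by simp
    then have "\<bar>\<alpha> (map e js)\<bar> = \<bar>\<alpha> (map e (sort js))\<bar>"
      by (rule adjacent_swap_invariant[where f = "\<lambda>js. \<bar>\<alpha> (map e js)\<bar>"]) simp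
    moreover have "\<alpha> (map e (sort js)) = 0"
      using True js us by (intro zero) (auto simp: strict_sorted_iff)
    ultimately show ?thesis using js by simp
  next
    case False
    then have "\<not> distinct us" using js by (simp add: distinct_map)
    then show ?thesis using \<alpha> us unfolding is_form_def by blast
  qed
qed

text \<open>If \<open>us\<close> and \<open>vs\<close> together enumerate the basis, only the \<open>k!\<close> reorderings of \<open>us\<close> contribute, and they
  contribute equally, since both factors change sign together.\<close>

lemma contraction_complementary:
  assumes \<alpha>: "is_form k \<alpha>" and \<gamma>: "is_form (k + length vs) \<gamma>"
    and B: "set (us @ vs) = B" "distinct (us @ vs)" "length us = k"
  shows "contraction B k \<alpha> (\<lambda>ws. \<gamma> (ws @ vs)) = fact k * (\<alpha> us * \<gamma> (us @ vs))"
proof -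
  have fin: "finite B" using B by auto
  define P where "P = {ws. length ws = k \<and> distinct ws \<and> set ws \<subseteq> set us}"
  have "contraction B k \<alpha> (\<lambda>ws. \<gamma> (ws @ vs)) = (\<Sum>ws\<in>P. \<alpha> ws * \<gamma> (ws @ vs))"
    unfolding contraction_def
  proof (rule sum.mono_neutral_right)
    show "finite {us. set us \<subseteq> B \<and> length us = k}" using fin by (rule finite_lists_length_eq)
    show "P \<subseteq> {us. set us \<subseteq> B \<and> length us = k}" using B unfolding P_def by auto
    show "\<forall>ws\<in>{us. set us \<subseteq> B \<and> length us = k} - P. \<alpha> ws * \<gamma> (ws @ vs) = 0"
    proof
      fix ws assume ws: "ws \<in> {us. set us \<subseteq> B \<and> length us = k} - P"
      have "\<not> distinct (ws @ vs)"
      proof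
        assume d: "distinct (ws @ vs)"
        then have "set ws \<subseteq> set us" using ws B by auto
        then show False using ws d unfolding P_def by auto
      qed
      moreover have "length (ws @ vs) = k + length vs" using ws by simp
      ultimately have "\<gamma> (ws @ vs) = 0" using \<gamma> unfolding is_form_def by blast
      then show "\<alpha> ws * \<gamma> (ws @ vs) = 0" by simp
    qed
  qed
  also have "\<dots> = (\<Sum>ws\<in>P. \<alpha> us * \<gamma> (us @ vs))"
  proof (rule sum.cong[OF refl])
    fix ws assume ws: "ws \<in> P"
    have "set ws = set us"
      using ws B unfolding P_def by (intro card_subset_eq) (auto simp: distinct_card)
    then have m: "mset ws = mset us"
      using ws B unfolding P_def by (simp add: set_eq_iff_mset_eq_distinct)
    show "\<alpha> ws * \<gamma> (ws @ vs) = \<alpha> us * \<gamma> (us @ vs)"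
    proof (rule adjacent_swap_invariant[where f = "\<lambda>ws. \<alpha> ws * \<gamma> (ws @ vs)", OF _ m])
      fix xs a b ys
      show "\<alpha> (xs @ a # b # ys) * \<gamma> ((xs @ a # b # ys) @ vs) = \<alpha> (xs @ b # a # ys) * \<gamma> ((xs @ b # a # ys) @ vs)"
        using is_form_swap[OF \<alpha>, of xs b a ys] is_form_swap[OF \<gamma>, of xs b a "ys @ vs"] by simp
    qed
  qed
  also have "card P = fact k"
  proof -
    have "card (set us) = k" using B distinct_card by auto
    then show ?thesis
      unfolding P_def by (subst card_lists_distinct_length_eq) (auto simp: fact_prod)
  qed
  then have "(\<Sum>ws\<in>P. \<alpha> us * \<gamma> (us @ vs)) = fact k * (\<alpha> us * \<gamma> (us @ vs))" by simp
  finally show ?thesis .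
qed

lemma hodge_star_contraction:
  "hodge_star g vol k \<alpha> vs = contraction (SOME B. orthonormal_basis g B) k \<alpha> (\<lambda>us. vol (us @ vs)) / fact k"
  by (simp add: hodge_star_def contraction_def)

lemma hodge_star_basis:
  assumes g: "inner_product_on UNIV g" and B: "orthonormal_basis g B"
    and \<alpha>: "is_form k \<alpha>" and vol: "is_form n vol"
  shows "hodge_star g vol k \<alpha> vs = contraction B k \<alpha> (\<lambda>us. vol (us @ vs)) / fact k"
proof (cases "k + length vs = n")
  case True
  have "orthonormal_basis g (SOME B. orthonormal_basis g B)" using B by (rule someI)
  then show ?thesis
    unfolding hodge_star_contraction
    using contraction_basis_independent[OF g _ B \<alpha>, of _ "\<lambda>us. vol (us @ vs)"] is_form_append[of k vs vol] True vol
    by simp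
next
  case False
  then have "contraction B' k \<alpha> (\<lambda>us. vol (us @ vs)) = 0" for B'
    unfolding contraction_def using is_form_length[OF vol] by (intro sum.neutral) auto
  then show ?thesis by (simp add: hodge_star_contraction)
qed

section \<open>The metric and the volume form of a \<open>G\<^sub>2\<close>-structure\<close>

lemma is_form_scale_all:
  assumes "is_form k \<alpha>" "length vs = k"
  shows "\<alpha> (map (\<lambda>v. r *\<^sub>R v) vs) = r ^ k * \<alpha> vs"
  using assms
proof (induction k arbitrary: \<alpha> vs)
  case (Suc k)
  then obtain v ws where vs: "vs = v # ws" "length ws = k" by (cases vs) auto
  have "\<alpha> (r *\<^sub>R v # map (\<lambda>v. r *\<^sub>R v) ws) = r * \<alpha> (v # map (\<lambda>v. r *\<^sub>R v) ws)"
    using linear_cmul[OF is_form_linear_Cons[OF Suc(2), of "map (\<lambda>v. r *\<^sub>R v) ws"], of r v] vs by simp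
  also have "\<dots> = r * (r ^ k * \<alpha> (v # ws))"
    using Suc(1)[OF is_form_iota[OF Suc(2), of v] vs(2)] by (simp add: iota_def)
  finally show ?case using vs by simp
qed simp

text \<open>The equation that defines the metric and the volume form leaves only a scaling \<open>g \<mapsto> c g\<close>,
  \<open>vol \<mapsto> vol / c\<close> free, and a volume form scales by \<open>c\<^sup>n\<^sup>/\<^sup>2\<close> under \<open>g \<mapsto> c g\<close>; hence \<open>c = 1\<close>.\<close>

lemma G2_induces_unique:
  fixes \<phi> :: "('a::euclidean_space) form"
  assumes I: "G2_induces \<phi> g vol" and I': "G2_induces \<phi> g' vol'" and B: "orthonormal_basis g B"
  shows "g' = g" "vol' = vol"
proof -
  have ip: "inner_product_on UNIV g" "inner_product_on UNIV g'"
    and f: "is_form DIM('a) vol" "is_form DIM('a) vol'"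
    and v: "\<And>es. distinct es \<Longrightarrow> orthonormal_basis g (set es) \<Longrightarrow> \<bar>vol es\<bar> = 1"
    and v': "\<And>es. distinct es \<Longrightarrow> orthonormal_basis g' (set es) \<Longrightarrow> \<bar>vol' es\<bar> = 1"
    and eq: "\<And>X Y vs. length vs = DIM('a) \<Longrightarrow> g X Y * vol vs = g' X Y * vol' vs"
    using I I' unfolding G2_induces_def volume_form_def by (auto, metis)
  obtain es where es: "distinct es" "set es = B"
    using B finite_distinct_list unfolding orthonormal_basis_def by blast
  have len: "length es = DIM('a)"
    using B es distinct_card[of es] unfolding orthonormal_basis_def by simp
  then obtain u where u: "u \<in> set es" by (metis DIM_positive list.set_sel(1) length_greater_0_conv)
  have guu: "g u u = 1" using B u es unfolding orthonormal_basis_def by auto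
  have "u \<noteq> 0" using guu linear_0[OF inner_product_on_linear(1)[OF ip(1)], of 0] by auto
  then have g'uu: "0 < g' u u" using ip(2) unfolding inner_product_on_def by auto
  have ves: "\<bar>vol es\<bar> = 1" using v es B by simp
  define c where "c = g' u u"
  have e1: "vol es = c * vol' es" using eq[OF len, of u u] guu by (simp add: c_def)
  have c0: "0 < c" using g'uu by (simp add: c_def)
  have v'0: "vol' es \<noteq> 0" using e1 ves by auto
  have g': "g' X Y = c * g X Y" for X Y
    using eq[OF len, of X Y] v'0 by (simp add: e1 mult.commute)
  have vol: "vol vs = c * vol' vs" if "length vs = DIM('a)" for vs
    using eq[OF that, of u u] guu by (simp add: c_def)
  define r where "r = 1 / sqrt c"
  have r0: "0 < r" and rc: "r * r * c = 1" using c0 by (simp_all add: r_def)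
  define es' where "es' = map (\<lambda>v. r *\<^sub>R v) es"
  have "distinct es'"
    unfolding es'_def using es r0 by (simp add: distinct_map inj_on_def)
  moreover have "orthonormal_basis g' (set es')"
  proof -
    have "card (set es') = DIM('a)"
      using distinct_card[OF \<open>distinct es'\<close>] len by (simp add: es'_def)
    moreover have "g' (r *\<^sub>R x) (r *\<^sub>R y) = (if x = y then 1 else 0)" if "x \<in> B" "y \<in> B" for x y
    proof -
      have "g' (r *\<^sub>R x) (r *\<^sub>R y) = r * r * c * g x y"
        by (simp add: g' linear_cmul[OF inner_product_on_linear(1)[OF ip(1)]]
            linear_cmul[OF inner_product_on_linear(2)[OF ip(1)]])
      then show ?thesis using B that rc unfolding orthonormal_basis_def by simp
    qed
    ultimately show ?thesis
      using r0 finite_set[of es] unfolding orthonormal_basis_def es'_def by (auto simp: es(2))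
  qed
  ultimately have "\<bar>vol' es'\<bar> = 1" by (rule v')
  moreover have "vol' es' = r ^ DIM('a) * vol' es"
    unfolding es'_def by (rule is_form_scale_all[OF f(2) len])
  moreover have "vol' es = r * r * vol es" using rc by (simp add: e1)
  ultimately have "r ^ DIM('a) * (r * r) = 1"
    using ves r0 by (simp add: abs_mult)
  then have "r ^ (DIM('a) + 2) = 1" by (simp add: power_add power2_eq_square mult_ac)
  then have "r = 1" using r0 power_eq_1_iff[of r "DIM('a) + 2"] by simp
  then have "c = 1" using rc by simp
  then show "g' = g" using g' by auto
  show "vol' = vol"
  proof
    fix vs show "vol' vs = vol vs"
    proof (cases "length vs = DIM('a)")
      case True
      then show ?thesis using vol \<open>c = 1\<close> by simp
    next
      case False
      then show ?thesis using f by (simp add: is_form_length)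
    qed
  qed
qed

lemma g2_metric_vol_eqI:
  assumes "G2_induces \<phi> g vol" "orthonormal_basis g B"
  shows "g2_metric \<phi> = g" "g2_vol \<phi> = vol"
proof -
  show m: "g2_metric \<phi> = g"
    unfolding g2_metric_def using assms G2_induces_unique(1)[OF assms(1) _ assms(2)] by blast
  show "g2_vol \<phi> = vol"
    unfolding g2_vol_def m using assms G2_induces_unique(2)[OF assms(1) _ assms(2)] by blast
qed

subsection \<open>Coordinates of a basis\<close>

definition coordinate :: "(nat \<Rightarrow> 'a::euclidean_space) \<Rightarrow> nat \<Rightarrow> 'a \<Rightarrow> real" where
  "coordinate e i v = representation (e ` {1..DIM('a)}) v (e i)"

definition frame_metric :: "(nat \<Rightarrow> 'a::euclidean_space) \<Rightarrow> 'a \<Rightarrow> 'a \<Rightarrow> real" where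
  "frame_metric e u v = (\<Sum>i = 1..DIM('a). coordinate e i u * coordinate e i v)"

definition frame_vol :: "(nat \<Rightarrow> 'a::euclidean_space) \<Rightarrow> 'a form" where
  "frame_vol e = coform e [1..<Suc DIM('a)]"

lemma linear_coordinate:
  fixes e :: "nat \<Rightarrow> 'a::euclidean_space"
  assumes "is_basis e"
  shows "linear (coordinate e i)"
  unfolding coordinate_def[abs_def] using assms unfolding is_basis_def
  by (intro linearI) (simp_all add: representation_add representation_scale)

lemma coordinate_basis:
  fixes e :: "nat \<Rightarrow> 'a::euclidean_space"
  assumes "is_basis e" "i \<in> {1..DIM('a)}" "j \<in> {1..DIM('a)}"
  shows "coordinate e i (e j) = (if i = j then 1 else 0)"
proof -
  have "independent (e ` {1..DIM('a)})" and inj: "inj_on e {1..DIM('a)}"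
    using assms(1) unfolding is_basis_def by auto
  then have "coordinate e i (e j) = (if e i = e j then 1 else 0)"
    unfolding coordinate_def using assms(3) by (subst representation_basis) auto
  then show ?thesis using inj_on_eq_iff[OF inj assms(2,3)] by simp
qed

lemma coordinate_expansion:
  fixes e :: "nat \<Rightarrow> 'a::euclidean_space"
  assumes "is_basis e"
  shows "v = (\<Sum>i = 1..DIM('a). coordinate e i v *\<^sub>R e i)"
proof -
  let ?B = "e ` {1..DIM('a)}"
  have "(\<Sum>b\<in>?B. representation ?B v b *\<^sub>R b) = v"
    using assms unfolding is_basis_def by (intro real_vector.sum_representation_eq) auto
  then show ?thesis
    using assms unfolding is_basis_def coordinate_def by (simp add: sum.reindex)
qed

lemma is_form_coform:
  fixes e :: "nat \<Rightarrow> 'a::euclidean_space"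
  assumes "is_basis e"
  shows "is_form (length js) (coform e js)"
proof -
  have one: "is_form 1 (coform e [i])" for i
  proof (rule is_formI)
    fix us ws :: "'a list" assume "Suc (length us + length ws) = 1"
    then show "linear (\<lambda>v. coform e [i] (us @ v # ws))"
      using linear_coordinate[OF assms, of i] by (simp add: coordinate_def[abs_def])
  qed auto
  show ?thesis
  proof (induction js rule: induct_list012)
    case 1
    then show ?case by (auto simp: is_form_def)
  next
    case (2 i)
    show ?case using one by simp
  next
    case (3 i j js)
    show ?case using is_form_wedge[OF one 3(2), of i] by simp
  qed
qed

lemma coform_Nil: "coform e [] vs = (if vs = [] then 1 else 0)"
  by simp

lemma coform_one: "coform e [i] [v] = coordinate e i v"
  by (simp add: coordinate_def)

lemma coform_Cons: "coform e (i # js) = wedge 1 (coform e [i]) (coform e js)" if "js \<noteq> []"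
  using that by (cases js) simp_all

lemma wedge_one_Cons:
  "wedge 1 \<alpha> \<beta> (v # vs) = \<alpha> [v] * \<beta> vs - wedge 1 \<alpha> (iota v \<beta>) vs"
  by (simp add: wedge_Cons wedge_0 iota_def)

lemma wedge_one_Nil: "wedge 1 \<alpha> \<beta> [] = 0"
  by (simp add: wedge_Nil)

lemma wedge_one_zero:
  assumes "\<And>v. v \<in> set vs \<Longrightarrow> \<alpha> [v] = 0"
  shows "wedge 1 \<alpha> \<beta> vs = 0"
  using assms
proof (induction vs arbitrary: \<beta>)
  case Nil
  then show ?case by (simp add: wedge_Nil)
next
  case (Cons v vs)
  then show ?case by (simp only: wedge_one_Cons) simp
qed

lemma coform_dual:
  fixes e :: "nat \<Rightarrow> 'a::euclidean_space"
  assumes "is_basis e" "distinct js" "set js \<subseteq> {1..DIM('a)}"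
  shows "coform e js (map e js) = 1"
  using assms(2,3)
proof (induction js)
  case (Cons j js)
  show ?case
  proof (cases "js = []")
    case True
    then show ?thesis using coordinate_basis[OF assms(1), of j j] Cons.prems
      by (simp del: coform.simps add: coform_one)
  next
    case False
    have "coform e [j] [v] = 0" if "v \<in> set (map e js)" for v
      unfolding coform_one using that coordinate_basis[OF assms(1)] Cons.prems by fastforce
    then show ?thesis
      unfolding coform_Cons[OF False] list.map wedge_one_Cons
      using wedge_one_zero[of "map e js" "coform e [j]"] coordinate_basis[OF assms(1), of j j] Cons
      by (simp del: coform.simps add: coform_one)
  qed
qed simp

text \<open>Bringing the argument \<open>e\<^sub>i\<close> to the front: the Laplace expansion of a basis form on basis vectors has at most
  one non-zero term.\<close>

lemma coform_basis_vectors: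
  fixes e :: "nat \<Rightarrow> 'a::euclidean_space"
  assumes e: "is_basis e" and i: "i \<in> {1..DIM('a)}" and js: "set js \<subseteq> {1..DIM('a)}" "distinct js" and ne: "ks \<noteq> []"
  shows "coform e (i # ks) (map e js) =
    (if i \<in> set js then (-1) ^ length (takeWhile (\<lambda>j. j \<noteq> i) js) * coform e ks (map e (remove1 i js)) else 0)"
proof -
  have "wedge 1 (coform e [i]) \<beta> (map e js) =
      (if i \<in> set js then (-1) ^ length (takeWhile (\<lambda>j. j \<noteq> i) js) * \<beta> (map e (remove1 i js)) else 0)" for \<beta>
    using js
  proof (induction js arbitrary: \<beta>)
    case Nil
    then show ?case by (simp only: list.map wedge_one_Nil) simp
  next
    case (Cons j js)
    have c: "coform e [i] [e j] = (if i = j then 1 else 0)" if "j \<in> {1..DIM('a)}" for j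
      unfolding coform_one using coordinate_basis[OF e i that] .
    show ?case
    proof (cases "i = j")
      case True
      have "coform e [i] [v] = 0" if v: "v \<in> set (map e js)" for v
      proof -
        obtain x where x: "v = e x" "x \<in> set js" using v by auto
        then have "x \<in> {1..DIM('a)}" "x \<noteq> i" using Cons True by auto
        then show ?thesis unfolding x(1) by (subst c) auto
      qed
      then have "wedge 1 (coform e [i]) (iota (e j) \<beta>) (map e js) = 0"
        by (rule wedge_one_zero)
      then show ?thesis using True Cons c[of j] by (simp only: list.map wedge_one_Cons) simp
    next
      case False
      then show ?thesis using Cons c[of j] by (simp only: list.map wedge_one_Cons) (simp add: iota_def)
    qed
  qed
  then show ?thesis unfolding coform_Cons[OF ne] .
qed

lemma inner_product_frame_metric:
  fixes e :: "nat \<Rightarrow> 'a::euclidean_space"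
  assumes "is_basis e"
  shows "inner_product_on UNIV (frame_metric e)"
proof -
  note lin = linear_coordinate[OF assms]
  have "0 < frame_metric e u u" if "u \<noteq> 0" for u
  proof -
    have "\<exists>i\<in>{1..DIM('a)}. coordinate e i u \<noteq> 0"
    proof (rule ccontr)
      assume "\<not> ?thesis"
      then have "(\<Sum>i = 1..DIM('a). coordinate e i u *\<^sub>R e i) = 0" by (intro sum.neutral) simp
      then show False using coordinate_expansion[OF assms, of u] that by metis
    qed
    then obtain i where i: "i \<in> {1..DIM('a)}" "coordinate e i u \<noteq> 0" by blast
    then have "0 < coordinate e i u * coordinate e i u" using not_real_square_gt_zero by blast
    then show ?thesis
      unfolding frame_metric_def using i(1) by (intro sum_pos2[of _ i]) auto
  qed
  then show ?thesis
    unfolding inner_product_on_def frame_metric_def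
    by (auto simp: linear_add[OF lin] linear_cmul[OF lin] sum.distrib sum_distrib_left algebra_simps)
qed

lemma frame_metric_basis:
  fixes e :: "nat \<Rightarrow> 'a::euclidean_space"
  assumes "is_basis e" "i \<in> {1..DIM('a)}" "j \<in> {1..DIM('a)}"
  shows "frame_metric e (e i) (e j) = (if i = j then 1 else 0)"
proof -
  have "frame_metric e (e i) (e j) = (\<Sum>k = 1..DIM('a). if k = i then (if i = j then 1 else 0) else 0)"
    unfolding frame_metric_def
  proof (rule sum.cong[OF refl])
    fix k assume k: "k \<in> {1..DIM('a)}"
    show "coordinate e k (e i) * coordinate e k (e j) = (if k = i then (if i = j then 1 else 0) else 0)"
      unfolding coordinate_basis[OF assms(1) k assms(2)] coordinate_basis[OF assms(1) k assms(3)] by simp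
  qed
  then show ?thesis using assms by simp
qed

lemma orthonormal_basis_frame:
  fixes e :: "nat \<Rightarrow> 'a::euclidean_space"
  assumes "is_basis e"
  shows "orthonormal_basis (frame_metric e) (e ` {1..DIM('a)})"
proof -
  have "inj_on e {1..DIM('a)}" using assms unfolding is_basis_def by blast
  moreover have "frame_metric e (e i) (e j) = (if e i = e j then 1 else 0)"
    if "i \<in> {1..DIM('a)}" "j \<in> {1..DIM('a)}" for i j
    using frame_metric_basis[OF assms that] inj_on_eq_iff[OF calculation that] by simp
  ultimately show ?thesis
    unfolding orthonormal_basis_def by (simp add: card_image del: One_nat_def)
qed

text \<open>The square of the volume form, contracted over any orthonormal basis, is \<open>n!\<close> times its squared value
  on that basis; so this value does not depend on the orthonormal basis.\<close>

lemma volume_form_frame_vol: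
  fixes e :: "nat \<Rightarrow> 'a::euclidean_space"
  assumes e: "is_basis e"
  shows "volume_form (frame_metric e) (frame_vol e)"
proof -
  let ?n = "DIM('a)" and ?B = "e ` {1..DIM('a)}" and ?vol = "frame_vol e" and ?g = "frame_metric e"
  have f: "is_form ?n ?vol"
    using is_form_coform[OF e, of "[1..<Suc ?n]"] unfolding frame_vol_def by simp
  have sq: "contraction (set us) ?n ?vol ?vol = fact ?n * (?vol us * ?vol us)"
    if "distinct us" "length us = ?n" for us
    using contraction_complementary[of ?n ?vol "[]" ?vol us] f that by simp
  define es where "es = map e [1..<Suc ?n]"
  have es: "distinct es" "set es = ?B" "length es = ?n"
    using e unfolding es_def is_basis_def
    by (simp_all only: distinct_map set_map set_upt atLeastLessThanSuc_atLeastAtMost distinct_upt length_map) simp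
  have "?vol es = 1"
    unfolding frame_vol_def es_def by (rule coform_dual[OF e]) auto
  then have c: "contraction ?B ?n ?vol ?vol = fact ?n"
    using sq[OF es(1,3)] es(2) by simp
  show ?thesis
    unfolding volume_form_def
  proof (intro conjI allI impI f)
    fix us assume us: "distinct us \<and> orthonormal_basis ?g (set us)"
    then have len: "length us = ?n" using distinct_card[of us] unfolding orthonormal_basis_def by simp
    have "fact ?n * (?vol us * ?vol us) = (fact ?n :: real)"
      using sq[OF _ len] us c
        contraction_basis_independent[OF inner_product_frame_metric[OF e] orthonormal_basis_frame[OF e] _ f f, of "set us"]
      by simp
    then have "?vol us * ?vol us = 1" by simp
    then show "\<bar>?vol us\<bar> = 1" by (metis abs_1 abs_mult_self_eq power2_eq_square real_sqrt_abs real_sqrt_one)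
  qed
qed

subsection \<open>The model three-form\<close>

lemma coform_two: "coform e [i, j] [u, v] =
    coordinate e i u * coordinate e j v - coordinate e i v * coordinate e j u"
  by (subst coform_Cons) (simp_all only: wedge_one_Cons wedge_one_Nil coform_one iota_def coform_Nil, simp_all)

lemma coform_three: "coform e [i, j, k] [u, v, w] =
    coordinate e i u * coform e [j, k] [v, w] - coordinate e i v * coform e [j, k] [u, w]
    + coordinate e i w * coform e [j, k] [u, v]"
  by (subst coform_Cons) (simp_all only: wedge_one_Cons wedge_one_Nil coform_one iota_def, simp_all)

lemma coform_four: "coform e [i, j, k, l] [u, v, w, x] =
    coordinate e i u * coform e [j, k, l] [v, w, x] - coordinate e i v * coform e [j, k, l] [u, w, x]
    + coordinate e i w * coform e [j, k, l] [u, v, x] - coordinate e i x * coform e [j, k, l] [u, v, w]"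
  by (subst coform_Cons) (simp_all only: wedge_one_Cons wedge_one_Nil coform_one iota_def, simp_all)

lemma is_form_phi_std:
  fixes e :: "nat \<Rightarrow> 'a::euclidean_space"
  assumes "is_basis e"
  shows "is_form 3 (phi_std e)"
proof -
  have c: "is_form 3 (coform e [i, j, k])" for i j k
    using is_form_coform[OF assms, of "[i, j, k]"] by (simp add: numeral_3_eq_3 del: coform.simps)
  have p: "is_form 3 (\<lambda>vs. \<alpha> vs + \<beta> vs)" "is_form 3 (\<lambda>vs. \<alpha> vs - \<beta> vs)"
    if "is_form 3 \<alpha>" "is_form 3 \<beta>" for \<alpha> \<beta> :: "'a form"
    using is_form_comb[OF that, of 1 1] is_form_comb[OF that, of 1 "-1"] by simp_all
  show ?thesis unfolding phi_std_def[abs_def] by (intro p c)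
qed

lemma is_form_top_zero:
  fixes e :: "nat \<Rightarrow> 'a::euclidean_space"
  assumes e: "is_basis e" and f: "is_form DIM('a) \<alpha>" and z: "\<alpha> (map e [1..<Suc DIM('a)]) = 0"
  shows "\<alpha> vs = 0"
proof (rule is_form_zero_increasing[OF f])
  show "set vs \<subseteq> span (e ` {1..DIM('a)})" using e unfolding is_basis_def by blast
  fix js :: "nat list"
  assume js: "sorted_wrt (<) js" "set js \<subseteq> {1..DIM('a)}" "length js = DIM('a)"
  then have srt: "sorted js" "distinct js" by (simp_all add: strict_sorted_iff)
  have "card (set js) = card {1..DIM('a)}" unfolding distinct_card[OF srt(2)] js(3) by simp
  then have "set js = {1..DIM('a)}" by (intro card_subset_eq js(2)) simp_all
  also have "\<dots> = set [1..<Suc DIM('a)]" by (simp only: set_upt atLeastLessThanSuc_atLeastAtMost)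
  finally have "js = [1..<Suc DIM('a)]"
    using srt by (intro sorted_distinct_set_unique sorted_upt distinct_upt)
  then show "\<alpha> (map e js) = 0" using z by simp
qed

lemma phi_std_eval: "phi_std e [u, v, w] =
    coform e [1,2,7] [u, v, w] + coform e [3,4,7] [u, v, w] + coform e [5,6,7] [u, v, w]
     + coform e [1,3,5] [u, v, w] - coform e [1,4,6] [u, v, w] - coform e [2,3,6] [u, v, w] - coform e [2,4,5] [u, v, w]"
  by (simp only: phi_std_def)

lemma wedge_two_Cons:
  "wedge 2 \<alpha> \<beta> (v # vs) = wedge 1 (iota v \<alpha>) \<beta> vs + wedge 2 \<alpha> (iota v \<beta>) vs"
  using wedge_Cons[of 1] by (simp add: numeral_2_eq_2)

lemma wedge_two_Nil: "wedge 2 \<alpha> \<beta> [] = 0"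
  by (simp add: numeral_2_eq_2 wedge_Nil)

text \<open>A term of the double sum over shuffles survives only if the factor without contraction receives one of
  the seven triples of \<open>\<phi>\<close>; there remain six ways to split the other four indices. Of these 42
  products of a coordinate of \<open>X\<close> with one of \<open>Y\<close>, the six for each \<open>X\<^sub>i Y\<^sub>i\<close> have sign \<open>+\<close> and there are no others.\<close>

lemma phi_std_metric_identity:
  fixes e :: "nat \<Rightarrow> 'a::euclidean_space"
  assumes e: "is_basis e" and dim: "DIM('a) = 7"
  shows "wedge 2 (iota X (phi_std e)) (wedge 2 (iota Y (phi_std e)) (phi_std e))
      [e 1, e 2, e 3, e 4, e 5, e 6, e 7] = 6 * frame_metric e X Y"
proof -
  have c: "coordinate e i (e j) = (if i = j then 1 else 0)" if "1 \<le> i" "i \<le> 7" "1 \<le> j" "j \<le> 7" for i j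
    using coordinate_basis[OF e] that dim by simp
  have s: "{1..7::nat} = {1,2,3,4,5,6,7}" by auto
  have fm: "frame_metric e X Y = coordinate e 1 X * coordinate e 1 Y + coordinate e 2 X * coordinate e 2 Y
    + coordinate e 3 X * coordinate e 3 Y + coordinate e 4 X * coordinate e 4 Y + coordinate e 5 X * coordinate e 5 Y
    + coordinate e 6 X * coordinate e 6 Y + coordinate e 7 X * coordinate e 7 Y"
    unfolding frame_metric_def dim s by simp
  show ?thesis
    unfolding fm
    by (simp only: wedge_two_Cons wedge_one_Cons wedge_two_Nil wedge_one_Nil iota_def)
      (simp add: phi_std_eval coform_three coform_two c del: One_nat_def coform.simps)
qed

lemma G2_induces_frame:
  fixes e :: "nat \<Rightarrow> 'a::euclidean_space"
  assumes e: "is_basis e" and dim: "DIM('a) = 7"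
  shows "G2_induces (phi_std e) (frame_metric e) (frame_vol e)"
  unfolding G2_induces_def
proof (intro conjI allI impI inner_product_frame_metric[OF e] volume_form_frame_vol[OF e])
  fix X Y :: 'a and vs :: "'a list"
  let ?\<phi> = "phi_std e"
  let ?w = "wedge 2 (iota X ?\<phi>) (wedge 2 (iota Y ?\<phi>) ?\<phi>)"
  have \<phi>: "is_form 3 ?\<phi>" by (rule is_form_phi_std[OF e])
  then have i: "is_form 2 (iota Z ?\<phi>)" for Z using is_form_iota[of 2] by (simp add: numeral_3_eq_3)
  have w: "is_form 7 ?w" using is_form_wedge[OF i[of X] is_form_wedge[OF i[of Y] \<phi>]] by simp
  have v: "is_form 7 (frame_vol e)" using is_form_coform[OF e, of "[1..<Suc 7]"] unfolding frame_vol_def dim length_upt by simp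
  have l: "map e [1..<Suc DIM('a)] = [e 1, e 2, e 3, e 4, e 5, e 6, e 7]"
    unfolding dim by (simp add: upt_rec[of 1 "numeral n" for n] del: One_nat_def)
  have "frame_vol e (map e [1..<Suc DIM('a)]) = 1"
    unfolding frame_vol_def by (rule coform_dual[OF e]) auto
  then have "1 * ?w vs + (- (6 * frame_metric e X Y)) * frame_vol e vs = 0"
    using is_form_top_zero[OF e, of "\<lambda>vs. 1 * ?w vs + (- (6 * frame_metric e X Y)) * frame_vol e vs" vs]
      is_form_comb[OF w v, of 1 "- (6 * frame_metric e X Y)"] phi_std_metric_identity[OF e dim, of X Y] l
    unfolding dim by (simp only: mult_1 mult_1_right add.right_inverse simp_thms)
  then show "frame_metric e X Y * frame_vol e vs = 1 / 6 * ?w vs" by simp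
qed

lemma g2_phi_std:
  fixes e :: "nat \<Rightarrow> 'a::euclidean_space"
  assumes e: "is_basis e" and dim: "DIM('a) = 7"
  shows "g2_metric (phi_std e) = frame_metric e" "g2_vol (phi_std e) = frame_vol e"
  using g2_metric_vol_eqI[OF G2_induces_frame[OF assms] orthonormal_basis_frame[OF e]] by auto

section \<open>Derivations and pull-backs of forms\<close>

text \<open>Up to sign, the action of the endomorphism \<open>A\<close> on forms.\<close>

definition derive_form :: "('a::euclidean_space \<Rightarrow> 'a) \<Rightarrow> 'a form \<Rightarrow> 'a form" where
  "derive_form A \<alpha> vs = (\<Sum>i<length vs. \<alpha> (vs[i := A (vs ! i)]))"

lemma derive_form_Nil: "derive_form A \<alpha> [] = 0"
  by (simp add: derive_form_def)

lemma derive_form_Cons: "derive_form A \<alpha> (v # vs) = \<alpha> (A v # vs) + derive_form A (iota v \<alpha>) vs"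
  unfolding derive_form_def iota_def by (simp add: sum.lessThan_Suc_shift del: sum.lessThan_Suc)

lemma linear_derive_form:
  assumes "\<And>us. linear (\<lambda>v. \<beta> v us)"
  shows "linear (\<lambda>v. derive_form A (\<beta> v) us)"
  unfolding derive_form_def
  by (rule linearI) (simp_all add: linear_add[OF assms] linear_cmul[OF assms] sum.distrib sum_distrib_left)

lemma is_form_derive_form:
  assumes A: "linear A" and "is_form k \<alpha>"
  shows "is_form k (derive_form A \<alpha>)"
proof (rule is_formI)
  fix vs :: "'a list" assume "length vs \<noteq> k"
  then show "derive_form A \<alpha> vs = 0"
    using is_form_length[OF assms(2)] by (simp add: derive_form_def)
next
  fix us ws :: "'a list" assume "Suc (length us + length ws) = k"
  then show "linear (\<lambda>v. derive_form A \<alpha> (us @ v # ws))"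
    using assms(2)
  proof (induction us arbitrary: k \<alpha>)
    case Nil
    have "linear (\<lambda>v. \<alpha> (A v # ws))"
      using linear_compose[OF A linear_iota[OF Nil(2), of ws]] by (simp add: iota_def o_def)
    then show ?case
      unfolding append_Nil derive_form_Cons
      by (intro linear_compose_add linear_derive_form[OF linear_iota[OF Nil(2)]])
  next
    case (Cons u us)
    then obtain m where m: "k = Suc m" "Suc (length us + length ws) = m" by auto
    have "linear (\<lambda>v. \<alpha> ((A u # us) @ v # ws))"
      using is_form_linear_append[OF Cons(3), of "A u # us" ws] m by simp
    moreover have "linear (\<lambda>v. derive_form A (iota u \<alpha>) (us @ v # ws))"
      using Cons(1)[OF m(2)] is_form_iota Cons(3) m by blast
    ultimately show ?case
      unfolding append_Cons derive_form_Cons by (intro linear_compose_add)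
  qed
next
  fix us ws :: "'a list" and v
  show "derive_form A \<alpha> (us @ v # v # ws) = 0"
    using assms(2)
  proof (induction us arbitrary: k \<alpha>)
    case Nil
    have "\<alpha> (v # v # xs) = 0" for xs using is_form_repeat[OF Nil, of "[]" v "[]" xs] by simp
    then have "derive_form A (iota v (iota v \<alpha>)) ws = 0" by (simp add: derive_form_def iota_def)
    moreover have "\<alpha> (v # A v # ws) = - \<alpha> (A v # v # ws)"
      using is_form_swap[OF Nil, of "[]" v "A v" ws] by simp
    ultimately show ?case by (simp add: derive_form_Cons iota_def)
  next
    case (Cons u us)
    have "\<alpha> (A u # us @ v # v # ws) = 0" using is_form_repeat[OF Cons(2), of "A u # us" v "[]" ws] by simp
    moreover have "derive_form A (iota u \<alpha>) (us @ v # v # ws) = 0"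
    proof (cases k)
      case 0
      then have "iota u \<alpha> = (\<lambda>_. 0)" using iota_is_form_0 Cons(2) by blast
      then show ?thesis unfolding derive_form_def by simp
    next
      case (Suc m)
      then show ?thesis using Cons(1) is_form_iota Cons(2) by blast
    qed
    ultimately show ?case by (simp add: derive_form_Cons)
  qed
qed

text \<open>The model objects of a frame are natural: the frame \<open>T\<^sup>-\<^sup>1 e\<close> yields the pull-backs by \<open>T\<close>.\<close>

lemma wedge_pullback:
  "wedge k (\<lambda>us. \<alpha> (map T us)) (\<lambda>us. \<beta> (map T us)) vs = wedge k \<alpha> \<beta> (map T vs)"
  by (simp add: wedge_def nths_map)

lemma is_form_pullback:
  assumes "linear T" "is_form k \<alpha>"
  shows "is_form k (\<lambda>us. \<alpha> (map T us))"
proof (rule is_formI)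
  fix us ws :: "'a list" assume "Suc (length us + length ws) = k"
  then show "linear (\<lambda>v. \<alpha> (map T (us @ v # ws)))"
    using linear_compose[OF assms(1) is_form_linear_append[OF assms(2), of "map T us" "map T ws"]]
    by (simp add: o_def)
next
  show "\<alpha> (map T (us @ v # v # ws)) = 0" for us v ws
    using is_form_repeat[OF assms(2), of "map T us" "T v" "[]" "map T ws"] by simp
qed (use is_form_length[OF assms(2)] in simp)

locale frame_change =
  fixes e :: "nat \<Rightarrow> 'a::euclidean_space" and T T' :: "'a \<Rightarrow> 'a"
  assumes e: "is_basis e" and T: "linear T" and T': "linear T'"
    and inv1: "T (T' v) = v" and inv2: "T' (T v) = v"
begin

lemma is_basis_change: "is_basis (\<lambda>i. T' (e i))"
proof -
  have inj: "inj T'" using inv1 by (metis injI)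
  have im: "(\<lambda>i. T' (e i)) ` {1..DIM('a)} = T' ` (e ` {1..DIM('a)})" by auto
  have "span (T' ` (e ` {1..DIM('a)})) = UNIV"
    using e inv2 unfolding is_basis_def by (subst linear_span_image[OF T']) (auto simp: surj_def, metis)
  moreover have "independent (T' ` (e ` {1..DIM('a)}))"
    using e inj_on_subset[OF inj subset_UNIV] unfolding is_basis_def
    by (intro linear_independent_injective_image[OF T']) auto
  moreover have "inj_on (\<lambda>i. T' (e i)) {1..DIM('a)}"
    using e comp_inj_on[of e "{1..DIM('a)}" T'] inj_on_subset[OF inj subset_UNIV] unfolding is_basis_def
    by (auto simp: o_def)
  ultimately show ?thesis unfolding is_basis_def im by blast
qed

lemma coordinate_change:
  assumes i: "i \<in> {1..DIM('a)}"
  shows "coordinate (\<lambda>i. T' (e i)) i v = coordinate e i (T v)"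
proof -
  let ?c = "coordinate (\<lambda>i. T' (e i))"
  have "T v = T (\<Sum>j = 1..DIM('a). ?c j v *\<^sub>R T' (e j))"
    using coordinate_expansion[OF is_basis_change, of v] by (rule arg_cong)
  also have "\<dots> = (\<Sum>j = 1..DIM('a). ?c j v *\<^sub>R e j)"
    by (simp only: linear_sum[OF T] linear_cmul[OF T] inv1)
  finally have "coordinate e i (T v) = (\<Sum>j = 1..DIM('a). ?c j v * coordinate e i (e j))"
    by (simp only: linear_sum[OF linear_coordinate[OF e]] linear_cmul[OF linear_coordinate[OF e]] real_scaleR_def)
  also have "\<dots> = (\<Sum>j = 1..DIM('a). if j = i then ?c j v else 0)"
    by (rule sum.cong[OF refl]) (use coordinate_basis[OF e i] in auto)
  finally show ?thesis using i by simp
qed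

lemma coform_change:
  assumes "set js \<subseteq> {1..DIM('a)}"
  shows "coform (\<lambda>i. T' (e i)) js vs = coform e js (map T vs)"
proof -
  have one: "coform (\<lambda>i. T' (e i)) [i] = (\<lambda>vs. coform e [i] (map T vs))" if "i \<in> {1..DIM('a)}" for i
  proof
    fix vs
    show "coform (\<lambda>i. T' (e i)) [i] vs = coform e [i] (map T vs)"
    proof (cases "length vs = 1")
      case True
      then obtain v where "vs = [v]" by (cases vs) auto
      then show ?thesis using coordinate_change[OF that] by (simp only: coform_one list.map)
    qed simp
  qed
  have "coform (\<lambda>i. T' (e i)) js = (\<lambda>vs. coform e js (map T vs))"
    using assms
  proof (induction js rule: induct_list012)
    case 1
    then show ?case by auto
  next
    case (2 i)
    then show ?case using one by simp
  next
    case (3 i j js)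
    have "coform (\<lambda>i. T' (e i)) (j # js) = (\<lambda>vs. coform e (j # js) (map T vs))"
      by (rule 3(2)) (use 3(3) in simp)
    moreover have "coform (\<lambda>i. T' (e i)) [i] = (\<lambda>vs. coform e [i] (map T vs))"
      by (rule one) (use 3(3) in simp)
    ultimately show ?case
      unfolding coform.simps(3) by (auto simp only: wedge_pullback)
  qed
  then show ?thesis by simp
qed

lemma frame_vol_change: "frame_vol (\<lambda>i. T' (e i)) vs = frame_vol e (map T vs)"
  unfolding frame_vol_def by (rule coform_change) auto

lemma phi_std_change:
  assumes "DIM('a) = 7"
  shows "phi_std (\<lambda>i. T' (e i)) vs = phi_std e (map T vs)"
proof -
  have "coform (\<lambda>i. T' (e i)) [i, j, k] vs = coform e [i, j, k] (map T vs)"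
    if "i \<in> {1..7}" "j \<in> {1..7}" "k \<in> {1..7}" for i j k
    by (rule coform_change) (use that assms in auto)
  then show ?thesis unfolding phi_std_def by simp
qed

lemma contraction_change:
  "contraction ((\<lambda>i. T' (e i)) ` I) k (\<lambda>us. \<alpha> (map T us)) (\<lambda>us. \<gamma> (map T us)) = contraction (e ` I) k \<alpha> \<gamma>"
  unfolding contraction_def
  by (rule sum.reindex_bij_witness[where i = "map T'" and j = "map T"])
    (auto simp: inv1 inv2 o_def map_idI)

end

subsection \<open>The Hodge star of a frame\<close>

definition frame_star :: "(nat \<Rightarrow> 'a::euclidean_space) \<Rightarrow> nat \<Rightarrow> 'a form \<Rightarrow> 'a form" where
  "frame_star e k \<alpha> vs = contraction (e ` {1..DIM('a)}) k \<alpha> (\<lambda>us. frame_vol e (us @ vs)) / fact k"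

lemma is_form_frame_vol:
  fixes e :: "nat \<Rightarrow> 'a::euclidean_space"
  assumes "is_basis e" shows "is_form DIM('a) (frame_vol e)"
  using volume_form_frame_vol[OF assms] unfolding volume_form_def by blast

lemma star_phi_std:
  assumes e: "is_basis e" and dim: "DIM('a::euclidean_space) = 7" and \<phi>: "\<phi> p = phi_std (e :: nat \<Rightarrow> 'a)"
    and \<alpha>: "is_form k (\<alpha> p)"
  shows "star \<phi> k \<alpha> p = frame_star e k (\<alpha> p)"
  unfolding star_def frame_star_def[abs_def] \<phi> g2_phi_std[OF e dim]
  by (rule ext) (rule hodge_star_basis[OF inner_product_frame_metric[OF e] orthonormal_basis_frame[OF e] \<alpha>
      is_form_frame_vol[OF e]])

lemma is_form_sum:
  assumes "\<And>i. i \<in> S \<Longrightarrow> is_form k (\<alpha> i)"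
  shows "is_form k (\<lambda>vs. \<Sum>i\<in>S. c i * \<alpha> i vs)"
  using assms
proof (induction S rule: infinite_finite_induct)
  case (insert i S)
  then show ?case using is_form_comb[of k "\<alpha> i" "\<lambda>vs. \<Sum>i\<in>S. c i * \<alpha> i vs" "c i" 1] by simp
qed (simp_all add: is_form_def linear_iff)

lemma is_form_prepend:
  assumes "is_form (length us + k) \<gamma>"
  shows "is_form k (\<lambda>vs. \<gamma> (us @ vs))"
  using assms
proof (induction us arbitrary: \<gamma>)
  case (Cons u us)
  then show ?case using is_form_iota[of "length us + k" \<gamma> u] by (auto simp: iota_def[abs_def])
qed simp

lemma is_form_frame_star:
  fixes e :: "nat \<Rightarrow> 'a::euclidean_space"
  assumes "is_basis e" "k + l = DIM('a)"
  shows "is_form l (frame_star e k \<alpha>)"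
proof -
  have eq: "frame_star e k \<alpha> = (\<lambda>vs. \<Sum>us \<in> {us. set us \<subseteq> e ` {1..DIM('a)} \<and> length us = k}.
      (\<alpha> us / fact k) * frame_vol e (us @ vs))"
    by (rule ext) (simp add: frame_star_def contraction_def sum_divide_distrib)
  show ?thesis
    unfolding eq using is_form_frame_vol[OF assms(1)] assms(2)
    by (intro is_form_sum is_form_prepend) auto
qed

lemma (in frame_change) frame_star_change:
  "frame_star (\<lambda>i. T' (e i)) k (\<lambda>us. \<alpha> (map T us)) vs = frame_star e k \<alpha> (map T vs)"
  unfolding frame_star_def frame_vol_change map_append
  using contraction_change[of "{1..DIM('a)}" k \<alpha> "\<lambda>us. frame_vol e (us @ map T vs)"] by simp

lemma frame_star_complementary:
  fixes e :: "nat \<Rightarrow> 'a::euclidean_space"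
  assumes e: "is_basis e" and \<alpha>: "is_form k \<alpha>"
    and js: "distinct (js @ ks)" "set (js @ ks) = {1..DIM('a)}" "length js = k"
  shows "frame_star e k \<alpha> (map e ks) = \<alpha> (map e js) * frame_vol e (map e (js @ ks))"
proof -
  have inj: "inj_on e {1..DIM('a)}" using e unfolding is_basis_def by blast
  have len: "k + length ks = DIM('a)"
    using distinct_card[OF js(1)] js(2,3) by simp
  have "contraction (e ` {1..DIM('a)}) k \<alpha> (\<lambda>ws. frame_vol e (ws @ map e ks))
      = fact k * (\<alpha> (map e js) * frame_vol e (map e js @ map e ks))"
  proof (rule contraction_complementary[OF \<alpha>])
    show "is_form (k + length (map e ks)) (frame_vol e)" using is_form_frame_vol[OF e] len by simp
    show "set (map e js @ map e ks) = e ` {1..DIM('a)}"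
      using js(2) by (metis list.set_map map_append)
    show "distinct (map e js @ map e ks)"
      using js(1,2) inj by (metis distinct_map map_append)
    show "length (map e js) = k" using js by simp
  qed
  then show ?thesis by (simp add: frame_star_def)
qed

section \<open>Left-invariant forms on the semidirect product\<close>

text \<open>The right-hand side has the shape of the definition of the exterior derivative.\<close>

lemma wedge_one_sum:
  "wedge 1 \<alpha> \<beta> vs = (\<Sum>i<length vs. (-1) ^ i * \<alpha> [vs ! i] * \<beta> (take i vs @ drop (Suc i) vs))"
proof (induction vs arbitrary: \<beta>)
  case Nil
  then show ?case unfolding wedge_one_Nil by simp
next
  case (Cons v vs)
  show ?case
    unfolding wedge_one_Cons Cons
    by (simp add: sum.lessThan_Suc_shift iota_def sum_negf del: sum.lessThan_Suc)
qed

text \<open>The inner derivation \<open>ad e\<^sub>7\<close> of the Lie algebra.\<close>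

definition extend_D :: "(real ^ 6 \<Rightarrow> real ^ 6) \<Rightarrow> GD \<Rightarrow> GD" where
  "extend_D D v = (D (fst v), 0)"

text \<open>The differential of the left translation by any group element with last coordinate \<open>s\<close>.\<close>

definition flow_D :: "(real ^ 6 \<Rightarrow> real ^ 6) \<Rightarrow> real \<Rightarrow> GD \<Rightarrow> GD" where
  "flow_D D s v = (exp_D D s (fst v), snd v)"

text \<open>The covector \<open>e\<^sup>7\<close>.\<close>

definition dt_form :: "GD form" where
  "dt_form vs = (if length vs = 1 then snd (hd vs) else 0)"

text \<open>The Chevalley--Eilenberg differential of the Lie algebra: as \<open>\<hh>\<close> is abelian, only the brackets
  \<open>[e\<^sub>7, x] = D x\<close> contribute.\<close>

definition ce_deriv :: "(real ^ 6 \<Rightarrow> real ^ 6) \<Rightarrow> GD form \<Rightarrow> GD form" where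
  "ce_deriv D \<alpha> = wedge 1 dt_form (\<lambda>ws. - derive_form (extend_D D) \<alpha> ws)"

lemma linear_extend_D: "linear D \<Longrightarrow> linear (extend_D D)"
  unfolding extend_D_def[abs_def] by (rule linearI) (simp_all add: linear_add linear_cmul prod_eq_iff)

lemma linear_flow_D:
  assumes "linear D" shows "linear (flow_D D s)"
  unfolding flow_D_def[abs_def]
  by (rule linearI) (simp_all add: linear_add[OF exp_D_linear[OF assms]] linear_cmul[OF exp_D_linear[OF assms]])

lemma flow_D_inverse:
  assumes "linear D" shows "flow_D D (- s) (flow_D D s v) = v" "flow_D D s (flow_D D (- s) v) = v"
  by (simp_all add: flow_D_def exp_D_add[OF assms, symmetric])

lemma flow_D_0: "flow_D D 0 v = v"
  by (simp add: flow_D_def)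

lemma snd_flow_D [simp]: "snd (flow_D D s v) = snd v"
  by (simp add: flow_D_def)

lemma flow_D_commute: "linear D \<Longrightarrow> flow_D D s (extend_D D v) = extend_D D (flow_D D s v)"
  by (simp add: flow_D_def extend_D_def exp_D_commute)

lemma flow_D_has_vector_derivative:
  assumes "linear D"
  shows "((\<lambda>s. flow_D D s v) has_vector_derivative extend_D D (flow_D D s v)) (at s)"
proof -
  have "((\<lambda>s. (exp_D D s (fst v), snd v)) has_vector_derivative (D (exp_D D s (fst v)), 0)) (at s)"
    by (intro has_vector_derivative_Pair exp_D_has_vector_derivative[OF assms] has_vector_derivative_const)
  then show ?thesis by (simp add: flow_D_def[abs_def] extend_D_def)
qed

text \<open>Expanding the first argument in a fixed basis makes the remaining factor a form of lower degree with
  constant first argument, to which the induction hypothesis applies.\<close>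

lemma form_along_flow_derivative:
  assumes D: "linear D" and \<alpha>: "is_form k \<alpha>"
  shows "((\<lambda>s. \<alpha> (map (flow_D D s) vs)) has_real_derivative
      derive_form (extend_D D) \<alpha> (map (flow_D D s) vs)) (at s)"
  using \<alpha>
proof (induction vs arbitrary: k \<alpha>)
  case Nil
  then show ?case by (simp add: derive_form_Nil)
next
  case (Cons v vs)
  let ?T = "\<lambda>s. map (flow_D D s) vs"
  have iota: "\<exists>m. is_form m (iota b \<alpha>)" for b
  proof (cases k)
    case 0
    have "is_form 0 (\<lambda>_::GD list. 0)" by (simp add: is_form_def)
    with 0 show ?thesis using iota_is_form_0[of \<alpha> b] Cons(2) by auto
  qed (use is_form_iota Cons(2) in blast)
  have lin: "linear (\<lambda>u. iota u \<alpha> ws)" for ws by (rule linear_iota[OF Cons(2)])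
  have lin': "linear (\<lambda>u. derive_form (extend_D D) (iota u \<alpha>) ws)" for ws
    by (rule linear_derive_form[OF lin])
  have expand: "L u = (\<Sum>b\<in>Basis. (u \<bullet> b) * L b)" if "linear L" for L :: "GD \<Rightarrow> real" and u
  proof -
    have "L u = L (\<Sum>b\<in>Basis. (u \<bullet> b) *\<^sub>R b)" by (simp only: euclidean_representation)
    then show ?thesis by (simp only: linear_sum[OF that] linear_cmul[OF that] real_scaleR_def)
  qed
  have d1: "((\<lambda>s. flow_D D s v \<bullet> b) has_real_derivative extend_D D (flow_D D s v) \<bullet> b) (at s)" for b
    using bounded_linear.has_vector_derivative[OF bounded_linear_inner_left flow_D_has_vector_derivative[OF D], of v b s]
    by (simp add: has_real_derivative_iff_has_vector_derivative)
  have d2: "((\<lambda>s. iota b \<alpha> (?T s)) has_real_derivative derive_form (extend_D D) (iota b \<alpha>) (?T s)) (at s)" for b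
    using Cons(1) iota by blast
  have "((\<lambda>s. \<Sum>b\<in>Basis. (flow_D D s v \<bullet> b) * iota b \<alpha> (?T s)) has_real_derivative
      (\<Sum>b\<in>Basis. (extend_D D (flow_D D s v) \<bullet> b) * iota b \<alpha> (?T s)
        + derive_form (extend_D D) (iota b \<alpha>) (?T s) * (flow_D D s v \<bullet> b))) (at s)"
    by (rule DERIV_sum) (rule DERIV_mult[OF d1 d2])
  also have "(\<lambda>s. \<Sum>b\<in>Basis. (flow_D D s v \<bullet> b) * iota b \<alpha> (?T s)) = (\<lambda>s. \<alpha> (map (flow_D D s) (v # vs)))"
  proof
    fix s
    show "(\<Sum>b\<in>Basis. (flow_D D s v \<bullet> b) * iota b \<alpha> (?T s)) = \<alpha> (map (flow_D D s) (v # vs))"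
      unfolding expand[OF lin, symmetric] by (simp add: iota_def)
  qed
  also have "(\<Sum>b\<in>Basis. (extend_D D (flow_D D s v) \<bullet> b) * iota b \<alpha> (?T s)
        + derive_form (extend_D D) (iota b \<alpha>) (?T s) * (flow_D D s v \<bullet> b)) =
      iota (extend_D D (flow_D D s v)) \<alpha> (?T s) + derive_form (extend_D D) (iota (flow_D D s v) \<alpha>) (?T s)"
    unfolding expand[OF lin, of "extend_D D (flow_D D s v)"] expand[OF lin', of "flow_D D s v"] sum.distrib
    by (simp only: mult.commute)
  finally show ?case by (simp add: derive_form_Cons iota_def)
qed

lemma left_translate_frechet_derivative:
  assumes D: "linear D" and \<alpha>: "is_form k \<alpha>" and p: "\<And>p vs. \<beta> (p::GD) vs = \<alpha> (map (flow_D D (- snd p)) vs)"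
  shows "((\<lambda>q. \<beta> q ws) has_derivative (\<lambda>v. - snd v * derive_form (extend_D D) \<alpha> (map (flow_D D (- snd p)) ws))) (at p)"
proof -
  have "((\<lambda>q::GD. - snd q) has_derivative (\<lambda>v. - snd v)) (at p)"
    by (intro has_derivative_minus bounded_linear.has_derivative[OF bounded_linear_snd has_derivative_ident])
  from has_derivative_compose[OF this
      form_along_flow_derivative[OF D \<alpha>, of ws "- snd p", unfolded has_field_derivative_def]]
  show ?thesis unfolding p by (simp add: mult.commute)
qed

lemma ext_deriv_left_translate:
  assumes D: "linear D" and \<alpha>: "is_form k \<alpha>" and p: "\<And>p vs. \<beta> (p::GD) vs = \<alpha> (map (flow_D D (- snd p)) vs)"
  shows "ext_deriv \<beta> p vs = ce_deriv D \<alpha> (map (flow_D D (- snd p)) vs)"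
proof -
  have "frechet_derivative (\<lambda>q. \<beta> q ws) (at p) v =
      - snd v * derive_form (extend_D D) \<alpha> (map (flow_D D (- snd p)) ws)" for v ws
    using frechet_derivative_at[OF left_translate_frechet_derivative[OF assms], symmetric] by simp
  then show ?thesis
    unfolding ext_deriv_def ce_deriv_def wedge_one_sum
    by (simp add: dt_form_def take_map drop_map mult.assoc)
qed

lemma is_form_ce_deriv:
  assumes "linear D" "is_form k \<alpha>"
  shows "is_form (Suc k) (ce_deriv D \<alpha>)"
proof -
  have "is_form 1 dt_form"
  proof (rule is_formI)
    fix us ws :: "GD list" assume "Suc (length us + length ws) = 1"
    then show "linear (\<lambda>v. dt_form (us @ v # ws))" by (simp add: dt_form_def linear_iff)
  qed (auto simp: dt_form_def)
  moreover have "is_form k (\<lambda>ws. - derive_form (extend_D D) \<alpha> ws)"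
    using is_form_comb[OF is_form_derive_form[OF linear_extend_D[OF assms(1)] assms(2)]
        is_form_derive_form[OF linear_extend_D[OF assms(1)] assms(2)], of "-1" 0] by simp
  ultimately show ?thesis using is_form_wedge[of 1 dt_form k] unfolding ce_deriv_def by fastforce
qed

lemma ce_deriv_horizontal:
  assumes "\<And>v. v \<in> set vs \<Longrightarrow> snd v = 0"
  shows "ce_deriv D \<alpha> vs = 0"
  unfolding ce_deriv_def by (rule wedge_one_zero) (simp add: dt_form_def assms)

lemma ce_deriv_vertical:
  assumes "\<And>v. v \<in> set vs \<Longrightarrow> snd v = 0" "snd w = 1"
  shows "ce_deriv D \<alpha> (w # vs) = - derive_form (extend_D D) \<alpha> vs"
  unfolding ce_deriv_def wedge_one_Cons
  using wedge_one_zero[of vs dt_form] assms by (simp add: dt_form_def)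

section \<open>Symmetry of the second derivative\<close>

lemma Ck_2_derivatives:
  assumes "Ck 2 f"
  shows "(f has_derivative frechet_derivative f (at p)) (at p)"
    and "((\<lambda>q. frechet_derivative f (at q) v) has_derivative
          frechet_derivative (\<lambda>q. frechet_derivative f (at q) v) (at p)) (at p)"
    and "isCont (\<lambda>q. frechet_derivative (\<lambda>q. frechet_derivative f (at q) v) (at q) w) p"
  using assms
  by (auto simp: numeral_2_eq_2 frechet_derivative_works[symmetric] continuous_on_eq_continuous_at)

text \<open>The mean value theorem, applied first along \<open>v\<close> and then along \<open>w\<close>. The left-hand side is symmetric in
  \<open>v\<close> and \<open>w\<close>, so for \<open>t \<rightarrow> 0\<close> it compares the two mixed derivatives.\<close>

lemma second_difference_mean_value:
  fixes f :: "'a::euclidean_space \<Rightarrow> real"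
  assumes f: "Ck 2 f" and t: "0 < t"
  obtains x y where "0 < x" "x < t" "0 < y" "y < t"
    "f (p + t *\<^sub>R v + t *\<^sub>R w) - f (p + t *\<^sub>R v) - f (p + t *\<^sub>R w) + f p =
      t * t * frechet_derivative (\<lambda>q. frechet_derivative f (at q) v) (at (p + x *\<^sub>R v + y *\<^sub>R w)) w"
proof -
  let ?f1 = "\<lambda>q. frechet_derivative f (at q) v"
  let ?f2 = "\<lambda>q. frechet_derivative ?f1 (at q) w"
  have line: "((\<lambda>x. h (a + x *\<^sub>R u)) has_real_derivative h' u) (at x)"
    if "(h has_derivative h') (at (a + x *\<^sub>R u))" for h :: "'a \<Rightarrow> real" and h' a u x
  proof -
    have "((\<lambda>x. a + x *\<^sub>R u) has_derivative (\<lambda>x. x *\<^sub>R u)) (at x)"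
      by (auto intro!: derivative_eq_intros)
    from has_derivative_compose[OF this that]
    have "((\<lambda>x. h (a + x *\<^sub>R u)) has_derivative (\<lambda>x. h' (x *\<^sub>R u))) (at x)" .
    then show ?thesis
      using linear_cmul[OF has_derivative_linear[OF that]]
      by (simp add: has_field_derivative_def mult.commute[of _ "h' u"])
  qed
  have "((\<lambda>x. f ((p + t *\<^sub>R w) + x *\<^sub>R v) - f (p + x *\<^sub>R v)) has_real_derivative
      ?f1 ((p + t *\<^sub>R w) + x *\<^sub>R v) - ?f1 (p + x *\<^sub>R v)) (at x)" for x
    by (intro DERIV_diff line Ck_2_derivatives(1)[OF f])
  from MVT2[OF t this] obtain x where x: "0 < x" "x < t"
    and ex: "(f ((p + t *\<^sub>R w) + t *\<^sub>R v) - f (p + t *\<^sub>R v)) - (f ((p + t *\<^sub>R w) + 0 *\<^sub>R v) - f (p + 0 *\<^sub>R v)) =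
      (t - 0) * (?f1 ((p + t *\<^sub>R w) + x *\<^sub>R v) - ?f1 (p + x *\<^sub>R v))" by blast
  have "((\<lambda>y. ?f1 ((p + x *\<^sub>R v) + y *\<^sub>R w)) has_real_derivative ?f2 ((p + x *\<^sub>R v) + y *\<^sub>R w)) (at y)" for y
    by (intro line Ck_2_derivatives(2)[OF f])
  from MVT2[OF t this] obtain y where y: "0 < y" "y < t"
    and ey: "?f1 ((p + x *\<^sub>R v) + t *\<^sub>R w) - ?f1 ((p + x *\<^sub>R v) + 0 *\<^sub>R w) =
      (t - 0) * ?f2 ((p + x *\<^sub>R v) + y *\<^sub>R w)" by blast
  show ?thesis
    by (rule that[OF x y]) (use ex ey in \<open>simp add: algebra_simps\<close>)
qed

lemma second_derivative_symmetric:
  fixes f :: "'a::euclidean_space \<Rightarrow> real"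
  assumes f: "Ck 2 f"
  shows "frechet_derivative (\<lambda>q. frechet_derivative f (at q) v) (at p) w =
    frechet_derivative (\<lambda>q. frechet_derivative f (at q) w) (at p) v"
proof -
  define g where "g v w q = frechet_derivative (\<lambda>q. frechet_derivative f (at q) v) (at q) w" for v w q
  have cont: "isCont (g v w) p" for v w
    unfolding g_def by (rule Ck_2_derivatives(3)[OF f])
  have "\<bar>g v w p - g w v p\<bar> < \<epsilon>" if \<epsilon>: "0 < \<epsilon>" for \<epsilon>
  proof -
    obtain d1 where d1: "0 < d1" "\<And>q. dist q p < d1 \<Longrightarrow> dist (g v w q) (g v w p) < \<epsilon> / 2"
      using cont[of v w] \<epsilon> half_gt_zero unfolding continuous_at_eps_delta by blast
    obtain d2 where d2: "0 < d2" "\<And>q. dist q p < d2 \<Longrightarrow> dist (g w v q) (g w v p) < \<epsilon> / 2"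
      using cont[of w v] \<epsilon> half_gt_zero unfolding continuous_at_eps_delta by blast
    define M where "M = norm v + norm w + 1"
    define t where "t = min d1 d2 / M"
    have M: "0 < M" unfolding M_def by (smt (verit) norm_ge_zero)
    have t: "0 < t" unfolding t_def using M d1 d2 by simp
    have close: "dist (p + x *\<^sub>R v + y *\<^sub>R w) p < min d1 d2"
      if "0 < x" "x < t" "0 < y" "y < t" for x y
    proof -
      have "dist (p + x *\<^sub>R v + y *\<^sub>R w) p = norm (x *\<^sub>R v + y *\<^sub>R w)" by (simp add: dist_norm)
      also have "\<dots> \<le> norm (x *\<^sub>R v) + norm (y *\<^sub>R w)" by (rule norm_triangle_ineq)
      also have "\<dots> \<le> t * norm v + t * norm w"
        using that by (intro add_mono) (auto intro!: mult_right_mono)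
      also have "\<dots> < t * M" using t by (simp add: M_def algebra_simps)
      finally show ?thesis using M by (simp add: t_def)
    qed
    obtain x y where xy: "0 < x" "x < t" "0 < y" "y < t"
      "f (p + t *\<^sub>R v + t *\<^sub>R w) - f (p + t *\<^sub>R v) - f (p + t *\<^sub>R w) + f p = t * t * g v w (p + x *\<^sub>R v + y *\<^sub>R w)"
      using second_difference_mean_value[OF f t, of p v w] unfolding g_def by metis
    obtain x' y' where xy': "0 < x'" "x' < t" "0 < y'" "y' < t"
      "f (p + t *\<^sub>R w + t *\<^sub>R v) - f (p + t *\<^sub>R w) - f (p + t *\<^sub>R v) + f p = t * t * g w v (p + x' *\<^sub>R w + y' *\<^sub>R v)"
      using second_difference_mean_value[OF f t, of p w v] unfolding g_def by metis
    have comm: "p + t *\<^sub>R w + t *\<^sub>R v = p + t *\<^sub>R v + t *\<^sub>R w" by simp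
    have "t * t * g v w (p + x *\<^sub>R v + y *\<^sub>R w) = t * t * g w v (p + x' *\<^sub>R w + y' *\<^sub>R v)"
      using xy(5) xy'(5) unfolding comm by linarith
    then have "g v w (p + x *\<^sub>R v + y *\<^sub>R w) = g w v (p + x' *\<^sub>R w + y' *\<^sub>R v)" using t by simp
    moreover have "p + x' *\<^sub>R w + y' *\<^sub>R v = p + y' *\<^sub>R v + x' *\<^sub>R w" by simp
    moreover have "dist (g v w (p + x *\<^sub>R v + y *\<^sub>R w)) (g v w p) < \<epsilon> / 2"
      using d1(2) close[OF xy(1-4)] by simp
    moreover have "dist (g w v (p + y' *\<^sub>R v + x' *\<^sub>R w)) (g w v p) < \<epsilon> / 2"
      using d2(2) close[OF xy'(3,4,1,2)] by simp
    ultimately show ?thesis unfolding dist_real_def by (smt (verit) field_sum_of_halves)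
  qed
  then have "\<bar>g v w p - g w v p\<bar> \<le> 0" by (meson dense_ge less_le)
  then show ?thesis by (simp add: g_def)
qed

section \<open>Trace identities\<close>

lemma matrix_mul_scaleR_right: "A ** (r *\<^sub>R B) = r *\<^sub>R (A ** (B :: complex^'n^'n))" for A :: "complex^'n^'n"
  by (simp add: matrix_matrix_mult_def vec_eq_iff scaleR_sum_right)

lemma matrix_mul_diff_right: "A ** (B - C) = A ** B - A ** (C :: complex^'n^'n)" for A :: "complex^'n^'n"
  by (simp add: matrix_matrix_mult_def vec_eq_iff sum_subtractf right_diff_distrib)

lemma trace_scaleR: "trace (r *\<^sub>R A) = r *\<^sub>R trace (A :: complex^'n^'n)"
  by (simp add: trace_def scaleR_sum_right)

text \<open>As \<open>K\<close> commutes with \<open>H\<close>, the factor \<open>H\<close> to the right of \<open>N\<close> can be moved cyclically to its left.\<close>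

lemma trace_anticommutator:
  fixes H M N K :: "complex^'n^'n"
  assumes H: "H = M + N" and K: "K ** H = H ** K"
  shows "trace (K ** (H ** M + N ** H)) = trace (K ** H ** H)"
proof -
  have "trace (K ** (N ** H)) = trace ((N ** H) ** K)" by (rule trace_mul_sym)
  also have "\<dots> = trace ((K ** H) ** N)"
    using trace_mul_sym[of N "K ** H"] K by (simp add: matrix_mul_assoc[symmetric])
  finally have "trace (K ** (H ** M + N ** H)) = trace ((K ** H) ** M) + trace ((K ** H) ** N)"
    by (simp add: matrix_add_ldistrib trace_add matrix_mul_assoc)
  also have "\<dots> = trace ((K ** H) ** (M + N))" by (simp add: matrix_add_ldistrib trace_add)
  finally show ?thesis using H by simp
qed

text \<open>The trace of the equation for \<open>W\<close>, and the traces of its products with \<open>H\<close> and \<open>H\<^sup>2\<close>.\<close>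

lemma trace_relations:
  fixes H M N W :: "complex^3^3" and a b :: real
  assumes H: "H = M + N" and W: "W + W = H ** M + N ** H + a *\<^sub>R H - b *\<^sub>R mat 1" and HW: "H ** W = 0"
  shows "trace (H ** H ** H) + a *\<^sub>R trace (H ** H) - b *\<^sub>R trace H = 0"
    and "trace (H ** H ** H ** H) + a *\<^sub>R trace (H ** H ** H) - b *\<^sub>R trace (H ** H) = 0"
    and "trace W + trace W = trace (H ** H) + a *\<^sub>R trace H - 3 * complex_of_real b"
proof -
  have *: "trace (K ** (W + W)) = trace (K ** H ** H) + a *\<^sub>R trace (K ** H) - b *\<^sub>R trace K"
    if "K ** H = H ** K" for K
    unfolding W using trace_anticommutator[OF H that]
    by (simp add: matrix_add_ldistrib matrix_mul_diff_right trace_add trace_sub matrix_mul_scaleR_right trace_scaleR)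
  have zero: "K ** (0 :: complex^3^3) = 0" for K :: "complex^3^3"
    by (simp add: matrix_matrix_mult_def vec_eq_iff)
  have "K ** H ** (W + W) = 0" for K
    unfolding matrix_mul_assoc[symmetric] matrix_add_ldistrib HW zero by simp
  from this[of "mat 1"] this[of H] have "H ** (W + W) = 0" "(H ** H) ** (W + W) = 0"
    by (simp_all only: matrix_mul_lid)
  moreover have "trace (0 :: complex^3^3) = 0" by (simp add: trace_def)
  ultimately show "trace (H ** H ** H) + a *\<^sub>R trace (H ** H) - b *\<^sub>R trace H = 0"
    "trace (H ** H ** H ** H) + a *\<^sub>R trace (H ** H ** H) - b *\<^sub>R trace (H ** H) = 0"
    using *[of H] *[of "H ** H"] by (simp_all only: matrix_mul_assoc simp_thms)
  show "trace W + trace W = trace (H ** H) + a *\<^sub>R trace H - 3 * complex_of_real b"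
    using *[of "mat 1", unfolded matrix_mul_lid matrix_mul_rid trace_add trace_I, OF refl]
    by (simp add: scaleR_conv_of_real mult.commute)
qed

text \<open>By Cayley--Hamilton \<open>H\<^sup>3 = c H + det H\<close> with \<open>2 c = tr H\<^sup>2\<close> when \<open>tr H = 0\<close>.\<close>

lemma trace_power_4:
  fixes H :: "complex^3^3"
  assumes "trace H = 0"
  shows "2 * trace (H ** H ** H ** H) = (trace (H ** H))\<^sup>2"
proof -
  have h: "H $ 3 $ 3 = - H $ 1 $ 1 - H $ 2 $ 2"
    using assms by (simp add: trace_def sum_3 algebra_simps add_eq_0_iff)
  define c where "c = trace (H ** H) / 2"
  have c: "c = H $ 1 $ 1 * H $ 1 $ 1 + H $ 1 $ 1 * H $ 2 $ 2 + H $ 2 $ 2 * H $ 2 $ 2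
    + H $ 1 $ 2 * H $ 2 $ 1 + H $ 1 $ 3 * H $ 3 $ 1 + H $ 2 $ 3 * H $ 3 $ 2"
    unfolding c_def by (simp add: trace_def matrix_matrix_mult_def sum_3 h field_simps)
  define C where "C = (\<chi> i j. c * H $ i $ j + (if i = j then det H else 0))"
  have "H ** H ** H = C"
    unfolding vec_eq_iff forall_3
    by (simp add: C_def c matrix_matrix_mult_def sum_3 det_3 h algebra_simps)
  then have "trace (H ** H ** H ** H) = trace (C ** H)" by simp
  also have "\<dots> = c * trace (H ** H) + det H * trace H"
    by (simp add: C_def trace_def matrix_matrix_mult_def sum_3 algebra_simps)
  finally show ?thesis using assms by (simp add: c_def power2_eq_square mult.commute)
qed

definition adjoint_matrix :: "complex^'n^'n \<Rightarrow> complex^'n^'n" where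
  "adjoint_matrix A = (\<chi> i j. cnj (A $ j $ i))"

text \<open>The number \<open>n\<close> is the squared Frobenius norm of \<open>H\<close>.\<close>

lemma hermitian_trace_square:
  fixes H :: "complex^'n^'n"
  assumes "adjoint_matrix H = H"
  obtains n :: real where "trace (H ** H) = complex_of_real n" "0 \<le> n" "n = 0 \<Longrightarrow> H = 0"
proof
  define n where "n = (\<Sum>i\<in>UNIV. \<Sum>j\<in>UNIV. (cmod (H $ i $ j))\<^sup>2)"
  have "adjoint_matrix H $ j $ i = cnj (H $ i $ j)" for i j by (simp add: adjoint_matrix_def)
  then have herm: "cnj (H $ i $ j) = H $ j $ i" for i j unfolding assms by (rule sym)
  have sq: "H $ i $ j * H $ j $ i = complex_of_real ((cmod (H $ i $ j))\<^sup>2)" for i j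
    by (simp only: complex_norm_square herm)
  show "trace (H ** H) = complex_of_real n"
    unfolding trace_def matrix_matrix_mult_def n_def by (simp only: vec_lambda_beta sq of_real_sum)
  show "0 \<le> n" unfolding n_def by (intro sum_nonneg) simp
  show "H = 0" if "n = 0"
    using that unfolding n_def by (simp add: sum_nonneg_eq_0_iff sum_nonneg vec_eq_iff)
qed

subsection \<open>Complex structure\<close>

text \<open>A real \<open>6 \<times> 6\<close> matrix that commutes with \<open>J e\<^sub>1 = e\<^sub>2\<close>, \<open>J e\<^sub>3 = e\<^sub>4\<close>, \<open>J e\<^sub>5 = e\<^sub>6\<close> is determined by its odd rows; its
  \<open>2 \<times> 2\<close> blocks have the first row \<open>(Re z, - Im z)\<close>.\<close>

definition odd_index :: "3 \<Rightarrow> nat" where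
  "odd_index i = (if i = 1 then 1 else if i = 2 then 3 else 5)"

definition complex_matrix :: "(nat \<Rightarrow> nat \<Rightarrow> real) \<Rightarrow> complex^3^3" where
  "complex_matrix m = (\<chi> i j. Complex (m (odd_index i) (odd_index j)) (- m (odd_index i) (Suc (odd_index j))))"

lemma complex_matrix_entries:
  "complex_matrix m $ 1 $ 1 = Complex (m 1 1) (- m 1 2)" "complex_matrix m $ 1 $ 2 = Complex (m 1 3) (- m 1 4)"
  "complex_matrix m $ 1 $ 3 = Complex (m 1 5) (- m 1 6)" "complex_matrix m $ 2 $ 1 = Complex (m 3 1) (- m 3 2)"
  "complex_matrix m $ 2 $ 2 = Complex (m 3 3) (- m 3 4)" "complex_matrix m $ 2 $ 3 = Complex (m 3 5) (- m 3 6)"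
  "complex_matrix m $ 3 $ 1 = Complex (m 5 1) (- m 5 2)" "complex_matrix m $ 3 $ 2 = Complex (m 5 3) (- m 5 4)"
  "complex_matrix m $ 3 $ 3 = Complex (m 5 5) (- m 5 6)"
  by (simp_all add: complex_matrix_def odd_index_def eval_nat_numeral)

section \<open>The soliton equation in a left-invariant frame\<close>

text \<open>The basis \<open>e\<close> is the adapted basis of the Lie algebra. Below, \<open>E p\<close> is the left-invariant frame that it
  defines, and \<open>flow_D D (- snd p)\<close> takes \<open>E p\<close> back to \<open>e\<close>.\<close>

locale adapted_soliton =
  fixes D :: "real ^ 6 \<Rightarrow> real ^ 6" and \<phi> :: "GD \<Rightarrow> GD form" and f :: "GD \<Rightarrow> real" and lam :: real
    and e :: "nat \<Rightarrow> GD"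
  assumes D: "linear D" and e: "is_basis e" and e7: "e 7 = (0, 1)" and eh: "\<And>i. i \<in> {1..6} \<Longrightarrow> snd (e i) = 0"
    and \<phi>0: "\<phi> 0 = phi_std e"
    and invariant: "left_invariant_form D \<phi>"
    and soliton: "closed_gradient_laplacian_soliton \<phi> f lam"
begin

definition E :: "GD \<Rightarrow> nat \<Rightarrow> GD" where
  "E p i = flow_D D (snd p) (e i)"

lemma dim: "DIM(GD) = 7"
  by simp

lemma frame_change: "frame_change e (flow_D D (- s)) (flow_D D s)"
  unfolding frame_change_def using e linear_flow_D[OF D] flow_D_inverse[OF D] by blast

lemma is_basis_E: "is_basis (E p)"
  using frame_change.is_basis_change[OF frame_change] unfolding E_def[abs_def] by blast

lemma snd_E: "snd (E p i) = snd (e i)"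
  by (simp add: E_def)

lemma snd_e: "i \<in> {1..7} \<Longrightarrow> snd (e i) = (if i = 7 then 1 else 0)"
  using eh[of i] e7 by auto

lemma flow_E: "flow_D D (- snd p) (E p i) = e i"
  by (simp add: E_def flow_D_inverse[OF D])

lemma phi_translate: "\<phi> p vs = phi_std e (map (flow_D D (- snd p)) vs)"
proof -
  have "\<phi> (mult_D D p 0) (map (frechet_derivative (mult_D D p) (at 0)) ws) = \<phi> 0 ws" for ws
    using invariant unfolding left_invariant_form_def by blast
  then have "\<phi> p (map (flow_D D (snd p)) ws) = phi_std e ws" for ws
    by (simp add: mult_D_group[OF D] mult_D_frechet_derivative[OF D] \<phi>0 flow_D_def[abs_def] cong: map_cong)
  from this[of "map (flow_D D (- snd p)) vs"] show ?thesis
    by (simp add: flow_D_inverse[OF D] o_def)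
qed

lemma phi_E: "\<phi> p = phi_std (E p)"
  using frame_change.phi_std_change[OF frame_change dim] phi_translate unfolding E_def[abs_def] by (intro ext) simp

lemma metric_E: "g2_metric (\<phi> p) = frame_metric (E p)"
  unfolding phi_E by (rule g2_phi_std(1)[OF is_basis_E dim])

lemma form_phi: "is_form 3 (phi_std e)"
  by (rule is_form_phi_std[OF e])

subsection \<open>The torsion form and the Laplacian\<close>

lemma star_translate:
  assumes "is_form k \<alpha>" and p: "\<And>p vs. \<beta> p vs = \<alpha> (map (flow_D D (- snd p)) vs)"
  shows "star \<phi> k \<beta> p vs = frame_star e k \<alpha> (map (flow_D D (- snd p)) vs)"
proof -
  have \<beta>: "\<beta> p = (\<lambda>vs. \<alpha> (map (flow_D D (- snd p)) vs))" using p by blast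
  have "is_form k (\<beta> p)" unfolding \<beta> by (rule is_form_pullback[OF linear_flow_D[OF D] assms(1)])
  then have "star \<phi> k \<beta> p vs = frame_star (E p) k (\<beta> p) vs"
    using star_phi_std[OF is_basis_E dim phi_E] by simp
  also have "\<dots> = frame_star e k \<alpha> (map (flow_D D (- snd p)) vs)"
    unfolding \<beta> E_def[abs_def] by (rule frame_change.frame_star_change[OF frame_change])
  finally show ?thesis .
qed

text \<open>The values at the identity of the left-invariant forms \<open>*\<phi>\<close> and \<open>*d*\<phi>\<close>. The latter is the negative of the
  torsion form \<open>\<tau>\<close>.\<close>

definition dual_form :: "GD form" where
  "dual_form = frame_star e 3 (phi_std e)"

definition torsion :: "GD form" where
  "torsion = frame_star e 5 (ce_deriv D dual_form)"

lemma form_dual: "is_form 4 dual_form"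
  unfolding dual_form_def by (rule is_form_frame_star[OF e]) simp

lemma form_ce_dual: "is_form 5 (ce_deriv D dual_form)"
  using is_form_ce_deriv[OF D form_dual] by simp

lemma form_torsion: "is_form 2 torsion"
  unfolding torsion_def by (rule is_form_frame_star[OF e]) simp

lemma star_phi: "star \<phi> 3 \<phi> p vs = dual_form (map (flow_D D (- snd p)) vs)"
  unfolding dual_form_def by (rule star_translate[OF form_phi phi_translate])

lemma closed: "closed_G2 \<phi>"
  using soliton unfolding closed_gradient_laplacian_soliton_def by blast

lemma laplacian: "hodge_laplacian \<phi> \<phi> p vs = - ce_deriv D torsion (map (flow_D D (- snd p)) vs)"
proof -
  have z: "ext_deriv \<phi> = (\<lambda>_ _. 0)" using closed unfolding closed_G2_def by blast
  have "star \<phi> k (\<lambda>_ _. 0) = (\<lambda>_ _. 0)" for k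
    by (intro ext) (simp add: star_def hodge_star_def)
  moreover have "ext_deriv (\<lambda>_ _. 0) = (\<lambda>(_::GD) _. 0)"
    by (intro ext) (simp add: ext_deriv_def)
  ultimately have "star \<phi> 4 (ext_deriv (star \<phi> 4 (ext_deriv \<phi>))) p vs = 0"
    unfolding z by simp
  moreover have "ext_deriv (star \<phi> 5 (ext_deriv (star \<phi> 3 \<phi>))) p vs = ce_deriv D torsion (map (flow_D D (- snd p)) vs)"
  proof (rule ext_deriv_left_translate[OF D form_torsion])
    fix q us
    show "star \<phi> 5 (ext_deriv (star \<phi> 3 \<phi>)) q us = torsion (map (flow_D D (- snd q)) us)"
      unfolding torsion_def
      by (rule star_translate[OF form_ce_dual ext_deriv_left_translate[OF D form_dual star_phi]])
  qed
  ultimately show ?thesis by (simp add: hodge_laplacian_def)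
qed

text \<open>This is the component of \<open>d\<phi> = 0\<close> on \<open>(e\<^sub>7, e\<^sub>a, e\<^sub>b, e\<^sub>c)\<close>.\<close>

lemma closed_rho:
  assumes "a \<in> {1..6}" "b \<in> {1..6}" "c \<in> {1..6}"
  shows "derive_form (extend_D D) (phi_std e) [e a, e b, e c] = 0"
proof -
  have "ext_deriv \<phi> 0 [e 7, e a, e b, e c] = 0" using closed unfolding closed_G2_def by blast
  then have "ce_deriv D (phi_std e) [e 7, e a, e b, e c] = 0"
    using ext_deriv_left_translate[OF D form_phi phi_translate, of 0] by (simp add: flow_D_0)
  moreover have "snd v = 0" if "v \<in> set [e a, e b, e c]" for v using that assms eh by auto
  ultimately show ?thesis
    using ce_deriv_vertical[of "[e a, e b, e c]" "e 7" D "phi_std e"] e7 by simp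
qed

text \<open>If \<open>D\<close> annihilates \<open>\<phi>\<close>, then \<open>\<phi>\<close> has constant coefficients in the global chart, and so has its dual.\<close>

lemma torsion_freeI:
  assumes "derive_form (extend_D D) (phi_std e) = (\<lambda>_. 0)"
  shows "torsion_free \<phi>"
proof -
  have const: "\<phi> p = \<phi> 0" for p
  proof
    fix vs
    have "((\<lambda>s. phi_std e (map (flow_D D s) vs)) has_real_derivative 0) (at s)" for s
      using form_along_flow_derivative[OF D form_phi, of vs s] assms by simp
    then have "phi_std e (map (flow_D D (- snd p)) vs) = phi_std e (map (flow_D D 0) vs)"
      using DERIV_isconst_all by blast
    then show "\<phi> p vs = \<phi> 0 vs" using phi_translate[of p vs] phi_translate[of 0 vs] by simp
  qed
  have "(\<lambda>q. star \<phi> 3 \<phi> q ws) = (\<lambda>q. star \<phi> 3 \<phi> 0 ws)" for ws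
    by (rule ext) (use const in \<open>metis star_def\<close>)
  then have "frechet_derivative (\<lambda>q. star \<phi> 3 \<phi> q ws) (at p) v = 0" for ws p v
    by (metis frechet_derivative_const)
  then have "ext_deriv (star \<phi> 3 \<phi>) p vs = 0" for p vs
    unfolding ext_deriv_def by simp
  then show ?thesis using closed unfolding torsion_free_def by blast
qed

subsection \<open>The gradient and its derivative\<close>

lemma Ck_f: "Ck 2 f"
  using soliton unfolding closed_gradient_laplacian_soliton_def smooth_def by blast

abbreviation df :: "GD \<Rightarrow> GD \<Rightarrow> real" where
  "df p \<equiv> frechet_derivative f (at p)"

text \<open>Second derivatives are taken with the second argument frozen: \<open>hess\<close> is the coordinate Hessian of the
  global chart, and \<open>G\<close> its matrix in the left-invariant frame.\<close>

definition hess :: "GD \<Rightarrow> GD \<Rightarrow> GD \<Rightarrow> real" where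
  "hess p v w = frechet_derivative (\<lambda>q. df q w) (at p) v"

definition F :: "nat \<Rightarrow> GD \<Rightarrow> real" where
  "F i p = df p (E p i)"

definition G :: "GD \<Rightarrow> nat \<Rightarrow> nat \<Rightarrow> real" where
  "G p i j = hess p (E p i) (E p j)"

abbreviation X :: "GD \<Rightarrow> GD" where
  "X \<equiv> gradient (\<lambda>p. g2_metric (\<phi> p)) f"

lemma linear_df: "linear (df p)"
  using has_derivative_linear[OF Ck_2_derivatives(1)[OF Ck_f]] .

lemma df_has_derivative: "((\<lambda>q. df q w) has_derivative (\<lambda>v. hess p v w)) (at p)"
  using Ck_2_derivatives(2)[OF Ck_f, of w p] by (simp add: hess_def[abs_def])

lemma G_sym: "G p i j = G p j i"
  unfolding G_def hess_def by (rule second_derivative_symmetric[OF Ck_f])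

lemma expand_Basis: "linear L \<Longrightarrow> L u = (\<Sum>b\<in>Basis. (u \<bullet> b) * L b)" for L :: "GD \<Rightarrow> real"
proof -
  assume l: "linear L"
  have "L u = L (\<Sum>b\<in>Basis. (u \<bullet> b) *\<^sub>R b)" by (simp only: euclidean_representation)
  then show ?thesis by (simp only: linear_sum[OF l] linear_cmul[OF l] real_scaleR_def)
qed

lemma hess_expand: "hess p v w = (\<Sum>b\<in>Basis. (w \<bullet> b) * hess p v b)"
proof -
  have "((\<lambda>q. \<Sum>b\<in>Basis. (w \<bullet> b) * df q b) has_derivative (\<lambda>v. \<Sum>b\<in>Basis. (w \<bullet> b) * hess p v b)) (at p)"
    by (intro has_derivative_sum has_derivative_mult_right df_has_derivative)
  then have "((\<lambda>q. df q w) has_derivative (\<lambda>v. \<Sum>b\<in>Basis. (w \<bullet> b) * hess p v b)) (at p)"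
    unfolding expand_Basis[OF linear_df, symmetric] .
  from has_derivative_unique[OF this df_has_derivative] show ?thesis by metis
qed

lemma E_has_derivative: "((\<lambda>q. E q i) has_derivative (\<lambda>v. snd v *\<^sub>R extend_D D (E p i))) (at p)"
proof -
  have "(snd has_derivative snd) (at p)"
    by (rule bounded_linear.has_derivative[OF bounded_linear_snd has_derivative_ident])
  from has_derivative_compose[OF this
      flow_D_has_vector_derivative[OF D, of "e i" "snd p", unfolded has_vector_derivative_def]]
  show ?thesis by (simp add: E_def)
qed

lemma F_has_derivative:
  "(F i has_derivative (\<lambda>v. hess p v (E p i) + snd v * df p (extend_D D (E p i)))) (at p)"
proof -
  have "((\<lambda>q. E q i \<bullet> b) has_derivative (\<lambda>v. (snd v *\<^sub>R extend_D D (E p i)) \<bullet> b)) (at p)" for b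
    by (rule bounded_linear.has_derivative[OF bounded_linear_inner_left E_has_derivative])
  then have "((\<lambda>q. \<Sum>b\<in>Basis. (E q i \<bullet> b) * df q b) has_derivative
      (\<lambda>v. \<Sum>b\<in>Basis. (E p i \<bullet> b) * hess p v b + ((snd v *\<^sub>R extend_D D (E p i)) \<bullet> b) * df p b)) (at p)"
    by (intro has_derivative_sum has_derivative_mult df_has_derivative)
  moreover have "(\<lambda>q. \<Sum>b\<in>Basis. (E q i \<bullet> b) * df q b) = F i"
    unfolding expand_Basis[OF linear_df, symmetric] F_def ..
  moreover have "(\<Sum>b\<in>Basis. (E p i \<bullet> b) * hess p v b + ((snd v *\<^sub>R extend_D D (E p i)) \<bullet> b) * df p b)
      = hess p v (E p i) + snd v * df p (extend_D D (E p i))" for v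
    unfolding sum.distrib hess_expand[symmetric] expand_Basis[OF linear_df, symmetric]
    by (simp add: linear_cmul[OF linear_df])
  ultimately show ?thesis by simp
qed

lemma gradient_frame: "X p = (\<Sum>i = 1..7. F i p *\<^sub>R E p i)"
proof -
  let ?g = "frame_metric (E p)"
  note ip = inner_product_frame_metric[OF is_basis_E, of p]
  note lin = inner_product_on_linear[OF ip]
  have g1: "?g (\<Sum>i = 1..7. F i p *\<^sub>R E p i) v = df p v" for v
  proof -
    have "?g (E p i) v = coordinate (E p) i v" if "i \<in> {1..7}" for i
    proof -
      have "?g (E p i) v = (\<Sum>k = 1..7. if k = i then coordinate (E p) k v else 0)"
        unfolding frame_metric_def dim
      proof (rule sum.cong[OF refl])
        fix k :: nat assume "k \<in> {1..7}"
        then show "coordinate (E p) k (E p i) * coordinate (E p) k v = (if k = i then coordinate (E p) k v else 0)"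
          using coordinate_basis[OF is_basis_E, of k i p] that dim by simp
      qed
      then show ?thesis using that by simp
    qed
    then have "(\<Sum>i = 1..7. F i p * ?g (E p i) v) = (\<Sum>i = 1..7. F i p * coordinate (E p) i v)"
      by (intro sum.cong) auto
    then have "?g (\<Sum>i = 1..7. F i p *\<^sub>R E p i) v = (\<Sum>i = 1..7. F i p * coordinate (E p) i v)"
      by (simp only: linear_sum[OF lin(1)] linear_cmul[OF lin(1)] real_scaleR_def)
    also have "\<dots> = df p (\<Sum>i = 1..7. coordinate (E p) i v *\<^sub>R E p i)"
      by (simp only: linear_sum[OF linear_df] linear_cmul[OF linear_df] real_scaleR_def F_def mult.commute)
    also have "\<dots> = df p v" using coordinate_expansion[OF is_basis_E, of v p] unfolding dim by metis
    finally show ?thesis .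
  qed
  show ?thesis
    unfolding gradient_def metric_E
  proof (rule the_equality)
    show "\<forall>v. ?g (\<Sum>i = 1..7. F i p *\<^sub>R E p i) v = df p v" using g1 by blast
  next
    fix w assume "\<forall>v. ?g w v = df p v"
    then have w: "?g w v = df p v" for v by blast
    define z where "z = w - (\<Sum>i = 1..7. F i p *\<^sub>R E p i)"
    have "?g z z = 0"
      unfolding z_def linear_diff[OF lin(1)] g1 w by simp
    moreover have "z \<noteq> 0 \<longrightarrow> 0 < ?g z z" using ip unfolding inner_product_on_def by blast
    ultimately have "z = 0" by (metis less_irrefl)
    then show "w = (\<Sum>i = 1..7. F i p *\<^sub>R E p i)" by (simp add: z_def)
  qed
qed

text \<open>Up to the identification of the frame \<open>E p\<close> with \<open>e\<close>, the Lie derivative of a left-invariant form along \<open>X\<close> is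
  the action of this endomorphism: the derivative of \<open>X\<close>, minus the motion of the frame along \<open>X\<close>, to which
  only the component \<open>F\<^sub>7\<close> contributes.\<close>

definition P :: "GD \<Rightarrow> nat \<Rightarrow> GD" where
  "P p a = flow_D D (- snd p) (frechet_derivative X (at p) (E p a)) - F 7 p *\<^sub>R extend_D D (e a)"

lemma lie_derivative_frame:
  assumes "a \<in> {1..7}" "b \<in> {1..7}" "c \<in> {1..7}"
  shows "lie_derivative X \<phi> p [E p a, E p b, E p c] =
    phi_std e [P p a, e b, e c] + phi_std e [e a, P p b, e c] + phi_std e [e a, e b, P p c]"
proof -
  let ?T = "flow_D D (- snd p)"
  let ?Q = "\<lambda>a. ?T (frechet_derivative X (at p) (E p a))"
  have X7: "snd (X p) = F 7 p"
  proof -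
    have "snd (X p) = (\<Sum>i = 1..7. F i p * snd (e i))"
      unfolding gradient_frame snd_sum by (simp only: snd_scaleR snd_E real_scaleR_def)
    also have "\<dots> = (\<Sum>i = 1..7. if i = 7 then F i p else 0)"
      by (rule sum.cong[OF refl]) (simp add: snd_e)
    finally show ?thesis by simp
  qed
  have "frechet_derivative (\<lambda>q. \<phi> q [E p a, E p b, E p c]) (at p) (X p) =
      - F 7 p * derive_form (extend_D D) (phi_std e) [e a, e b, e c]"
    using frechet_derivative_at[OF left_translate_frechet_derivative[OF D form_phi phi_translate], symmetric]
    by (simp add: flow_E X7)
  moreover have "derive_form (extend_D D) (phi_std e) [e a, e b, e c] =
      phi_std e [extend_D D (e a), e b, e c] + phi_std e [e a, extend_D D (e b), e c] + phi_std e [e a, e b, extend_D D (e c)]"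
    by (simp add: derive_form_Cons derive_form_Nil iota_def)
  moreover have "(\<Sum>i<length [E p a, E p b, E p c].
      \<phi> p ([E p a, E p b, E p c][i := frechet_derivative X (at p) ([E p a, E p b, E p c] ! i)]))
    = phi_std e [?Q a, e b, e c] + phi_std e [e a, ?Q b, e c] + phi_std e [e a, e b, ?Q c]"
    by (simp add: eval_nat_numeral phi_translate flow_E)
  moreover have "phi_std e (us @ P p i # ws) = phi_std e (us @ ?Q i # ws) - F 7 p * phi_std e (us @ extend_D D (e i) # ws)"
    if "Suc (length us + length ws) = 3" for us ws i
    unfolding P_def linear_diff[OF is_form_linear_append[OF form_phi that]]
      linear_cmul[OF is_form_linear_append[OF form_phi that]] by simp
  from this[of "[]" "[e b, e c]" a] this[of "[e a]" "[e c]" b] this[of "[e a, e b]" "[]" c]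
  have "phi_std e [P p a, e b, e c] = phi_std e [?Q a, e b, e c] - F 7 p * phi_std e [extend_D D (e a), e b, e c]"
    "phi_std e [e a, P p b, e c] = phi_std e [e a, ?Q b, e c] - F 7 p * phi_std e [e a, extend_D D (e b), e c]"
    "phi_std e [e a, e b, P p c] = phi_std e [e a, e b, ?Q c] - F 7 p * phi_std e [e a, e b, extend_D D (e c)]"
    by simp_all
  ultimately show ?thesis unfolding lie_derivative_def by (simp add: algebra_simps)
qed

lemma soliton_frame:
  assumes "a \<in> {1..7}" "b \<in> {1..7}" "c \<in> {1..7}"
  shows "- ce_deriv D torsion [e a, e b, e c] = lam * phi_std e [e a, e b, e c]
    + (phi_std e [P p a, e b, e c] + phi_std e [e a, P p b, e c] + phi_std e [e a, e b, P p c])"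
proof -
  have "hodge_laplacian \<phi> \<phi> p [E p a, E p b, E p c] =
      lam * \<phi> p [E p a, E p b, E p c] + lie_derivative X \<phi> p [E p a, E p b, E p c]"
    using soliton unfolding closed_gradient_laplacian_soliton_def by blast
  then show ?thesis
    unfolding laplacian lie_derivative_frame[OF assms] by (simp add: phi_translate[of p] flow_E)
qed

text \<open>The matrix of \<open>D\<close> in the adapted basis.\<close>

definition d :: "nat \<Rightarrow> nat \<Rightarrow> real" where
  "d k j = coordinate e k (extend_D D (e j))"

lemma X_has_derivative:
  "(X has_derivative (\<lambda>v. \<Sum>j = 1..7. F j p *\<^sub>R (snd v *\<^sub>R extend_D D (E p j))
     + (hess p v (E p j) + snd v * df p (extend_D D (E p j))) *\<^sub>R E p j)) (at p)"
proof -
  have "X = (\<lambda>p. \<Sum>i = 1..7. F i p *\<^sub>R E p i)" using gradient_frame by blast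
  then show ?thesis
    by (simp only:) (intro has_derivative_sum has_derivative_scaleR F_has_derivative E_has_derivative)
qed

lemma extend_D_expand: "extend_D D (e j) = (\<Sum>k = 1..7. d k j *\<^sub>R e k)"
  unfolding d_def using coordinate_expansion[OF e, of "extend_D D (e j)"] unfolding dim .

lemma df_extend_D: "df p (extend_D D (E p j)) = (\<Sum>k = 1..7. d k j * F k p)"
proof -
  have "extend_D D (E p j) = (\<Sum>k = 1..7. d k j *\<^sub>R E p k)"
    unfolding E_def flow_D_commute[OF D, symmetric] extend_D_expand[of j]
    by (simp only: linear_sum[OF linear_flow_D[OF D]] linear_cmul[OF linear_flow_D[OF D]])
  then show ?thesis
    by (simp only: linear_sum[OF linear_df] linear_cmul[OF linear_df] real_scaleR_def F_def)
qed

text \<open>In the direction \<open>e\<^sub>7\<close> the frame itself moves. This changes both the vectors in \<open>X = \<Sum> F\<^sub>k E\<^sub>k\<close> and the components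
  \<open>F\<^sub>k = df(E\<^sub>k)\<close>, and so brings in \<open>D\<close> together with its transpose.\<close>

lemma coordinate_P:
  assumes l: "l \<in> {1..7}" and a: "a \<in> {1..7}"
  shows "coordinate e l (P p a) = G p a l - F 7 p * d l a
    + (if a = 7 then \<Sum>k = 1..7. (d k l + d l k) * F k p else 0)"
proof -
  let ?T = "flow_D D (- snd p)"
  note T = linear_flow_D[OF D, of "- snd p"] and c = linear_coordinate[OF e, of l]
  have "?T (frechet_derivative X (at p) (E p a)) = (\<Sum>j = 1..7. F j p *\<^sub>R (snd (e a) *\<^sub>R extend_D D (e j))
     + (G p a j + snd (e a) * df p (extend_D D (E p j))) *\<^sub>R e j)"
    unfolding frechet_derivative_at[OF X_has_derivative, symmetric] G_def
    by (simp only: linear_sum[OF T] linear_add[OF T] linear_cmul[OF T] flow_D_commute[OF D] flow_E snd_E)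
  then have "coordinate e l (P p a) = (\<Sum>j = 1..7. F j p * (snd (e a) * d l j)
     + (G p a j + snd (e a) * df p (extend_D D (E p j))) * coordinate e l (e j)) - F 7 p * d l a"
    unfolding P_def d_def
    by (simp only: linear_sum[OF c] linear_add[OF c] linear_diff[OF c] linear_cmul[OF c] real_scaleR_def)
  also have "(\<Sum>j = 1..7. F j p * (snd (e a) * d l j)
     + (G p a j + snd (e a) * df p (extend_D D (E p j))) * coordinate e l (e j)) =
     (\<Sum>j = 1..7. F j p * (snd (e a) * d l j)) + (\<Sum>j = 1..7. if j = l then G p a j + snd (e a) * df p (extend_D D (E p j)) else 0)"
    unfolding sum.distrib[symmetric]
  proof (rule sum.cong[OF refl])
    fix j :: nat assume "j \<in> {1..7}"
    then have "coordinate e l (e j) = (if j = l then 1 else 0)" using coordinate_basis[OF e, of l j] l dim by simp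
    then show "F j p * (snd (e a) * d l j) + (G p a j + snd (e a) * df p (extend_D D (E p j))) * coordinate e l (e j)
      = F j p * (snd (e a) * d l j) + (if j = l then G p a j + snd (e a) * df p (extend_D D (E p j)) else 0)"
      by simp
  qed
  also have "(\<Sum>j = 1..7. if j = l then G p a j + snd (e a) * df p (extend_D D (E p j)) else 0)
      = G p a l + snd (e a) * (\<Sum>k = 1..7. d k l * F k p)"
    using l by (simp add: df_extend_D)
  finally show ?thesis
    using snd_e[OF a] by (simp add: sum.distrib algebra_simps)
qed

lemma d_7:
  shows "j \<in> {1..7} \<Longrightarrow> d 7 j = 0" "k \<in> {1..7} \<Longrightarrow> d k 7 = 0"
proof -
  have "extend_D D (e 7) = 0" using linear_0[OF D] by (simp add: extend_D_def e7 zero_prod_def)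
  then show "d k 7 = 0" for k unfolding d_def using linear_0[OF linear_coordinate[OF e]] by simp
  have "(\<Sum>k = 1..7. d k j * snd (e k)) = snd (extend_D D (e j))"
    unfolding extend_D_expand[of j] snd_sum by (simp only: snd_scaleR real_scaleR_def)
  moreover have "(\<Sum>k = 1..7. d k j * snd (e k)) = (\<Sum>k = 1..7. if k = 7 then d k j else 0)"
    by (rule sum.cong[OF refl]) (simp add: snd_e)
  ultimately show "d 7 j = 0" by (simp add: extend_D_def)
qed

text \<open>Relations with constant coefficients between the components of \<open>X\<close> may be differentiated along the abelian
  directions, where they pass to the components of the second derivative.\<close>

lemma F_relation_derivative:
  assumes rel: "\<And>p. (\<Sum>k = 1..6. c k * F k p) = 0" and i: "i \<in> {1..6}"
  shows "(\<Sum>k = 1..6. c k * G p i k) = 0"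
proof -
  have "((\<lambda>p. \<Sum>k = 1..6. c k * F k p) has_derivative
      (\<lambda>v. \<Sum>k = 1..6. c k * (hess p v (E p k) + snd v * df p (extend_D D (E p k))))) (at p)"
    by (intro has_derivative_sum has_derivative_mult_right F_has_derivative)
  then have "((\<lambda>p. 0) has_derivative
      (\<lambda>v. \<Sum>k = 1..6. c k * (hess p v (E p k) + snd v * df p (extend_D D (E p k))))) (at p)"
    unfolding rel .
  from has_derivative_unique[OF this has_derivative_const]
  have "(\<Sum>k = 1..6. c k * (hess p (E p i) (E p k) + snd (E p i) * df p (extend_D D (E p k)))) = 0" by metis
  then show ?thesis using eh[OF i] by (simp add: snd_E G_def)
qed

lemma F_7_constant:
  assumes "\<And>p. F 7 p = c" shows "G p 7 7 = 0"
proof -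
  have "((\<lambda>p. c) has_derivative (\<lambda>v. hess p v (E p 7) + snd v * df p (extend_D D (E p 7)))) (at p)"
    using F_has_derivative[of 7 p] assms unfolding F_def by simp
  from has_derivative_unique[OF this has_derivative_const]
  have "hess p (E p 7) (E p 7) + snd (E p 7) * df p (extend_D D (E p 7)) = 0" by metis
  then show ?thesis by (simp add: G_def df_extend_D d_7)
qed

subsection \<open>The restriction of the dual four-form\<close>

lemma coordinate_e: "coordinate e i (e j) = (if i = j then 1 else 0)" if "1 \<le> i" "i \<le> 7" "1 \<le> j" "j \<le> 7"
  using coordinate_basis[OF e] that by simp

lemmas phi_rules = phi_std_eval coform_three coform_two coordinate_e

lemma frame_vol_coform: "frame_vol e = coform e [1, 2, 3, 4, 5, 6, 7]"
proof -
  have "[1..<Suc 7] = [1, 2, 3, 4, 5, 6, 7::nat]" by (simp add: upt_rec[of 1 "numeral n" for n] del: One_nat_def)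
  then show ?thesis unfolding frame_vol_def dim by simp
qed

lemma coform_basis_rules:
  assumes "1 \<le> i" "i \<le> 7"
  shows "set js \<subseteq> {1..7} \<Longrightarrow> distinct js \<Longrightarrow> coform e (i # k # ks) (map e js) =
    (if i \<in> set js then (-1) ^ length (takeWhile (\<lambda>j. j \<noteq> i) js) * coform e (k # ks) (map e (remove1 i js)) else 0)"
    and "1 \<le> j \<Longrightarrow> j \<le> 7 \<Longrightarrow> coform e [i] (map e [j]) = (if i = j then 1 else 0)"
proof -
  show "set js \<subseteq> {1..7} \<Longrightarrow> distinct js \<Longrightarrow> coform e (i # k # ks) (map e js) =
    (if i \<in> set js then (-1) ^ length (takeWhile (\<lambda>j. j \<noteq> i) js) * coform e (k # ks) (map e (remove1 i js)) else 0)"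
    using coform_basis_vectors[OF e, of i js "k # ks"] assms by (simp only: dim) simp
  show "1 \<le> j \<Longrightarrow> j \<le> 7 \<Longrightarrow> coform e [i] (map e [j]) = (if i = j then 1 else 0)"
    unfolding list.map coform_one by (rule coordinate_e[OF assms])
qed

abbreviation complement :: "nat list \<Rightarrow> nat list" where
  "complement ks \<equiv> filter (\<lambda>i. i \<notin> set ks) [7, 1, 2, 3, 4, 5, 6]"

lemma complement:
  assumes "distinct ks" "set ks \<subseteq> {1..6}"
  shows "distinct (complement ks @ ks)" "set (complement ks @ ks) = {1..DIM(GD)}"
    "length (complement ks) + length ks = 7"
proof -
  have s: "set [7, 1, 2, 3, 4, 5, 6] = {1..7::nat}" by (simp, auto)
  have k: "set ks \<subseteq> {1..7}" using assms(2) by (rule order.trans) simp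
  show d: "distinct (complement ks @ ks)" using assms(1) by auto
  show u: "set (complement ks @ ks) = {1..DIM(GD)}" unfolding dim set_append set_filter s using k by blast
  show "length (complement ks) + length ks = 7" using distinct_card[OF d] u dim by simp
qed

lemma dual_form_eval:
  assumes "distinct ks" "set ks \<subseteq> {1..6}" "length ks = 4"
  shows "dual_form (map e ks) = phi_std e (map e (complement ks)) * frame_vol e (map e (complement ks @ ks))"
  unfolding dual_form_def
proof (rule frame_star_complementary[OF e form_phi complement(1,2)[OF assms(1,2)]])
  show "length (complement ks) = 3" using complement(3)[OF assms(1,2)] unfolding assms(3) by linarith
qed

text \<open>The form \<open>\<omega> \<and> \<omega> / 2\<close>, to which \<open>*\<phi>\<close> restricts on \<open>\<hh>\<close>.\<close>

definition omega_squared :: "GD form" where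
  "omega_squared vs = coform e [1,2,3,4] vs + coform e [1,2,5,6] vs + coform e [3,4,5,6] vs"


lemma ball_Cons: "(\<forall>x\<in>set (y # ys). Q x) \<longleftrightarrow> Q y \<and> (\<forall>x\<in>set ys. Q x)"
  by simp

lemma increasing_four:
  assumes "a < b" "b < c" "c < (k::nat)" "{a, b, c, k} \<subseteq> {1..6}"
  shows "[a, b, c, k] \<in> set [[1,2,3,4], [1,2,3,5], [1,2,3,6], [1,2,4,5], [1,2,4,6], [1,2,5,6], [1,3,4,5], [1,3,4,6],
    [1,3,5,6], [1,4,5,6], [2,3,4,5], [2,3,4,6], [2,3,5,6], [2,4,5,6], [3,4,5,6]]"
proof -
  have "a \<in> {1,2,3}" "b \<in> {2,3,4}" "c \<in> {3,4,5}" "k \<in> {4,5,6}" using assms by auto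
  then show ?thesis using assms by (elim insertE emptyE) simp_all
qed

lemma dual_form_basis:
  "\<forall>ks\<in>set [[1,2,3,4], [1,2,3,5], [1,2,3,6], [1,2,4,5], [1,2,4,6], [1,2,5,6], [1,3,4,5], [1,3,4,6],
    [1,3,5,6], [1,4,5,6], [2,3,4,5], [2,3,4,6], [2,3,5,6], [2,4,5,6], [3,4,5,6]].
    dual_form (map e ks) = omega_squared (map e ks)"
  unfolding ball_Cons
  by (simp add: dual_form_eval omega_squared_def frame_vol_coform phi_std_def coform_basis_rules
      del: One_nat_def coform.simps list.map)

lemma form_omega_squared: "is_form 4 omega_squared"
proof -
  have c: "is_form 4 (coform e [i, j, k, l])" for i j k l
    using is_form_coform[OF e, of "[i, j, k, l]"] by (simp add: eval_nat_numeral del: coform.simps)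
  have p: "is_form 4 (\<lambda>vs. \<alpha> vs + \<beta> vs)" if "is_form 4 \<alpha>" "is_form 4 \<beta>" for \<alpha> \<beta> :: "GD form"
    using is_form_comb[OF that, of 1 1] by simp
  show ?thesis unfolding omega_squared_def[abs_def] by (intro p c)
qed

lemma dual_form_horizontal:
  assumes "set vs \<subseteq> span (e ` {1..6})"
  shows "dual_form vs = omega_squared vs"
proof -
  have "1 * dual_form vs + (-1) * omega_squared vs = 0"
  proof (rule is_form_zero_increasing[OF is_form_comb[OF form_dual form_omega_squared] _ assms])
    fix js :: "nat list" assume js: "sorted_wrt (<) js" "set js \<subseteq> {1..6}" "length js = 4"
    from js(3) obtain a b c k where abck: "js = [a, b, c, k]" by (auto simp: eval_nat_numeral length_Suc_conv)
    have "a < b" "b < c" "c < k" "{a, b, c, k} \<subseteq> {1..6}" using js(1,2) unfolding abck by auto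
    note increasing_four[OF this, folded abck]
    then have "dual_form (map e js) = omega_squared (map e js)" using dual_form_basis by blast
    then show "1 * dual_form (map e js) + (-1) * omega_squared (map e js) = 0" by simp
  qed
  then show ?thesis by simp
qed

lemma extend_D_horizontal: "j \<in> {1..6} \<Longrightarrow> extend_D D (e j) \<in> span (e ` {1..6})"
proof -
  assume j: "j \<in> {1..6}"
  have "extend_D D (e j) = (\<Sum>k\<in>{1..6}. d k j *\<^sub>R e k)"
  proof -
    have s: "{1..7} = insert 7 {1..6::nat}" by auto
    have "d 7 j = 0" using d_7(1)[of j] j by simp
    then show ?thesis unfolding extend_D_expand[of j] s by (subst sum.insert) simp_all
  qed
  then show ?thesis by (simp only:) (intro span_sum span_scale span_base imageI)
qed

lemma ce_deriv_e7:
  assumes "set js \<subseteq> {1..6}"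
  shows "ce_deriv D \<alpha> (map e (7 # js)) = - derive_form (extend_D D) \<alpha> (map e js)"
  unfolding list.map using assms eh e7 by (intro ce_deriv_vertical) auto

lemma derive_dual_form:
  assumes "i \<in> {1..6}" "j \<in> {1..6}" "k \<in> {1..6}" "l \<in> {1..6}"
  shows "derive_form (extend_D D) dual_form [e i, e j, e k, e l] =
    omega_squared [extend_D D (e i), e j, e k, e l] + omega_squared [e i, extend_D D (e j), e k, e l]
    + omega_squared [e i, e j, extend_D D (e k), e l] + omega_squared [e i, e j, e k, extend_D D (e l)]"
proof -
  have "e i \<in> span (e ` {1..6})" if "i \<in> {1..6}" for i using that by (intro span_base imageI)
  then show ?thesis
    using assms extend_D_horizontal
    by (simp add: derive_form_Cons derive_form_Nil iota_def dual_form_horizontal)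
qed

lemma d_coordinate: "coordinate e k (extend_D D (e j)) = d k j"
  by (simp add: d_def)

lemma omega_squared_eval:
  "omega_squared [u, v, w, x] = coform e [1,2,3,4] [u, v, w, x] + coform e [1,2,5,6] [u, v, w, x] + coform e [3,4,5,6] [u, v, w, x]"
  by (simp add: omega_squared_def)

subsection \<open>Closedness and the torsion form\<close>

definition rho_equation :: "nat \<Rightarrow> nat \<Rightarrow> nat \<Rightarrow> bool" where
  "rho_equation a b c \<longleftrightarrow> phi_std e [extend_D D (e a), e b, e c] + phi_std e [e a, extend_D D (e b), e c]
     + phi_std e [e a, e b, extend_D D (e c)] = 0"

lemma rho_equation: "a \<in> {1..6} \<Longrightarrow> b \<in> {1..6} \<Longrightarrow> c \<in> {1..6} \<Longrightarrow> rho_equation a b c"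
  using closed_rho[of a b c] by (simp add: rho_equation_def derive_form_Cons derive_form_Nil iota_def)

text \<open>The twenty equations \<open>D\<cdot>\<rho> = 0\<close> cut out the stabiliser \<open>sl(3, \<complex>)\<close> of \<open>\<rho>\<close>.\<close>

lemma d_complex_linear:
  shows "d 2 2 = d 1 1" "d 2 1 = - d 1 2" "d 4 4 = d 3 3" "d 4 3 = - d 3 4" "d 6 6 = d 5 5" "d 6 5 = - d 5 6"
    "d 2 4 = d 1 3" "d 2 3 = - d 1 4" "d 4 2 = d 3 1" "d 4 1 = - d 3 2"
    "d 2 6 = d 1 5" "d 2 5 = - d 1 6" "d 6 2 = d 5 1" "d 6 1 = - d 5 2"
    "d 4 6 = d 3 5" "d 4 5 = - d 3 6" "d 6 4 = d 5 3" "d 6 3 = - d 5 4"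
    and d_traceless: "d 1 1 + d 3 3 + d 5 5 = 0" "d 1 2 + d 3 4 + d 5 6 = 0"
proof -
  have "rho_equation 1 2 3" "rho_equation 1 2 4" "rho_equation 1 2 5" "rho_equation 1 2 6" "rho_equation 1 3 4" "rho_equation 1 3 5" "rho_equation 1 3 6"
    "rho_equation 1 4 5" "rho_equation 1 4 6" "rho_equation 1 5 6" "rho_equation 2 3 4" "rho_equation 2 3 5" "rho_equation 2 3 6" "rho_equation 2 4 5"
    "rho_equation 2 4 6" "rho_equation 2 5 6" "rho_equation 3 4 5" "rho_equation 3 4 6" "rho_equation 3 5 6" "rho_equation 4 5 6"
    by (simp_all add: rho_equation)
  note eqs = this[unfolded rho_equation_def, simplified phi_rules d_coordinate, simplified]
  have "d 7 1 = 0" "d 7 2 = 0" "d 7 3 = 0" "d 7 4 = 0" "d 7 5 = 0" "d 7 6 = 0" by (simp_all add: d_7)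
  note d7 = this
  \<comment> \<open>The components along \<open>e\<^sub>7\<close> would enter through \<open>\<omega> \<and> e\<^sup>7\<close>; they vanish because \<open>D\<close> preserves \<open>\<hh>\<close>.\<close>
  show "d 2 2 = d 1 1" "d 2 1 = - d 1 2" "d 4 4 = d 3 3" "d 4 3 = - d 3 4" "d 6 6 = d 5 5" "d 6 5 = - d 5 6"
    "d 2 4 = d 1 3" "d 2 3 = - d 1 4" "d 4 2 = d 3 1" "d 4 1 = - d 3 2"
    "d 2 6 = d 1 5" "d 2 5 = - d 1 6" "d 6 2 = d 5 1" "d 6 1 = - d 5 2"
    "d 4 6 = d 3 5" "d 4 5 = - d 3 6" "d 6 4 = d 5 3" "d 6 3 = - d 5 4"
    "d 1 1 + d 3 3 + d 5 5 = 0" "d 1 2 + d 3 4 + d 5 6 = 0"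
    using eqs d7 unfolding One_nat_def[symmetric] by linarith+
qed

lemma d_7_simps:
  "d 7 1 = 0" "d 7 2 = 0" "d 7 3 = 0" "d 7 4 = 0" "d 7 5 = 0" "d 7 6 = 0" "d 7 7 = 0"
  "d 1 7 = 0" "d 2 7 = 0" "d 3 7 = 0" "d 4 7 = 0" "d 5 7 = 0" "d 6 7 = 0"
  by (simp_all add: d_7)

lemma d_trace_rules: "d 5 5 = - d 1 1 - d 3 3" "d 5 6 = - d 1 2 - d 3 4"
  using d_traceless by simp_all

lemma torsion_pair:
  assumes "distinct [j, k, a, b, c, l]" "{j, k, a, b, c, l} = {1..6}"
  shows "torsion [e j, e k] = - (omega_squared [extend_D D (e a), e b, e c, e l] + omega_squared [e a, extend_D D (e b), e c, e l]
    + omega_squared [e a, e b, extend_D D (e c), e l] + omega_squared [e a, e b, e c, extend_D D (e l)])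
    * frame_vol e (map e [7, a, b, c, l, j, k])"
proof -
  have mem: "j \<in> {1..6}" "k \<in> {1..6}" "a \<in> {1..6}" "b \<in> {1..6}" "c \<in> {1..6}" "l \<in> {1..6}"
    unfolding assms(2)[symmetric] by simp_all
  have "{1..DIM(GD)} = insert 7 {1..6}" unfolding dim by auto
  then have "set ([7, a, b, c, l] @ [j, k]) = {1..DIM(GD)}" using assms(2) by auto
  then have "torsion (map e [j, k]) = ce_deriv D dual_form (map e [7, a, b, c, l]) * frame_vol e (map e ([7, a, b, c, l] @ [j, k]))"
    unfolding torsion_def using assms(1) mem
    by (intro frame_star_complementary[OF e form_ce_dual]) auto
  moreover have "ce_deriv D dual_form (map e [7, a, b, c, l]) = - derive_form (extend_D D) dual_form (map e [a, b, c, l])"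
    by (rule ce_deriv_e7) (use mem in simp)
  ultimately show ?thesis using derive_dual_form[OF mem(3-6)] by simp
qed

text \<open>With \<open>S\<close> the symmetric part of \<open>D\<close>, the form \<open>*d*\<phi>\<close> is \<open>2 \<langle>J S\<cdot>, \<cdot>\<rangle>\<close>: applying \<open>D\<close> to \<open>\<omega>\<^sup>2/2\<close> gives \<open>\<omega>\<close> wedged with the primitive
  form \<open>2 \<langle>J S\<cdot>, \<cdot>\<rangle>\<close>, and the star of \<open>\<hh>\<close> sends this product back to the primitive form, up to sign.\<close>

lemma torsion_values:
  "torsion [e 1, e 2] = (d 1 1 + d 1 1)"
    "torsion [e 1, e 3] = - (d 4 1 + d 1 4)"
    "torsion [e 1, e 4] = (d 3 1 + d 1 3)"
    "torsion [e 1, e 5] = - (d 6 1 + d 1 6)"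
    "torsion [e 1, e 6] = (d 5 1 + d 1 5)"
    "torsion [e 2, e 3] = - (d 4 2 + d 2 4)"
    "torsion [e 2, e 4] = (d 3 2 + d 2 3)"
    "torsion [e 2, e 5] = - (d 6 2 + d 2 6)"
    "torsion [e 2, e 6] = (d 5 2 + d 2 5)"
    "torsion [e 3, e 4] = (d 3 3 + d 3 3)"
    "torsion [e 3, e 5] = - (d 6 3 + d 3 6)"
    "torsion [e 3, e 6] = (d 5 3 + d 3 5)"
    "torsion [e 4, e 5] = - (d 6 4 + d 4 6)"
    "torsion [e 4, e 6] = (d 5 4 + d 4 5)"
    "torsion [e 5, e 6] = (d 5 5 + d 5 5)"
proof -
  have s: "{1..6} = {1, 2, 3, 4, 5, 6::nat}" by auto
  note rules = s insert_commute omega_squared_eval coform_four coform_three coform_two coordinate_e d_coordinate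
    d_complex_linear d_trace_rules
  have "frame_vol e (map e [7, 3, 4, 5, 6, 1, 2]) = 1"
    by (simp add: frame_vol_coform coform_basis_rules del: One_nat_def coform.simps list.map)
  then show "torsion [e 1, e 2] = (d 1 1 + d 1 1)"
    using torsion_pair[of 1 2 3 4 5 6] by (simp add: rules del: One_nat_def coform.simps list.map)
  have "frame_vol e (map e [7, 2, 4, 5, 6, 1, 3]) = -1"
    by (simp add: frame_vol_coform coform_basis_rules del: One_nat_def coform.simps list.map)
  then show "torsion [e 1, e 3] = - (d 4 1 + d 1 4)"
    using torsion_pair[of 1 3 2 4 5 6] by (simp add: rules del: One_nat_def coform.simps list.map)
  have "frame_vol e (map e [7, 2, 3, 5, 6, 1, 4]) = 1"
    by (simp add: frame_vol_coform coform_basis_rules del: One_nat_def coform.simps list.map)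
  then show "torsion [e 1, e 4] = (d 3 1 + d 1 3)"
    using torsion_pair[of 1 4 2 3 5 6] by (simp add: rules del: One_nat_def coform.simps list.map)
  have "frame_vol e (map e [7, 2, 3, 4, 6, 1, 5]) = -1"
    by (simp add: frame_vol_coform coform_basis_rules del: One_nat_def coform.simps list.map)
  then show "torsion [e 1, e 5] = - (d 6 1 + d 1 6)"
    using torsion_pair[of 1 5 2 3 4 6] by (simp add: rules del: One_nat_def coform.simps list.map)
  have "frame_vol e (map e [7, 2, 3, 4, 5, 1, 6]) = 1"
    by (simp add: frame_vol_coform coform_basis_rules del: One_nat_def coform.simps list.map)
  then show "torsion [e 1, e 6] = (d 5 1 + d 1 5)"
    using torsion_pair[of 1 6 2 3 4 5] by (simp add: rules del: One_nat_def coform.simps list.map)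
  have "frame_vol e (map e [7, 1, 4, 5, 6, 2, 3]) = 1"
    by (simp add: frame_vol_coform coform_basis_rules del: One_nat_def coform.simps list.map)
  then show "torsion [e 2, e 3] = - (d 4 2 + d 2 4)"
    using torsion_pair[of 2 3 1 4 5 6] by (simp add: rules del: One_nat_def coform.simps list.map)
  have "frame_vol e (map e [7, 1, 3, 5, 6, 2, 4]) = -1"
    by (simp add: frame_vol_coform coform_basis_rules del: One_nat_def coform.simps list.map)
  then show "torsion [e 2, e 4] = (d 3 2 + d 2 3)"
    using torsion_pair[of 2 4 1 3 5 6] by (simp add: rules del: One_nat_def coform.simps list.map)
  have "frame_vol e (map e [7, 1, 3, 4, 6, 2, 5]) = 1"
    by (simp add: frame_vol_coform coform_basis_rules del: One_nat_def coform.simps list.map)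
  then show "torsion [e 2, e 5] = - (d 6 2 + d 2 6)"
    using torsion_pair[of 2 5 1 3 4 6] by (simp add: rules del: One_nat_def coform.simps list.map)
  have "frame_vol e (map e [7, 1, 3, 4, 5, 2, 6]) = -1"
    by (simp add: frame_vol_coform coform_basis_rules del: One_nat_def coform.simps list.map)
  then show "torsion [e 2, e 6] = (d 5 2 + d 2 5)"
    using torsion_pair[of 2 6 1 3 4 5] by (simp add: rules del: One_nat_def coform.simps list.map)
  have "frame_vol e (map e [7, 1, 2, 5, 6, 3, 4]) = 1"
    by (simp add: frame_vol_coform coform_basis_rules del: One_nat_def coform.simps list.map)
  then show "torsion [e 3, e 4] = (d 3 3 + d 3 3)"
    using torsion_pair[of 3 4 1 2 5 6] by (simp add: rules del: One_nat_def coform.simps list.map)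
  have "frame_vol e (map e [7, 1, 2, 4, 6, 3, 5]) = -1"
    by (simp add: frame_vol_coform coform_basis_rules del: One_nat_def coform.simps list.map)
  then show "torsion [e 3, e 5] = - (d 6 3 + d 3 6)"
    using torsion_pair[of 3 5 1 2 4 6] by (simp add: rules del: One_nat_def coform.simps list.map)
  have "frame_vol e (map e [7, 1, 2, 4, 5, 3, 6]) = 1"
    by (simp add: frame_vol_coform coform_basis_rules del: One_nat_def coform.simps list.map)
  then show "torsion [e 3, e 6] = (d 5 3 + d 3 5)"
    using torsion_pair[of 3 6 1 2 4 5] by (simp add: rules del: One_nat_def coform.simps list.map)
  have "frame_vol e (map e [7, 1, 2, 3, 6, 4, 5]) = 1"
    by (simp add: frame_vol_coform coform_basis_rules del: One_nat_def coform.simps list.map)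
  then show "torsion [e 4, e 5] = - (d 6 4 + d 4 6)"
    using torsion_pair[of 4 5 1 2 3 6] by (simp add: rules del: One_nat_def coform.simps list.map)
  have "frame_vol e (map e [7, 1, 2, 3, 5, 4, 6]) = -1"
    by (simp add: frame_vol_coform coform_basis_rules del: One_nat_def coform.simps list.map)
  then show "torsion [e 4, e 6] = (d 5 4 + d 4 5)"
    using torsion_pair[of 4 6 1 2 3 5] by (simp add: rules del: One_nat_def coform.simps list.map)
  have "frame_vol e (map e [7, 1, 2, 3, 4, 5, 6]) = 1"
    by (simp add: frame_vol_coform coform_basis_rules del: One_nat_def coform.simps list.map)
  then show "torsion [e 5, e 6] = (d 5 5 + d 5 5)"
    using torsion_pair[of 5 6 1 2 3 4] by (simp add: rules del: One_nat_def coform.simps list.map)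
qed

subsection \<open>The soliton equation along the abelian ideal\<close>

definition grad_hess :: "GD \<Rightarrow> nat \<Rightarrow> GD" where
  "grad_hess p a = (\<Sum>l = 1..7. G p a l *\<^sub>R e l)"

lemma coordinate_grad_hess:
  assumes "1 \<le> l" "l \<le> 7"
  shows "coordinate e l (grad_hess p a) = G p a l"
proof -
  note c = linear_coordinate[OF e, of l]
  have "coordinate e l (grad_hess p a) = (\<Sum>k = 1..7. G p a k * coordinate e l (e k))"
    unfolding grad_hess_def linear_sum[OF c] linear_cmul[OF c] real_scaleR_def ..
  also have "\<dots> = (\<Sum>k = 1..7. if k = l then G p a k else 0)"
    by (rule sum.cong[OF refl]) (use coordinate_e assms in auto)
  finally show ?thesis using assms by simp
qed

lemma P_horizontal:
  assumes a: "a \<in> {1..6}"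
  shows "P p a = grad_hess p a - F 7 p *\<^sub>R extend_D D (e a)"
proof -
  have "P p a = (\<Sum>l = 1..7. coordinate e l (P p a) *\<^sub>R e l)"
    using coordinate_expansion[OF e, of "P p a"] unfolding dim .
  also have "\<dots> = (\<Sum>l = 1..7. G p a l *\<^sub>R e l - F 7 p *\<^sub>R (d l a *\<^sub>R e l))"
    by (rule sum.cong[OF refl]) (use a in \<open>simp add: coordinate_P scaleR_diff_left\<close>)
  also have "\<dots> = grad_hess p a - F 7 p *\<^sub>R extend_D D (e a)"
    unfolding sum_subtractf scaleR_sum_right[symmetric] extend_D_expand[symmetric] grad_hess_def ..
  finally show ?thesis .
qed

definition horizontal_equation :: "GD \<Rightarrow> nat \<Rightarrow> nat \<Rightarrow> nat \<Rightarrow> bool" where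
  "horizontal_equation p a b c \<longleftrightarrow> lam * phi_std e [e a, e b, e c] + (phi_std e [grad_hess p a, e b, e c]
     + phi_std e [e a, grad_hess p b, e c] + phi_std e [e a, e b, grad_hess p c]) = 0"

text \<open>The Laplacian is exact and left-invariant, so it has no component along \<open>\<hh>\<close>. The term \<open>F\<^sub>7 D\<close> of \<open>P\<close> drops out
  because \<open>D\<close> annihilates \<open>\<rho>\<close>.\<close>

lemma horizontal_equation:
  assumes "a \<in> {1..6}" "b \<in> {1..6}" "c \<in> {1..6}"
  shows "horizontal_equation p a b c"
proof -
  have "ce_deriv D torsion [e a, e b, e c] = 0"
    using assms eh by (intro ce_deriv_horizontal) auto
  moreover have "phi_std e (us @ P p i # ws) = phi_std e (us @ grad_hess p i # ws) - F 7 p * phi_std e (us @ extend_D D (e i) # ws)"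
    if "Suc (length us + length ws) = 3" "i \<in> {1..6}" for us ws i
    unfolding P_horizontal[OF that(2)] linear_diff[OF is_form_linear_append[OF form_phi that(1)]]
      linear_cmul[OF is_form_linear_append[OF form_phi that(1)]] by simp
  from this[of "[]" "[e b, e c]" a] this[of "[e a]" "[e c]" b] this[of "[e a, e b]" "[]" c]
  have "phi_std e [P p a, e b, e c] = phi_std e [grad_hess p a, e b, e c] - F 7 p * phi_std e [extend_D D (e a), e b, e c]"
    "phi_std e [e a, P p b, e c] = phi_std e [e a, grad_hess p b, e c] - F 7 p * phi_std e [e a, extend_D D (e b), e c]"
    "phi_std e [e a, e b, P p c] = phi_std e [e a, e b, grad_hess p c] - F 7 p * phi_std e [e a, e b, extend_D D (e c)]"
    using assms by simp_all
  moreover have "F 7 p * (phi_std e [extend_D D (e a), e b, e c] + phi_std e [e a, extend_D D (e b), e c]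
     + phi_std e [e a, e b, extend_D D (e c)]) = 0"
    using rho_equation[OF assms] unfolding rho_equation_def by simp
  ultimately show ?thesis
    using soliton_frame[of a b c p] assms unfolding horizontal_equation_def by (simp add: algebra_simps)
qed

text \<open>The decomposition of three-forms on \<open>\<hh>\<close>: a symmetric endomorphism acting on \<open>\<rho>\<close> gives a multiple of \<open>\<rho>\<close> from its
  trace, nothing from its trace-free part commuting with \<open>J\<close>, and independent terms from the part
  anticommuting with \<open>J\<close>; the mixed derivatives enter through \<open>\<alpha> \<and> \<omega>\<close>, which is independent of both.\<close>

lemma G_complex_linear:
  shows "G p 1 7 = 0" "G p 2 7 = 0" "G p 3 7 = 0" "G p 4 7 = 0" "G p 5 7 = 0" "G p 6 7 = 0"
    "G p 2 2 = G p 1 1" "G p 1 2 = 0" "G p 4 4 = G p 3 3" "G p 3 4 = 0" "G p 6 6 = G p 5 5" "G p 5 6 = 0"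
    "G p 2 4 = G p 1 3" "G p 2 3 = - G p 1 4" "G p 2 6 = G p 1 5" "G p 2 5 = - G p 1 6"
    "G p 4 6 = G p 3 5" "G p 4 5 = - G p 3 6"
    and G_trace: "G p 1 1 + G p 3 3 + G p 5 5 = - lam"
proof -
  have "horizontal_equation p 1 2 3" "horizontal_equation p 1 2 4" "horizontal_equation p 1 2 5" "horizontal_equation p 1 2 6" "horizontal_equation p 1 3 4" "horizontal_equation p 1 3 5" "horizontal_equation p 1 3 6" "horizontal_equation p 1 4 5" "horizontal_equation p 1 4 6" "horizontal_equation p 1 5 6" "horizontal_equation p 2 3 4" "horizontal_equation p 2 3 5" "horizontal_equation p 2 3 6" "horizontal_equation p 2 4 5" "horizontal_equation p 2 4 6" "horizontal_equation p 2 5 6" "horizontal_equation p 3 4 5" "horizontal_equation p 3 4 6" "horizontal_equation p 3 5 6" "horizontal_equation p 4 5 6"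
    by (simp_all add: horizontal_equation)
  note eqs = this[unfolded horizontal_equation_def, simplified phi_rules coordinate_grad_hess, simplified]
  note sym = G_sym[of p 2 1] G_sym[of p 3 1] G_sym[of p 4 1] G_sym[of p 5 1] G_sym[of p 6 1] G_sym[of p 3 2]
    G_sym[of p 4 2] G_sym[of p 5 2] G_sym[of p 6 2] G_sym[of p 4 3] G_sym[of p 5 3] G_sym[of p 6 3]
    G_sym[of p 5 4] G_sym[of p 6 4] G_sym[of p 6 5]
  show "G p 1 7 = 0" "G p 2 7 = 0" "G p 3 7 = 0" "G p 4 7 = 0" "G p 5 7 = 0" "G p 6 7 = 0"
    "G p 2 2 = G p 1 1" "G p 1 2 = 0" "G p 4 4 = G p 3 3" "G p 3 4 = 0" "G p 6 6 = G p 5 5" "G p 5 6 = 0"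
    "G p 2 4 = G p 1 3" "G p 2 3 = - G p 1 4" "G p 2 6 = G p 1 5" "G p 2 5 = - G p 1 6"
    "G p 4 6 = G p 3 5" "G p 4 5 = - G p 3 6" "G p 1 1 + G p 3 3 + G p 5 5 = - lam"
    using eqs sym unfolding One_nat_def[symmetric] by linarith+
qed

subsection \<open>The soliton equation across the abelian ideal\<close>

text \<open>The components of \<open>2 S X\<close>, where \<open>S\<close> is the symmetric part of \<open>D\<close>.\<close>

definition SF :: "GD \<Rightarrow> nat \<Rightarrow> real" where
  "SF p l = (\<Sum>k = 1..7. (d k l + d l k) * F k p)"

definition vertical_equation :: "GD \<Rightarrow> nat \<Rightarrow> nat \<Rightarrow> bool" where
  "vertical_equation p j k \<longleftrightarrow> (\<Sum>l = 1..6. d l j * torsion [e l, e k]) + (\<Sum>l = 1..6. d l k * torsion [e j, e l])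
     = lam * phi_std e [e 7, e j, e k] + (phi_std e [P p 7, e j, e k] + phi_std e [e 7, P p j, e k] + phi_std e [e 7, e j, P p k])"

lemma vertical_equation:
  assumes "j \<in> {1..6}" "k \<in> {1..6}"
  shows "vertical_equation p j k"
proof -
  have s: "{1..7} = insert 7 {1..6::nat}" by auto
  have D: "extend_D D (e i) = (\<Sum>l = 1..6. d l i *\<^sub>R e l)" if "i \<in> {1..6}" for i
  proof -
    have "d 7 i = 0" using d_7(1)[of i] that by simp
    then show ?thesis unfolding extend_D_expand[of i] s by (subst sum.insert) simp_all
  qed
  have l1: "linear (\<lambda>v. torsion [v, e k])" using is_form_linear_append[OF form_torsion, of "[]" "[e k]"] by simp
  have l2: "linear (\<lambda>v. torsion [e j, v])" using is_form_linear_append[OF form_torsion, of "[e j]" "[]"] by simp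
  have "ce_deriv D torsion (map e [7, j, k]) = - derive_form (extend_D D) torsion (map e [j, k])"
    by (rule ce_deriv_e7) (use assms in simp)
  then have "- ce_deriv D torsion [e 7, e j, e k] = torsion [extend_D D (e j), e k] + torsion [e j, extend_D D (e k)]"
    by (simp add: derive_form_Cons derive_form_Nil iota_def)
  also have "torsion [extend_D D (e j), e k] = (\<Sum>l = 1..6. d l j * torsion [e l, e k])"
    unfolding D[OF assms(1)] linear_sum[OF l1] linear_cmul[OF l1] by simp
  also have "torsion [e j, extend_D D (e k)] = (\<Sum>l = 1..6. d l k * torsion [e j, e l])"
    unfolding D[OF assms(2)] linear_sum[OF l2] linear_cmul[OF l2] by simp
  finally show ?thesis
    using soliton_frame[of 7 j k p] assms unfolding vertical_equation_def by simp
qed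

lemma torsion_antisymmetric: "torsion [u, v] = - torsion [v, u]"
  using is_form_swap[OF form_torsion, of "[]" u v "[]"] by simp

lemma torsion_same: "torsion [u, u] = 0"
  using torsion_antisymmetric[of u u] by simp

lemma coordinate_P_rules:
  assumes "1 \<le> l" "l \<le> 7"
  shows "1 \<le> a \<Longrightarrow> a \<le> 6 \<Longrightarrow> coordinate e l (P p a) = G p a l - F 7 p * d l a"
    "coordinate e l (P p 7) = G p 7 l + SF p l"
  using coordinate_P[of l a p] coordinate_P[of l 7 p] assms d_7(2)[of l] by (simp_all add: SF_def)

lemma SF_7: "SF p 7 = 0"
  unfolding SF_def by (intro sum.neutral) (simp add: d_7)

text \<open>\<open>H\<close> is twice the symmetric part of \<open>D\<close>; working with it avoids halves.\<close>

definition M :: "complex^3^3" where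
  "M = complex_matrix d"

definition H :: "complex^3^3" where
  "H = M + adjoint_matrix M"

definition W :: "GD \<Rightarrow> complex^3^3" where
  "W p = complex_matrix (G p)"

text \<open>The components containing \<open>e\<^sup>7\<close>, split by type with respect to \<open>J\<close>. Type \<open>(2,0) + (0,2)\<close> only receives \<open>\<iota>\<^sub>v \<rho>\<close> with
  \<open>v = 2 S X\<close>; all other terms are of type \<open>(1,1)\<close>, that is, matrices commuting with \<open>J\<close>.\<close>

lemma vertical_equations:
  shows SF_zero: "SF p 1 = 0" "SF p 2 = 0" "SF p 3 = 0" "SF p 4 = 0" "SF p 5 = 0" "SF p 6 = 0"
    and W_matrix: "W p + W p = H ** M + adjoint_matrix M ** H + F 7 p *\<^sub>R H - (lam + G p 7 7) *\<^sub>R mat 1"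
proof -
  have ver: "vertical_equation p 1 2" "vertical_equation p 1 3" "vertical_equation p 1 4" "vertical_equation p 1 5" "vertical_equation p 1 6" "vertical_equation p 2 3" "vertical_equation p 2 4"
    "vertical_equation p 2 5" "vertical_equation p 2 6" "vertical_equation p 3 4" "vertical_equation p 3 5" "vertical_equation p 3 6" "vertical_equation p 4 5" "vertical_equation p 4 6"
    "vertical_equation p 5 6"
    by (simp_all add: vertical_equation)
  have s: "{1..6} = {1, 2, 3, 4, 5, 6::nat}" by auto
  note anti = torsion_antisymmetric[of "e 2" "e 1"] torsion_antisymmetric[of "e 3" "e 1"]
    torsion_antisymmetric[of "e 4" "e 1"] torsion_antisymmetric[of "e 5" "e 1"]
    torsion_antisymmetric[of "e 6" "e 1"] torsion_antisymmetric[of "e 3" "e 2"]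
    torsion_antisymmetric[of "e 4" "e 2"] torsion_antisymmetric[of "e 5" "e 2"]
    torsion_antisymmetric[of "e 6" "e 2"] torsion_antisymmetric[of "e 4" "e 3"]
    torsion_antisymmetric[of "e 5" "e 3"] torsion_antisymmetric[of "e 6" "e 3"]
    torsion_antisymmetric[of "e 5" "e 4"] torsion_antisymmetric[of "e 6" "e 4"]
    torsion_antisymmetric[of "e 6" "e 5"]
  note sym = G_sym[of p 2 1] G_sym[of p 3 1] G_sym[of p 4 1] G_sym[of p 5 1] G_sym[of p 6 1] G_sym[of p 7 1]
    G_sym[of p 3 2] G_sym[of p 4 2] G_sym[of p 5 2] G_sym[of p 6 2] G_sym[of p 7 2] G_sym[of p 4 3]
    G_sym[of p 5 3] G_sym[of p 6 3] G_sym[of p 7 3] G_sym[of p 5 4] G_sym[of p 6 4] G_sym[of p 7 4]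
    G_sym[of p 6 5] G_sym[of p 7 5] G_sym[of p 7 6]
  \<comment> \<open>The index \<open>1\<close> has to stay in the form in which the rewrite rules mention it.\<close>
  note [simp del] = One_nat_def
  note eqs = ver[unfolded vertical_equation_def s, simplified phi_rules coordinate_P_rules, simplified, simplified torsion_values
      anti torsion_same sym G_complex_linear d_complex_linear d_7_simps d_trace_rules SF_7, simplified]
  show "SF p 1 = 0" "SF p 2 = 0" using eqs(11,12,13,14) by algebra+
  show "SF p 3 = 0" "SF p 4 = 0" using eqs(4,5,8,9) by algebra+
  show "SF p 5 = 0" "SF p 6 = 0" using eqs(2,3,6,7) by algebra+
  \<comment> \<open>Imaginary parts on the diagonal vanish identically; the other entries follow from the equation of
    a diagonal block or the four equations of an off-diagonal one.\<close>
  note mat = W_def H_def M_def adjoint_matrix_def complex_matrix_entries matrix_matrix_mult_def sum_3 mat_def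
    complex_eq_iff G_complex_linear sym d_trace_rules
  let ?R = "H ** M + adjoint_matrix M ** H + F 7 p *\<^sub>R H - (lam + G p 7 7) *\<^sub>R mat 1"
  have r11: "(W p + W p) $ 1 $ 1 = ?R $ 1 $ 1"
    by (simp add: mat; intro conjI; (algebra | (use eqs(1) in algebra)))
  have r12: "(W p + W p) $ 1 $ 2 = ?R $ 1 $ 2"
    by (simp add: mat; intro conjI; (algebra | (use eqs(2,3,6,7) in algebra)))
  have r13: "(W p + W p) $ 1 $ 3 = ?R $ 1 $ 3"
    by (simp add: mat; intro conjI; (algebra | (use eqs(4,5,8,9) in algebra)))
  have r21: "(W p + W p) $ 2 $ 1 = ?R $ 2 $ 1"
    by (simp add: mat; intro conjI; (algebra | (use eqs(2,3,6,7) in algebra)))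
  have r22: "(W p + W p) $ 2 $ 2 = ?R $ 2 $ 2"
    by (simp add: mat; intro conjI; (algebra | (use eqs(10) in algebra)))
  have r23: "(W p + W p) $ 2 $ 3 = ?R $ 2 $ 3"
    by (simp add: mat; intro conjI; (algebra | (use eqs(11,12,13,14) in algebra)))
  have r31: "(W p + W p) $ 3 $ 1 = ?R $ 3 $ 1"
    by (simp add: mat; intro conjI; (algebra | (use eqs(4,5,8,9) in algebra)))
  have r32: "(W p + W p) $ 3 $ 2 = ?R $ 3 $ 2"
    by (simp add: mat; intro conjI; (algebra | (use eqs(11,12,13,14) in algebra)))
  have r33: "(W p + W p) $ 3 $ 3 = ?R $ 3 $ 3"
    by (simp add: mat; intro conjI; (algebra | (use eqs(15) in algebra)))
  show "W p + W p = ?R"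
    unfolding vec_eq_iff forall_3 by (intro conjI r11 r12 r13 r21 r22 r23 r31 r32 r33)
qed

subsection \<open>Vanishing of the torsion\<close>

lemma hermitian_H: "adjoint_matrix H = H"
  by (simp add: H_def adjoint_matrix_def vec_eq_iff)

lemma trace_H: "trace H = 0"
  using d_traceless
  by (simp add: H_def M_def trace_def sum_3 adjoint_matrix_def complex_matrix_entries complex_eq_iff)

lemma trace_W: "trace (W p) = - complex_of_real lam"
proof -
  note [simp del] = One_nat_def
  show ?thesis
    using G_trace[of p] by (simp add: W_def trace_def sum_3 complex_matrix_entries complex_eq_iff G_complex_linear)
qed

text \<open>The derivative of \<open>S X = 0\<close> along the abelian directions.\<close>

lemma HW_zero: "H ** W p = 0"
proof -
  have rel: "(\<Sum>k = 1..6. (d k l + d l k) * G p i k) = 0" if "l \<in> {1..6}" "i \<in> {1..6}" for l i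
  proof (rule F_relation_derivative[OF _ that(2)])
    fix p
    have s: "{1..7} = insert 7 {1..6::nat}" by auto
    have "SF p l = (\<Sum>k = 1..6. (d k l + d l k) * F k p)"
      unfolding SF_def s using d_7[of l] that by (subst sum.insert) simp_all
    moreover have "l = 1 \<or> l = 2 \<or> l = 3 \<or> l = 4 \<or> l = 5 \<or> l = 6" using that by auto
    ultimately show "(\<Sum>k = 1..6. (d k l + d l k) * F k p) = 0"
      using SF_zero[of p] by auto
  qed
  note [simp del] = One_nat_def
  have s: "{1..6} = {1, 2, 3, 4, 5, 6::nat}" by auto
  note sym = G_sym[of p 2 1] G_sym[of p 3 1] G_sym[of p 4 1] G_sym[of p 5 1] G_sym[of p 6 1] G_sym[of p 3 2]
    G_sym[of p 4 2] G_sym[of p 5 2] G_sym[of p 6 2] G_sym[of p 4 3] G_sym[of p 5 3] G_sym[of p 6 3]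
    G_sym[of p 5 4] G_sym[of p 6 4] G_sym[of p 6 5]
  have "\<forall>l\<in>set [1, 3, 5]. \<forall>i\<in>set [1, 2, 3, 4, 5, 6]. (\<Sum>k = 1..6. (d k l + d l k) * G p i k) = 0"
    using rel by auto
  note rels = this[unfolded s, simplified, simplified sym G_complex_linear d_complex_linear, simplified]
  show ?thesis
    unfolding vec_eq_iff forall_3
    apply (simp add: W_def H_def M_def matrix_matrix_mult_def sum_3 adjoint_matrix_def complex_matrix_entries complex_eq_iff
        G_complex_linear sym)
    by (intro conjI; (algebra | (use rels in algebra)))
qed

text \<open>If \<open>H = 0\<close>, then \<open>D\<close> is also skew, so it lies in \<open>su(3)\<close> and annihilates \<open>\<omega>\<close> as well as \<open>\<rho>\<close>.\<close>

lemma torsion_free_if_H_zero: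
  assumes "H = 0"
  shows "torsion_free \<phi>"
proof (rule torsion_freeI, rule ext)
  have "H $ i $ j = 0" for i j using assms by simp
  from this[of 1 1] this[of 1 2] this[of 1 3] this[of 2 1] this[of 2 2] this[of 2 3] this[of 3 3]
  have h: "d 1 1 = 0" "d 3 1 = - d 1 3" "d 5 1 = - d 1 5" "d 3 2 = d 1 4" "d 5 2 = d 1 6" "d 3 3 = 0"
    "d 5 3 = - d 3 5" "d 5 4 = d 3 6" "d 5 5 = 0"
    by (simp_all add: H_def M_def adjoint_matrix_def complex_matrix_entries complex_eq_iff del: One_nat_def)
  fix vs
  have dform: "is_form 3 (derive_form (extend_D D) (phi_std e))"
    by (rule is_form_derive_form[OF linear_extend_D[OF D] form_phi])
  show "derive_form (extend_D D) (phi_std e) vs = 0"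
  proof (rule is_form_zero_increasing[OF dform])
    show "set vs \<subseteq> span (e ` {1..7})" using e unfolding is_basis_def dim by blast
    fix js :: "nat list" assume js: "sorted_wrt (<) js" "set js \<subseteq> {1..7}" "length js = 3"
    from js(3) obtain a b c where abc: "js = [a, b, c]" by (auto simp: eval_nat_numeral length_Suc_conv)
    have o: "a < b" "b < c" "1 \<le> a" "c \<le> 7" using js(1,2) unfolding abc by auto
    have "derive_form (extend_D D) (phi_std e) [e a, e b, e c] = 0"
    proof (cases "c = 7")
      case False
      then show ?thesis using o by (intro closed_rho) auto
    next
      case True
      have "extend_D D (e 7) = 0" using linear_0[OF D] by (simp add: extend_D_def e7 zero_prod_def)
      then have "phi_std e [e a, e b, extend_D D (e 7)] = 0"
        using linear_0[OF is_form_linear_append[OF form_phi, of "[e a, e b]" "[]"]] by simp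
      then have "derive_form (extend_D D) (phi_std e) [e a, e b, e 7] =
          phi_std e [extend_D D (e a), e b, e 7] + phi_std e [e a, extend_D D (e b), e 7]"
        by (simp add: derive_form_Cons derive_form_Nil iota_def)
      moreover have all: "\<forall>a\<in>set [1, 2, 3, 4, 5, 6]. \<forall>b\<in>set [1, 2, 3, 4, 5, 6]. a < b \<longrightarrow>
          phi_std e [extend_D D (e a), e b, e 7] + phi_std e [e a, extend_D D (e b), e 7] = 0"
        by (simp add: phi_rules d_coordinate del: One_nat_def coform.simps)
          (simp add: d_complex_linear d_7_simps d_trace_rules h del: One_nat_def)
      moreover have "set [1, 2, 3, 4, 5, 6] = {1..6::nat}" by (simp, auto)
      then have "a \<in> set [1, 2, 3, 4, 5, 6]" "b \<in> set [1, 2, 3, 4, 5, 6]" using o True by simp_all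
      with all o(1) have "phi_std e [extend_D D (e a), e b, e 7] + phi_std e [e a, extend_D D (e b), e 7] = 0"
        by blast
      ultimately show ?thesis using True by simp
    qed
    then show "derive_form (extend_D D) (phi_std e) (map e js) = 0" by (simp add: abc)
  qed
qed

lemma is_torsion_free: "torsion_free \<phi>"
proof (rule ccontr)
  assume "\<not> torsion_free \<phi>"
  then have "H \<noteq> 0" using torsion_free_if_H_zero by blast
  then obtain n :: real where n: "trace (H ** H) = complex_of_real n" "n \<noteq> 0" "0 \<le> n"
    using hermitian_trace_square[OF hermitian_H] by metis
  note rel = trace_relations[OF H_def W_matrix HW_zero]
  \<comment> \<open>The product with \<open>H\<close>: \<open>F\<^sub>7\<close> is expressed by the constant matrix \<open>H\<close>.\<close>
  have t3: "trace (H ** H ** H) = - complex_of_real (F 7 p * n)" for p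
    using rel(1)[of p] by (simp add: n(1) trace_H scaleR_conv_of_real add_eq_0_iff)
  then have "F 7 p * n = F 7 0 * n" for p
    by (metis of_real_eq_iff neg_equal_iff_equal)
  then have F7: "F 7 p = F 7 0" for p using n(2) by (metis mult_right_cancel)
  then have G77: "G 0 7 7 = 0" by (rule F_7_constant)
  \<comment> \<open>The trace of the equation itself.\<close>
  have "complex_of_real (n - 3 * lam) = complex_of_real (- 2 * lam)"
    using rel(3)[of 0] by (simp add: trace_W n(1) trace_H G77 algebra_simps)
  then have lam: "lam = n" by (simp only: of_real_eq_iff)
  have "2 * trace (H ** H ** H ** H) = complex_of_real (n\<^sup>2)"
    using trace_power_4[OF trace_H] n(1) by simp
  \<comment> \<open>The product with \<open>H\<^sup>2\<close>.\<close>
  moreover have "2 * trace (H ** H ** H ** H) = complex_of_real (2 * (F 7 0 * F 7 0 * n + n * n))"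
    using rel(2)[of 0] t3[of 0] by (simp add: n(1) G77 lam scaleR_conv_of_real algebra_simps add_eq_0_iff)
  ultimately have "n\<^sup>2 = 2 * (F 7 0 * F 7 0 * n + n * n)" by (metis of_real_eq_iff)
  then have "n * (2 * (F 7 0)\<^sup>2 + n) = 0" by (simp add: power2_eq_square algebra_simps)
  moreover have "0 < 2 * (F 7 0)\<^sup>2 + n" using n(2,3) by (simp add: add_nonneg_pos)
  ultimately show False using n(2) by simp
qed

end

lemma normalised_phi_std:
  fixes e :: "nat \<Rightarrow> GD"
  assumes e: "is_basis e"
  shows "(\<lambda>vs. wedge 2 (omega_std e) (coform e [7]) vs + rho_plus_std e vs) = phi_std e"
proof
  fix vs
  have c: "is_form (length js) (coform e js)" for js by (rule is_form_coform[OF e])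
  have add: "is_form k (\<lambda>vs. \<alpha> vs + \<beta> vs)" "is_form k (\<lambda>vs. \<alpha> vs - \<beta> vs)"
    if "is_form k \<alpha>" "is_form k \<beta>" for k and \<alpha> \<beta> :: "GD form"
    using is_form_comb[OF that, of 1 1] is_form_comb[OF that, of 1 "-1"] by simp_all
  have c2: "is_form 2 (coform e [i, j])" and c3: "is_form 3 (coform e [i, j, k])" for i j k
    using c[of "[i, j]"] c[of "[i, j, k]"] by (simp_all add: eval_nat_numeral del: coform.simps)
  have c1: "is_form 1 (coform e [7])" using c[of "[7]"] by (simp del: coform.simps)
  have "is_form 2 (omega_std e)" unfolding omega_std_def[abs_def] by (intro add c2)
  then have w: "is_form 3 (wedge 2 (omega_std e) (coform e [7]))" using is_form_wedge[OF _ c1] by fastforce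
  have r: "is_form 3 (rho_plus_std e)" unfolding rho_plus_std_def[abs_def] by (intro add c3)
  show "wedge 2 (omega_std e) (coform e [7]) vs + rho_plus_std e vs = phi_std e vs"
  proof (cases "length vs = 3")
    case True
    then obtain u v x where vs: "vs = [u, v, x]" by (auto simp: eval_nat_numeral length_Suc_conv)
    have "wedge 2 (omega_std e) (coform e [7]) [u, v, x] =
        coordinate e 7 x * omega_std e [u, v] - coordinate e 7 v * omega_std e [u, x] + coordinate e 7 u * omega_std e [v, x]"
      by (simp only: wedge_two_Cons wedge_one_Cons wedge_two_Nil wedge_one_Nil iota_def coform_one) simp
    then show ?thesis
      unfolding vs phi_std_eval rho_plus_std_def omega_std_def coform_three coform_two
      by (simp add: algebra_simps)
  next
    case False
    then show ?thesis using is_form_length[OF w] is_form_length[OF r] is_form_length[OF is_form_phi_std[OF e]] by simp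
  qed
qed

theorem theorem1p8:
  fixes D :: "real ^ 6 \<Rightarrow> real ^ 6"
    and \<phi> :: "GD \<Rightarrow> GD form"
    and f :: "GD \<Rightarrow> real"
    and lam :: real
  assumes "linear D"
    and "G2_structure \<phi>"
    and "left_invariant_form D \<phi>"
    and "normalised (\<phi> 0)"
    and "closed_gradient_laplacian_soliton \<phi> f lam"
    and "\<not> torsion_free \<phi>"
    and "\<not> f constant_on UNIV"
  shows "\<exists>k K h F. riemannian_product_isometry k K h (\<lambda>p. g2_metric (\<phi> p)) F \<and> constant_on_N K F f"
proof -
  obtain e where e: "is_basis e" "e 7 = (0, 1)" "\<forall>i\<in>{1..6}. snd (e i) = 0"
    and \<phi>0: "\<phi> 0 = (\<lambda>vs. wedge 2 (omega_std e) (coform e [7]) vs + rho_plus_std e vs)"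
    using assms(4) unfolding normalised_def by blast
  have "\<phi> 0 = phi_std e" unfolding \<phi>0 by (rule normalised_phi_std[OF e(1)])
  then interpret adapted_soliton D \<phi> f lam e
    unfolding adapted_soliton_def using assms(1,3,5) e by blast
  show ?thesis using is_torsion_free assms(6) by blast
qed

end
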